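(* Let $T$ be a theory in the language of second-order arithmetic such that: (i) $T$ extends $\Sigma^1_1\text{-}\mathsf{AC}_0$; (ii) $T$ is $\Pi^1_1$-sound; and (iii) $T$ is $\Sigma^1_1$-definable, say by the $\Sigma^1_1$ formula $\tau$. Then $T$ does not prove its own $\Pi^1_1$-soundness, i.e. $T \nvdash \mathsf{RFN}_{\Pi^1_1}(T)$, where $\mathsf{RFN}_{\Pi^1_1}(T)$ is formulated using $\tau$ as the definition of $T$.
   Context: The language is that of second-order arithmetic, with standard structure $(\mathbb{N},\mathcal{P}(\mathbb{N}))$; $\Sigma^1_1$ and $\Pi^1_1$ are the lightface classes (no set parameters), and "true" means true in the standard structure. $\Sigma^1_1\text{-}\mathsf{AC}_0$ is the theory whose axioms are those of $\mathsf{ACA}_0$ plus every instance of the schema $$\forall n\, \exists X\, \varphi(n,X) \to \exists Y\, \forall n\, \varphi\big(n,(Y)_n\big),$$ where $\varphi(n,X)$ is a $\Sigma^1_1$ formula in which $Y$ does not occur, and $(Y)_n=\{i \mid (i,n)\in Y\}$. A theory $T$ is $\Pi^1_1$-sound if every $\Pi^1_1$ sentence provable in $T$ is true. $T$ is $\Sigma^1_1$-definable if there is a $\Sigma^1_1$ formula $\tau(x)$ that defines, over the standard structure, the set of (Gödel numbers of) axioms of $T$. For such a $\tau$, $\mathsf{Pr}_T(x)$ is the standard arithmetized provability formula, "there is a (finite) proof of $x$ from axioms satisfying $\tau$". $\mathsf{True}_{\Pi^1_1}$ is the standard partial truth predicate for $\Pi^1_1$ sentences (available in $\mathsf{ACA}_0$).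 The sentence expressing the $\Pi^1_1$-soundness of $T$ is $$\mathsf{RFN}_{\Pi^1_1}(T) := \forall \varphi\in\Pi^1_1\, \big(\mathsf{Pr}_T(\varphi)\to \mathsf{True}_{\Pi^1_1}(\varphi)\big).$$ *)

theory Defs
  imports Main
begin

section \<open>The language of second-order arithmetic\<close>

text \<open>
  De Bruijn syntax with two independent index spaces, one for number variables and one for set
  variables.  A number quantifier binds the number variable 0 of its body and leaves set indices
  alone; a set quantifier binds the set variable 0 and leaves number indices alone.
\<close>

datatype tm = Var nat | Zero | One
  | Add tm tm (infixl "\<^bold>+" 65)
  | Mul tm tm (infixl "\<^bold>*" 70)

datatype fm =
    Eq tm tm (infix "\<^bold>=" 50)
  | Lt tm tm (infix "\<^bold><" 50)
  | In tm nat (infix "\<^bold>\<in>" 50)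
  | Fls
  | Imp fm fm (infixr "\<^bold>\<longrightarrow>" 25)
  | AllN fm
  | AllS fm

definition Neg :: "fm \<Rightarrow> fm" ("\<^bold>\<not> _" [40] 40) where
  "(\<^bold>\<not> a) = (a \<^bold>\<longrightarrow> Fls)"

definition Or :: "fm \<Rightarrow> fm \<Rightarrow> fm" (infixr "\<^bold>\<or>" 30) where
  "(a \<^bold>\<or> b) = (\<^bold>\<not> a \<^bold>\<longrightarrow> b)"

definition And :: "fm \<Rightarrow> fm \<Rightarrow> fm" (infixr "\<^bold>\<and>" 35) where
  "(a \<^bold>\<and> b) = (\<^bold>\<not> (a \<^bold>\<longrightarrow> \<^bold>\<not> b))"

definition Iff :: "fm \<Rightarrow> fm \<Rightarrow> fm" (infix "\<^bold>\<longleftrightarrow>" 25) where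
  "(a \<^bold>\<longleftrightarrow> b) = ((a \<^bold>\<longrightarrow> b) \<^bold>\<and> (b \<^bold>\<longrightarrow> a))"

definition ExN :: "fm \<Rightarrow> fm" where
  "ExN a = (\<^bold>\<not> AllN (\<^bold>\<not> a))"

definition ExS :: "fm \<Rightarrow> fm" where
  "ExS a = (\<^bold>\<not> AllS (\<^bold>\<not> a))"

definition AllNs :: "nat \<Rightarrow> fm \<Rightarrow> fm" where
  "AllNs n = AllN ^^ n"

definition ExNs :: "nat \<Rightarrow> fm \<Rightarrow> fm" where
  "ExNs n = ExN ^^ n"

definition Ors :: "fm list \<Rightarrow> fm" where
  "Ors as = foldr Or as Fls"

definition Ands :: "fm list \<Rightarrow> fm" where
  "Ands as = foldr And as (\<^bold>\<not> Fls)"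

subsection \<open>Truth in the standard structure\<close>

text \<open>\<open>case_nat x e\<close> is the environment \<open>e\<close> with \<open>x\<close> pushed at index 0.\<close>

primrec val :: "(nat \<Rightarrow> nat) \<Rightarrow> tm \<Rightarrow> nat" where
  "val e (Var i) = e i"
| "val e Zero = 0"
| "val e One = 1"
| "val e (s \<^bold>+ t) = val e s + val e t"
| "val e (s \<^bold>* t) = val e s * val e t"

primrec sat :: "(nat \<Rightarrow> nat) \<Rightarrow> (nat \<Rightarrow> nat set) \<Rightarrow> fm \<Rightarrow> bool" where
  "sat e E (s \<^bold>= t) \<longleftrightarrow> val e s = val e t"
| "sat e E (s \<^bold>< t) \<longleftrightarrow> val e s < val e t"
| "sat e E (t \<^bold>\<in> i) \<longleftrightarrow> val e t \<in> E i"
| "sat e E Fls \<longleftrightarrow> False"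
| "sat e E (a \<^bold>\<longrightarrow> b) \<longleftrightarrow> (sat e E a \<longrightarrow> sat e E b)"
| "sat e E (AllN a) \<longleftrightarrow> (\<forall>x. sat (case_nat x e) E a)"
| "sat e E (AllS a) \<longleftrightarrow> (\<forall>X. sat e (case_nat X E) a)"

text \<open>For sentences, the only formulas to which it is applied, the environment is irrelevant.\<close>

definition true_N :: "fm \<Rightarrow> bool" where
  "true_N a \<longleftrightarrow> sat (\<lambda>_. 0) (\<lambda>_. {}) a"

subsection \<open>Free variables and syntactic classes\<close>

text \<open>\<open>bounded m n a\<close>: the free number variables of \<open>a\<close> are below \<open>m\<close>, its free set variables
  below \<open>n\<close>.\<close>

primrec bounded_tm :: "nat \<Rightarrow> tm \<Rightarrow> bool" where
  "bounded_tm m (Var i) \<longleftrightarrow> i < m"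
| "bounded_tm m Zero \<longleftrightarrow> True"
| "bounded_tm m One \<longleftrightarrow> True"
| "bounded_tm m (s \<^bold>+ t) \<longleftrightarrow> bounded_tm m s \<and> bounded_tm m t"
| "bounded_tm m (s \<^bold>* t) \<longleftrightarrow> bounded_tm m s \<and> bounded_tm m t"

primrec bounded :: "nat \<Rightarrow> nat \<Rightarrow> fm \<Rightarrow> bool" where
  "bounded m n (s \<^bold>= t) \<longleftrightarrow> bounded_tm m s \<and> bounded_tm m t"
| "bounded m n (s \<^bold>< t) \<longleftrightarrow> bounded_tm m s \<and> bounded_tm m t"
| "bounded m n (t \<^bold>\<in> i) \<longleftrightarrow> bounded_tm m t \<and> i < n"
| "bounded m n Fls \<longleftrightarrow> True"
| "bounded m n (a \<^bold>\<longrightarrow> b) \<longleftrightarrow> bounded m n a \<and> bounded m n b"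
| "bounded m n (AllN a) \<longleftrightarrow> bounded (Suc m) n a"
| "bounded m n (AllS a) \<longleftrightarrow> bounded m (Suc n) a"

definition sentence :: "fm \<Rightarrow> bool" where
  "sentence a \<longleftrightarrow> bounded 0 0 a"

primrec arithmetical :: "fm \<Rightarrow> bool" where
  "arithmetical (s \<^bold>= t) \<longleftrightarrow> True"
| "arithmetical (s \<^bold>< t) \<longleftrightarrow> True"
| "arithmetical (t \<^bold>\<in> i) \<longleftrightarrow> True"
| "arithmetical Fls \<longleftrightarrow> True"
| "arithmetical (a \<^bold>\<longrightarrow> b) \<longleftrightarrow> arithmetical a \<and> arithmetical b"
| "arithmetical (AllN a) \<longleftrightarrow> arithmetical a"
| "arithmetical (AllS a) \<longleftrightarrow> False"

text \<open>Parameters are allowed in these two classes; the lightface classes add a bound on the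
  free variables.\<close>

definition sigma11 :: "fm \<Rightarrow> bool" where
  "sigma11 a \<longleftrightarrow> (\<exists>b. arithmetical b \<and> a = ExS b)"

definition pi11 :: "fm \<Rightarrow> bool" where
  "pi11 a \<longleftrightarrow> (\<exists>b. arithmetical b \<and> a = AllS b)"

definition pi11_sentence :: "fm \<Rightarrow> bool" where
  "pi11_sentence a \<longleftrightarrow> pi11 a \<and> sentence a"

subsection \<open>Lifting and substitution\<close>

primrec lift_tm :: "nat \<Rightarrow> tm \<Rightarrow> tm" where
  "lift_tm k (Var i) = Var (if i < k then i else i + 1)"
| "lift_tm k Zero = Zero"
| "lift_tm k One = One"
| "lift_tm k (s \<^bold>+ t) = lift_tm k s \<^bold>+ lift_tm k t"
| "lift_tm k (s \<^bold>* t) = lift_tm k s \<^bold>* lift_tm k t"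

primrec liftN :: "nat \<Rightarrow> fm \<Rightarrow> fm" where
  "liftN k (s \<^bold>= t) = (lift_tm k s \<^bold>= lift_tm k t)"
| "liftN k (s \<^bold>< t) = (lift_tm k s \<^bold>< lift_tm k t)"
| "liftN k (t \<^bold>\<in> i) = (lift_tm k t \<^bold>\<in> i)"
| "liftN k Fls = Fls"
| "liftN k (a \<^bold>\<longrightarrow> b) = (liftN k a \<^bold>\<longrightarrow> liftN k b)"
| "liftN k (AllN a) = AllN (liftN (k + 1) a)"
| "liftN k (AllS a) = AllS (liftN k a)"

primrec liftS :: "nat \<Rightarrow> fm \<Rightarrow> fm" where
  "liftS k (s \<^bold>= t) = (s \<^bold>= t)"
| "liftS k (s \<^bold>< t) = (s \<^bold>< t)"
| "liftS k (t \<^bold>\<in> i) = (t \<^bold>\<in> (if i < k then i else i + 1))"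
| "liftS k Fls = Fls"
| "liftS k (a \<^bold>\<longrightarrow> b) = (liftS k a \<^bold>\<longrightarrow> liftS k b)"
| "liftS k (AllN a) = AllN (liftS k a)"
| "liftS k (AllS a) = AllS (liftS (k + 1) a)"

primrec subst_tm :: "nat \<Rightarrow> tm \<Rightarrow> tm \<Rightarrow> tm" where
  "subst_tm k u (Var i) = (if i < k then Var i else if i = k then u else Var (i - 1))"
| "subst_tm k u Zero = Zero"
| "subst_tm k u One = One"
| "subst_tm k u (s \<^bold>+ t) = subst_tm k u s \<^bold>+ subst_tm k u t"
| "subst_tm k u (s \<^bold>* t) = subst_tm k u s \<^bold>* subst_tm k u t"

primrec substN :: "nat \<Rightarrow> tm \<Rightarrow> fm \<Rightarrow> fm" where
  "substN k u (s \<^bold>= t) = (subst_tm k u s \<^bold>= subst_tm k u t)"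
| "substN k u (s \<^bold>< t) = (subst_tm k u s \<^bold>< subst_tm k u t)"
| "substN k u (t \<^bold>\<in> i) = (subst_tm k u t \<^bold>\<in> i)"
| "substN k u Fls = Fls"
| "substN k u (a \<^bold>\<longrightarrow> b) = (substN k u a \<^bold>\<longrightarrow> substN k u b)"
| "substN k u (AllN a) = AllN (substN (k + 1) (lift_tm 0 u) a)"
| "substN k u (AllS a) = AllS (substN k u a)"

primrec substS :: "nat \<Rightarrow> nat \<Rightarrow> fm \<Rightarrow> fm" where
  "substS k j (s \<^bold>= t) = (s \<^bold>= t)"
| "substS k j (s \<^bold>< t) = (s \<^bold>< t)"
| "substS k j (t \<^bold>\<in> i) = (t \<^bold>\<in> (if i < k then i else if i = k then j else i - 1))"
| "substS k j Fls = Fls"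
| "substS k j (a \<^bold>\<longrightarrow> b) = (substS k j a \<^bold>\<longrightarrow> substS k j b)"
| "substS k j (AllN a) = AllN (substS k j a)"
| "substS k j (AllS a) = AllS (substS (k + 1) (j + 1) a)"

section \<open>Provability\<close>

text \<open>
  A Hilbert calculus for two-sorted classical logic with equality on numbers.  A theory is given
  by its set of axioms; because of the two generalization rules, an axiom with free variables
  has the same force as its universal closure.
\<close>

inductive logical_axiom :: "fm \<Rightarrow> bool" where
  "logical_axiom (a \<^bold>\<longrightarrow> b \<^bold>\<longrightarrow> a)"
| "logical_axiom ((a \<^bold>\<longrightarrow> b \<^bold>\<longrightarrow> c) \<^bold>\<longrightarrow> (a \<^bold>\<longrightarrow> b) \<^bold>\<longrightarrow> a \<^bold>\<longrightarrow> c)"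
| "logical_axiom (((a \<^bold>\<longrightarrow> Fls) \<^bold>\<longrightarrow> Fls) \<^bold>\<longrightarrow> a)"
| "logical_axiom (AllN a \<^bold>\<longrightarrow> substN 0 t a)"
| "logical_axiom (AllN (liftN 0 a \<^bold>\<longrightarrow> b) \<^bold>\<longrightarrow> a \<^bold>\<longrightarrow> AllN b)"
| "logical_axiom (AllS a \<^bold>\<longrightarrow> substS 0 j a)"
| "logical_axiom (AllS (liftS 0 a \<^bold>\<longrightarrow> b) \<^bold>\<longrightarrow> a \<^bold>\<longrightarrow> AllS b)"
| "logical_axiom (t \<^bold>= t)"
| "logical_axiom (s \<^bold>= t \<^bold>\<longrightarrow> substN 0 s a \<^bold>\<longrightarrow> substN 0 t a)"

inductive proves :: "fm set \<Rightarrow> fm \<Rightarrow> bool" (infix "\<turnstile>" 20) for T where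
  ax: "a \<in> T \<Longrightarrow> T \<turnstile> a"
| logical: "logical_axiom a \<Longrightarrow> T \<turnstile> a"
| mp: "T \<turnstile> a \<Longrightarrow> T \<turnstile> a \<^bold>\<longrightarrow> b \<Longrightarrow> T \<turnstile> b"
| genN: "T \<turnstile> a \<Longrightarrow> T \<turnstile> AllN a"
| genS: "T \<turnstile> a \<Longrightarrow> T \<turnstile> AllS a"

definition extends :: "fm set \<Rightarrow> fm set \<Rightarrow> bool" where
  "extends T U \<longleftrightarrow> (\<forall>a\<in>U. T \<turnstile> a)"

section \<open>The base theories\<close>

definition basic_axioms :: "fm set" where
  "basic_axioms =
    {\<^bold>\<not> (Var 0 \<^bold>+ One \<^bold>= Zero),
     Var 0 \<^bold>+ One \<^bold>= Var 1 \<^bold>+ One \<^bold>\<longrightarrow> Var 0 \<^bold>= Var 1,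
     Var 0 \<^bold>+ Zero \<^bold>= Var 0,
     Var 0 \<^bold>+ (Var 1 \<^bold>+ One) \<^bold>= (Var 0 \<^bold>+ Var 1) \<^bold>+ One,
     Var 0 \<^bold>* Zero \<^bold>= Zero,
     Var 0 \<^bold>* (Var 1 \<^bold>+ One) \<^bold>= (Var 0 \<^bold>* Var 1) \<^bold>+ Var 0,
     \<^bold>\<not> (Var 0 \<^bold>< Zero),
     Var 0 \<^bold>< Var 1 \<^bold>+ One \<^bold>\<longleftrightarrow> (Var 0 \<^bold>< Var 1 \<^bold>\<or> Var 0 \<^bold>= Var 1)}"

definition induction_axiom :: fm where
  "induction_axiom =
    (Zero \<^bold>\<in> 0 \<^bold>\<and> AllN (Var 0 \<^bold>\<in> 0 \<^bold>\<longrightarrow> Var 0 \<^bold>+ One \<^bold>\<in> 0) \<^bold>\<longrightarrow> AllN (Var 0 \<^bold>\<in> 0))"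

text \<open>In comprehension for \<open>a\<close> the number variable 0 of \<open>a\<close> is the element variable; lifting the
  set variables makes room for the set being asserted to exist, which hence is not free in \<open>a\<close>.\<close>

definition ACA0 :: "fm set" where
  "ACA0 = basic_axioms \<union> {induction_axiom} \<union>
     {ExS (AllN (Var 0 \<^bold>\<in> 0 \<^bold>\<longleftrightarrow> liftS 0 a)) | a. arithmetical a}"

text \<open>The pairing \<open>(m, n) = (m + n)\<^sup>2 + m\<close>, as a term; tuples nest to the right.\<close>

definition pairt :: "tm \<Rightarrow> tm \<Rightarrow> tm" (infixr "\<star>" 55) where
  "s \<star> t = (s \<^bold>+ t) \<^bold>* (s \<^bold>+ t) \<^bold>+ s"

text \<open>\<open>slice p k a\<close> replaces every atom \<open>t \<in> X\<close>, \<open>X\<close> the set variable \<open>k\<close>, by \<open>(t, n) \<in> X\<close>, \<open>n\<close> the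
  number variable \<open>p\<close>.  So if \<open>\<phi>(n, X)\<close> has \<open>n\<close> and \<open>X\<close> as variables 0, then \<open>slice 0 0 \<phi>\<close> is
  \<open>\<phi>(n, (Y)\<^sub>n)\<close> with \<open>Y\<close> as set variable 0.\<close>

primrec slice :: "nat \<Rightarrow> nat \<Rightarrow> fm \<Rightarrow> fm" where
  "slice p k (s \<^bold>= t) = (s \<^bold>= t)"
| "slice p k (s \<^bold>< t) = (s \<^bold>< t)"
| "slice p k (t \<^bold>\<in> i) = ((if i = k then t \<star> Var p else t) \<^bold>\<in> i)"
| "slice p k Fls = Fls"
| "slice p k (a \<^bold>\<longrightarrow> b) = (slice p k a \<^bold>\<longrightarrow> slice p k b)"
| "slice p k (AllN a) = AllN (slice (p + 1) k a)"
| "slice p k (AllS a) = AllS (slice p (k + 1) a)"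

definition Sigma11_AC0 :: "fm set" where
  "Sigma11_AC0 = ACA0 \<union>
     {AllN (ExS a) \<^bold>\<longrightarrow> ExS (AllN (slice 0 0 a)) | a. sigma11 a}"

section \<open>Goedel numbering\<close>

definition pair :: "nat \<Rightarrow> nat \<Rightarrow> nat" where
  "pair m n = (m + n) * (m + n) + m"

primrec code_tm :: "tm \<Rightarrow> nat" where
  "code_tm (Var i) = pair 0 i"
| "code_tm Zero = pair 1 0"
| "code_tm One = pair 2 0"
| "code_tm (s \<^bold>+ t) = pair 3 (pair (code_tm s) (code_tm t))"
| "code_tm (s \<^bold>* t) = pair 4 (pair (code_tm s) (code_tm t))"

primrec code :: "fm \<Rightarrow> nat" where
  "code (s \<^bold>= t) = pair 5 (pair (code_tm s) (code_tm t))"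
| "code (s \<^bold>< t) = pair 6 (pair (code_tm s) (code_tm t))"
| "code (t \<^bold>\<in> i) = pair 7 (pair (code_tm t) i)"
| "code Fls = pair 8 0"
| "code (a \<^bold>\<longrightarrow> b) = pair 9 (pair (code a) (code b))"
| "code (AllN a) = pair 10 (code a)"
| "code (AllS a) = pair 11 (code a)"

definition pi11_sound :: "fm set \<Rightarrow> bool" where
  "pi11_sound T \<longleftrightarrow> (\<forall>a. pi11_sentence a \<and> (T \<turnstile> a) \<longrightarrow> true_N a)"

definition defines_axioms :: "fm \<Rightarrow> fm set \<Rightarrow> bool" where
  "defines_axioms \<tau> T \<longleftrightarrow> (\<forall>n. sat (\<lambda>_. n) (\<lambda>_. {}) \<tau> \<longleftrightarrow> n \<in> code ` T)"

text \<open>A lightface \<open>\<Sigma>\<^sup>1\<^sub>1\<close> formula whose only free variable is the number variable 0.\<close>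

definition sigma11_definition :: "fm \<Rightarrow> fm set \<Rightarrow> bool" where
  "sigma11_definition \<tau> T \<longleftrightarrow> sigma11 \<tau> \<and> bounded 1 0 \<tau> \<and> defines_axioms \<tau> T"

section \<open>Arithmetized syntax\<close>

text \<open>
  From here on, the functions build formulas of the object language.  Arguments of type \<open>tm\<close> are
  arbitrary terms; \<open>t \<up> n\<close> is \<open>t\<close> moved under \<open>n\<close> further number quantifiers.  Inside \<open>ExNs n\<close>,
  the variables \<open>Var (n - 1), \<dots>, Var 0\<close> are the quantified ones, outermost first.
\<close>

primrec up :: "tm \<Rightarrow> nat \<Rightarrow> tm" (infix "\<up>" 80) where
  "Var i \<up> n = Var (i + n)"
| "Zero \<up> n = Zero"
| "One \<up> n = One"
| "(s \<^bold>+ t) \<up> n = s \<up> n \<^bold>+ t \<up> n"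
| "(s \<^bold>* t) \<up> n = s \<up> n \<^bold>* t \<up> n"

primrec num :: "nat \<Rightarrow> tm" where
  "num 0 = Zero"
| "num (Suc n) = num n \<^bold>+ One"

definition cVar :: "tm \<Rightarrow> tm" where "cVar i = num 0 \<star> i"
definition cZero :: tm where "cZero = num 1 \<star> num 0"
definition cOne :: tm where "cOne = num 2 \<star> num 0"
definition cAdd :: "tm \<Rightarrow> tm \<Rightarrow> tm" where "cAdd s t = num 3 \<star> s \<star> t"
definition cMul :: "tm \<Rightarrow> tm \<Rightarrow> tm" where "cMul s t = num 4 \<star> s \<star> t"
definition cEq :: "tm \<Rightarrow> tm \<Rightarrow> tm" where "cEq s t = num 5 \<star> s \<star> t"
definition cLt :: "tm \<Rightarrow> tm \<Rightarrow> tm" where "cLt s t = num 6 \<star> s \<star> t"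
definition cIn :: "tm \<Rightarrow> tm \<Rightarrow> tm" where "cIn t i = num 7 \<star> t \<star> i"
definition cFls :: tm where "cFls = num 8 \<star> num 0"
definition cImp :: "tm \<Rightarrow> tm \<Rightarrow> tm" where "cImp a b = num 9 \<star> a \<star> b"
definition cAllN :: "tm \<Rightarrow> tm" where "cAllN a = num 10 \<star> a"
definition cAllS :: "tm \<Rightarrow> tm" where "cAllS a = num 11 \<star> a"

subsection \<open>Finite sequences and inductively generated sets\<close>

text \<open>Goedel's beta function: \<open>x\<close> is the remainder of \<open>c\<close> modulo \<open>1 + (i + 1) d\<close>.\<close>

definition Beta :: "tm \<Rightarrow> tm \<Rightarrow> tm \<Rightarrow> tm \<Rightarrow> fm" where
  "Beta c d i x = (let m = One \<^bold>+ (i \<^bold>+ One) \<^bold>* d in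
     x \<^bold>< m \<^bold>\<and> ExN (c \<up> 1 \<^bold>= Var 0 \<^bold>* m \<up> 1 \<^bold>+ x \<up> 1))"

text \<open>\<open>z\<close> occurs in the sequence coded by \<open>(c, d)\<close> at a position before \<open>i\<close>.\<close>

definition Earlier :: "tm \<Rightarrow> tm \<Rightarrow> tm \<Rightarrow> tm \<Rightarrow> fm" where
  "Earlier c d i z = ExN (Var 0 \<^bold>< i \<up> 1 \<^bold>\<and> Beta (c \<up> 1) (d \<up> 1) (Var 0) (z \<up> 1))"

text \<open>
  \<open>Derivable step x\<close>: there is a finite sequence whose last element is \<open>x\<close> and each of whose
  elements \<open>y\<close> satisfies \<open>step E y\<close>.  Here \<open>E n z\<close>, for use under \<open>n\<close> additional number quantifiers
  inside \<open>step\<close>, says that \<open>z\<close> occurs before \<open>y\<close> in the sequence.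
\<close>

definition Derivable :: "((nat \<Rightarrow> tm \<Rightarrow> fm) \<Rightarrow> tm \<Rightarrow> fm) \<Rightarrow> tm \<Rightarrow> fm" where
  "Derivable step x = ExNs 3 (
     Beta (Var 2) (Var 1) (Var 0) (x \<up> 3) \<^bold>\<and>
     AllN (Var 0 \<^bold>< Var 1 \<^bold>+ One \<^bold>\<longrightarrow>
       ExN (Beta (Var 4) (Var 3) (Var 1) (Var 0) \<^bold>\<and>
         step (\<lambda>n. Earlier (Var (4 + n)) (Var (3 + n)) (Var (1 + n))) (Var 0))))"

subsection \<open>Terms, formulas, lifting and substitution\<close>

definition IsTm :: "tm \<Rightarrow> fm" where
  "IsTm = Derivable (\<lambda>E y. Ors
    [ExN (y \<up> 1 \<^bold>= cVar (Var 0)),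
     y \<^bold>= cZero,
     y \<^bold>= cOne,
     ExNs 2 (E 2 (Var 1) \<^bold>\<and> E 2 (Var 0) \<^bold>\<and>
       (y \<up> 2 \<^bold>= cAdd (Var 1) (Var 0) \<^bold>\<or> y \<up> 2 \<^bold>= cMul (Var 1) (Var 0)))])"

definition IsFm :: "tm \<Rightarrow> fm" where
  "IsFm = Derivable (\<lambda>E y. Ors
    [ExNs 2 (IsTm (Var 1) \<^bold>\<and> IsTm (Var 0) \<^bold>\<and>
       (y \<up> 2 \<^bold>= cEq (Var 1) (Var 0) \<^bold>\<or> y \<up> 2 \<^bold>= cLt (Var 1) (Var 0))),
     ExNs 2 (IsTm (Var 1) \<^bold>\<and> y \<up> 2 \<^bold>= cIn (Var 1) (Var 0)),
     y \<^bold>= cFls,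
     ExNs 2 (E 2 (Var 1) \<^bold>\<and> E 2 (Var 0) \<^bold>\<and> y \<up> 2 \<^bold>= cImp (Var 1) (Var 0)),
     ExN (E 1 (Var 0) \<^bold>\<and> (y \<up> 1 \<^bold>= cAllN (Var 0) \<^bold>\<or> y \<up> 1 \<^bold>= cAllS (Var 0)))])"

text \<open>Graphs of the syntactic operations, as sets of tuples: \<open>(k, t, lift_tm k t)\<close> for \<open>LiftTm\<close>,
  \<open>(k, u, a, substN k u a)\<close> for \<open>SubstN\<close>, and so on.\<close>

definition LiftTm :: "tm \<Rightarrow> fm" where
  "LiftTm = Derivable (\<lambda>E y. Ors
    [ExNs 2 (Var 0 \<^bold>< Var 1 \<^bold>\<and> y \<up> 2 \<^bold>= Var 1 \<star> cVar (Var 0) \<star> cVar (Var 0)),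
     ExNs 2 (\<^bold>\<not> (Var 0 \<^bold>< Var 1) \<^bold>\<and> y \<up> 2 \<^bold>= Var 1 \<star> cVar (Var 0) \<star> cVar (Var 0 \<^bold>+ One)),
     ExN (y \<up> 1 \<^bold>= Var 0 \<star> cZero \<star> cZero),
     ExN (y \<up> 1 \<^bold>= Var 0 \<star> cOne \<star> cOne),
     ExNs 5 (E 5 (Var 4 \<star> Var 3 \<star> Var 2) \<^bold>\<and> E 5 (Var 4 \<star> Var 1 \<star> Var 0) \<^bold>\<and>
       (y \<up> 5 \<^bold>= Var 4 \<star> cAdd (Var 3) (Var 1) \<star> cAdd (Var 2) (Var 0) \<^bold>\<or>
        y \<up> 5 \<^bold>= Var 4 \<star> cMul (Var 3) (Var 1) \<star> cMul (Var 2) (Var 0)))])"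

definition LiftN :: "tm \<Rightarrow> fm" where
  "LiftN = Derivable (\<lambda>E y. Ors
    [ExNs 5 (LiftTm (Var 4 \<star> Var 3 \<star> Var 2) \<^bold>\<and> LiftTm (Var 4 \<star> Var 1 \<star> Var 0) \<^bold>\<and>
       (y \<up> 5 \<^bold>= Var 4 \<star> cEq (Var 3) (Var 1) \<star> cEq (Var 2) (Var 0) \<^bold>\<or>
        y \<up> 5 \<^bold>= Var 4 \<star> cLt (Var 3) (Var 1) \<star> cLt (Var 2) (Var 0))),
     ExNs 4 (LiftTm (Var 3 \<star> Var 2 \<star> Var 1) \<^bold>\<and>
       y \<up> 4 \<^bold>= Var 3 \<star> cIn (Var 2) (Var 0) \<star> cIn (Var 1) (Var 0)),
     ExN (y \<up> 1 \<^bold>= Var 0 \<star> cFls \<star> cFls),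
     ExNs 5 (E 5 (Var 4 \<star> Var 3 \<star> Var 2) \<^bold>\<and> E 5 (Var 4 \<star> Var 1 \<star> Var 0) \<^bold>\<and>
       y \<up> 5 \<^bold>= Var 4 \<star> cImp (Var 3) (Var 1) \<star> cImp (Var 2) (Var 0)),
     ExNs 3 (E 3 ((Var 2 \<^bold>+ One) \<star> Var 1 \<star> Var 0) \<^bold>\<and>
       y \<up> 3 \<^bold>= Var 2 \<star> cAllN (Var 1) \<star> cAllN (Var 0)),
     ExNs 3 (E 3 (Var 2 \<star> Var 1 \<star> Var 0) \<^bold>\<and>
       y \<up> 3 \<^bold>= Var 2 \<star> cAllS (Var 1) \<star> cAllS (Var 0))])"

definition LiftS :: "tm \<Rightarrow> fm" where
  "LiftS = Derivable (\<lambda>E y. Ors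
    [ExNs 3 (IsTm (Var 1) \<^bold>\<and> IsTm (Var 0) \<^bold>\<and>
       (y \<up> 3 \<^bold>= Var 2 \<star> cEq (Var 1) (Var 0) \<star> cEq (Var 1) (Var 0) \<^bold>\<or>
        y \<up> 3 \<^bold>= Var 2 \<star> cLt (Var 1) (Var 0) \<star> cLt (Var 1) (Var 0))),
     ExNs 3 (IsTm (Var 1) \<^bold>\<and> Var 0 \<^bold>< Var 2 \<^bold>\<and>
       y \<up> 3 \<^bold>= Var 2 \<star> cIn (Var 1) (Var 0) \<star> cIn (Var 1) (Var 0)),
     ExNs 3 (IsTm (Var 1) \<^bold>\<and> \<^bold>\<not> (Var 0 \<^bold>< Var 2) \<^bold>\<and>
       y \<up> 3 \<^bold>= Var 2 \<star> cIn (Var 1) (Var 0) \<star> cIn (Var 1) (Var 0 \<^bold>+ One)),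
     ExN (y \<up> 1 \<^bold>= Var 0 \<star> cFls \<star> cFls),
     ExNs 5 (E 5 (Var 4 \<star> Var 3 \<star> Var 2) \<^bold>\<and> E 5 (Var 4 \<star> Var 1 \<star> Var 0) \<^bold>\<and>
       y \<up> 5 \<^bold>= Var 4 \<star> cImp (Var 3) (Var 1) \<star> cImp (Var 2) (Var 0)),
     ExNs 3 (E 3 (Var 2 \<star> Var 1 \<star> Var 0) \<^bold>\<and>
       y \<up> 3 \<^bold>= Var 2 \<star> cAllN (Var 1) \<star> cAllN (Var 0)),
     ExNs 3 (E 3 ((Var 2 \<^bold>+ One) \<star> Var 1 \<star> Var 0) \<^bold>\<and>
       y \<up> 3 \<^bold>= Var 2 \<star> cAllS (Var 1) \<star> cAllS (Var 0))])"

definition SubstTm :: "tm \<Rightarrow> fm" where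
  "SubstTm = Derivable (\<lambda>E y. Ors
    [ExNs 3 (Var 0 \<^bold>< Var 2 \<^bold>\<and> y \<up> 3 \<^bold>= Var 2 \<star> Var 1 \<star> cVar (Var 0) \<star> cVar (Var 0)),
     ExNs 2 (y \<up> 2 \<^bold>= Var 1 \<star> Var 0 \<star> cVar (Var 1) \<star> Var 0),
     ExNs 3 (\<^bold>\<not> (Var 0 \<^bold>< Var 2) \<^bold>\<and> y \<up> 3 \<^bold>= Var 2 \<star> Var 1 \<star> cVar (Var 0 \<^bold>+ One) \<star> cVar (Var 0)),
     ExNs 2 (y \<up> 2 \<^bold>= Var 1 \<star> Var 0 \<star> cZero \<star> cZero),
     ExNs 2 (y \<up> 2 \<^bold>= Var 1 \<star> Var 0 \<star> cOne \<star> cOne),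
     ExNs 6 (E 6 (Var 5 \<star> Var 4 \<star> Var 3 \<star> Var 2) \<^bold>\<and> E 6 (Var 5 \<star> Var 4 \<star> Var 1 \<star> Var 0) \<^bold>\<and>
       (y \<up> 6 \<^bold>= Var 5 \<star> Var 4 \<star> cAdd (Var 3) (Var 1) \<star> cAdd (Var 2) (Var 0) \<^bold>\<or>
        y \<up> 6 \<^bold>= Var 5 \<star> Var 4 \<star> cMul (Var 3) (Var 1) \<star> cMul (Var 2) (Var 0)))])"

definition SubstN :: "tm \<Rightarrow> fm" where
  "SubstN = Derivable (\<lambda>E y. Ors
    [ExNs 6 (SubstTm (Var 5 \<star> Var 4 \<star> Var 3 \<star> Var 2) \<^bold>\<and> SubstTm (Var 5 \<star> Var 4 \<star> Var 1 \<star> Var 0) \<^bold>\<and>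
       (y \<up> 6 \<^bold>= Var 5 \<star> Var 4 \<star> cEq (Var 3) (Var 1) \<star> cEq (Var 2) (Var 0) \<^bold>\<or>
        y \<up> 6 \<^bold>= Var 5 \<star> Var 4 \<star> cLt (Var 3) (Var 1) \<star> cLt (Var 2) (Var 0))),
     ExNs 5 (SubstTm (Var 4 \<star> Var 3 \<star> Var 2 \<star> Var 1) \<^bold>\<and>
       y \<up> 5 \<^bold>= Var 4 \<star> Var 3 \<star> cIn (Var 2) (Var 0) \<star> cIn (Var 1) (Var 0)),
     ExNs 2 (y \<up> 2 \<^bold>= Var 1 \<star> Var 0 \<star> cFls \<star> cFls),
     ExNs 6 (E 6 (Var 5 \<star> Var 4 \<star> Var 3 \<star> Var 2) \<^bold>\<and> E 6 (Var 5 \<star> Var 4 \<star> Var 1 \<star> Var 0) \<^bold>\<and>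
       y \<up> 6 \<^bold>= Var 5 \<star> Var 4 \<star> cImp (Var 3) (Var 1) \<star> cImp (Var 2) (Var 0)),
     ExNs 5 (LiftTm (Zero \<star> Var 3 \<star> Var 2) \<^bold>\<and> E 5 ((Var 4 \<^bold>+ One) \<star> Var 2 \<star> Var 1 \<star> Var 0) \<^bold>\<and>
       y \<up> 5 \<^bold>= Var 4 \<star> Var 3 \<star> cAllN (Var 1) \<star> cAllN (Var 0)),
     ExNs 4 (E 4 (Var 3 \<star> Var 2 \<star> Var 1 \<star> Var 0) \<^bold>\<and>
       y \<up> 4 \<^bold>= Var 3 \<star> Var 2 \<star> cAllS (Var 1) \<star> cAllS (Var 0))])"

definition SubstS :: "tm \<Rightarrow> fm" where
  "SubstS = Derivable (\<lambda>E y. Ors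
    [ExNs 4 (IsTm (Var 1) \<^bold>\<and> IsTm (Var 0) \<^bold>\<and>
       (y \<up> 4 \<^bold>= Var 3 \<star> Var 2 \<star> cEq (Var 1) (Var 0) \<star> cEq (Var 1) (Var 0) \<^bold>\<or>
        y \<up> 4 \<^bold>= Var 3 \<star> Var 2 \<star> cLt (Var 1) (Var 0) \<star> cLt (Var 1) (Var 0))),
     ExNs 4 (IsTm (Var 1) \<^bold>\<and> Var 0 \<^bold>< Var 3 \<^bold>\<and>
       y \<up> 4 \<^bold>= Var 3 \<star> Var 2 \<star> cIn (Var 1) (Var 0) \<star> cIn (Var 1) (Var 0)),
     ExNs 3 (IsTm (Var 0) \<^bold>\<and>
       y \<up> 3 \<^bold>= Var 2 \<star> Var 1 \<star> cIn (Var 0) (Var 2) \<star> cIn (Var 0) (Var 1)),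
     ExNs 4 (IsTm (Var 1) \<^bold>\<and> \<^bold>\<not> (Var 0 \<^bold>< Var 3) \<^bold>\<and>
       y \<up> 4 \<^bold>= Var 3 \<star> Var 2 \<star> cIn (Var 1) (Var 0 \<^bold>+ One) \<star> cIn (Var 1) (Var 0)),
     ExNs 2 (y \<up> 2 \<^bold>= Var 1 \<star> Var 0 \<star> cFls \<star> cFls),
     ExNs 6 (E 6 (Var 5 \<star> Var 4 \<star> Var 3 \<star> Var 2) \<^bold>\<and> E 6 (Var 5 \<star> Var 4 \<star> Var 1 \<star> Var 0) \<^bold>\<and>
       y \<up> 6 \<^bold>= Var 5 \<star> Var 4 \<star> cImp (Var 3) (Var 1) \<star> cImp (Var 2) (Var 0)),
     ExNs 4 (E 4 (Var 3 \<star> Var 2 \<star> Var 1 \<star> Var 0) \<^bold>\<and>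
       y \<up> 4 \<^bold>= Var 3 \<star> Var 2 \<star> cAllN (Var 1) \<star> cAllN (Var 0)),
     ExNs 4 (E 4 ((Var 3 \<^bold>+ One) \<star> (Var 2 \<^bold>+ One) \<star> Var 1 \<star> Var 0) \<^bold>\<and>
       y \<up> 4 \<^bold>= Var 3 \<star> Var 2 \<star> cAllS (Var 1) \<star> cAllS (Var 0))])"

subsection \<open>The provability formula\<close>

definition LogAx :: "tm \<Rightarrow> fm" where
  "LogAx y = Ors
    [ExNs 2 (IsFm (Var 1) \<^bold>\<and> IsFm (Var 0) \<^bold>\<and>
       y \<up> 2 \<^bold>= cImp (Var 1) (cImp (Var 0) (Var 1))),
     ExNs 3 (IsFm (Var 2) \<^bold>\<and> IsFm (Var 1) \<^bold>\<and> IsFm (Var 0) \<^bold>\<and>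
       y \<up> 3 \<^bold>= cImp (cImp (Var 2) (cImp (Var 1) (Var 0)))
         (cImp (cImp (Var 2) (Var 1)) (cImp (Var 2) (Var 0)))),
     ExN (IsFm (Var 0) \<^bold>\<and> y \<up> 1 \<^bold>= cImp (cImp (cImp (Var 0) cFls) cFls) (Var 0)),
     ExNs 3 (IsTm (Var 2) \<^bold>\<and> SubstN (Zero \<star> Var 2 \<star> Var 1 \<star> Var 0) \<^bold>\<and>
       y \<up> 3 \<^bold>= cImp (cAllN (Var 1)) (Var 0)),
     ExNs 3 (LiftN (Zero \<star> Var 2 \<star> Var 1) \<^bold>\<and> IsFm (Var 0) \<^bold>\<and>
       y \<up> 3 \<^bold>= cImp (cAllN (cImp (Var 1) (Var 0))) (cImp (Var 2) (cAllN (Var 0)))),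
     ExNs 3 (SubstS (Zero \<star> Var 2 \<star> Var 1 \<star> Var 0) \<^bold>\<and>
       y \<up> 3 \<^bold>= cImp (cAllS (Var 1)) (Var 0)),
     ExNs 3 (LiftS (Zero \<star> Var 2 \<star> Var 1) \<^bold>\<and> IsFm (Var 0) \<^bold>\<and>
       y \<up> 3 \<^bold>= cImp (cAllS (cImp (Var 1) (Var 0))) (cImp (Var 2) (cAllS (Var 0)))),
     ExN (IsTm (Var 0) \<^bold>\<and> y \<up> 1 \<^bold>= cEq (Var 0) (Var 0)),
     ExNs 5 (IsTm (Var 4) \<^bold>\<and> IsTm (Var 3) \<^bold>\<and>
       SubstN (Zero \<star> Var 4 \<star> Var 2 \<star> Var 1) \<^bold>\<and> SubstN (Zero \<star> Var 3 \<star> Var 2 \<star> Var 0) \<^bold>\<and>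
       y \<up> 5 \<^bold>= cImp (cEq (Var 4) (Var 3)) (cImp (Var 1) (Var 0)))]"

definition Pr :: "fm \<Rightarrow> tm \<Rightarrow> fm" where
  "Pr \<tau> = Derivable (\<lambda>E y. Ors
    [substN 0 y \<tau>,
     LogAx y,
     ExN (E 1 (Var 0) \<^bold>\<and> E 1 (cImp (Var 0) (y \<up> 1))),
     ExN (E 1 (Var 0) \<^bold>\<and> y \<up> 1 \<^bold>= cAllN (Var 0)),
     ExN (E 1 (Var 0) \<^bold>\<and> y \<up> 1 \<^bold>= cAllS (Var 0))])"

subsection \<open>Codes of \<open>\<Pi>\<^sup>1\<^sub>1\<close> sentences\<close>

text \<open>Pairs \<open>(k, t)\<close>, \<open>t\<close> a term with variables below \<open>k\<close>.\<close>

definition BoundedTm :: "tm \<Rightarrow> fm" where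
  "BoundedTm = Derivable (\<lambda>E y. Ors
    [ExNs 2 (Var 0 \<^bold>< Var 1 \<^bold>\<and> y \<up> 2 \<^bold>= Var 1 \<star> cVar (Var 0)),
     ExN (y \<up> 1 \<^bold>= Var 0 \<star> cZero),
     ExN (y \<up> 1 \<^bold>= Var 0 \<star> cOne),
     ExNs 3 (E 3 (Var 2 \<star> Var 1) \<^bold>\<and> E 3 (Var 2 \<star> Var 0) \<^bold>\<and>
       (y \<up> 3 \<^bold>= Var 2 \<star> cAdd (Var 1) (Var 0) \<^bold>\<or> y \<up> 3 \<^bold>= Var 2 \<star> cMul (Var 1) (Var 0)))])"

text \<open>Pairs \<open>(k, a)\<close>, \<open>a\<close> an arithmetical formula with free number variables below \<open>k\<close> and with
  no free set variable other than 0.\<close>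

definition BoundedArith :: "tm \<Rightarrow> fm" where
  "BoundedArith = Derivable (\<lambda>E y. Ors
    [ExNs 3 (BoundedTm (Var 2 \<star> Var 1) \<^bold>\<and> BoundedTm (Var 2 \<star> Var 0) \<^bold>\<and>
       (y \<up> 3 \<^bold>= Var 2 \<star> cEq (Var 1) (Var 0) \<^bold>\<or> y \<up> 3 \<^bold>= Var 2 \<star> cLt (Var 1) (Var 0))),
     ExNs 2 (BoundedTm (Var 1 \<star> Var 0) \<^bold>\<and> y \<up> 2 \<^bold>= Var 1 \<star> cIn (Var 0) Zero),
     ExN (y \<up> 1 \<^bold>= Var 0 \<star> cFls),
     ExNs 3 (E 3 (Var 2 \<star> Var 1) \<^bold>\<and> E 3 (Var 2 \<star> Var 0) \<^bold>\<and>
       y \<up> 3 \<^bold>= Var 2 \<star> cImp (Var 1) (Var 0)),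
     ExNs 2 (E 2 ((Var 1 \<^bold>+ One) \<star> Var 0) \<^bold>\<and> y \<up> 2 \<^bold>= Var 1 \<star> cAllN (Var 0))])"

definition Pi11Sent :: "tm \<Rightarrow> fm" where
  "Pi11Sent x = ExN (BoundedArith (Zero \<star> Var 0) \<^bold>\<and> x \<up> 1 \<^bold>= cAllS (Var 0))"

subsection \<open>The truth predicate for \<open>\<Pi>\<^sup>1\<^sub>1\<close> sentences\<close>

text \<open>
  Assignments to number variables are coded as stacks: \<open>(x, s)\<close> assigns \<open>x\<close> to variable 0 and
  otherwise behaves like \<open>s\<close> shifted by one.  Since \<open>(0, 0) = 0\<close>, the stack 0 assigns 0 everywhere.

  \<open>SatClass X D V S\<close> says that \<open>D\<close> is a set of codes of terms and arithmetical formulas closed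
  under subterms and subformulas, that \<open>V\<close> contains, among the \<open>(t, s, v)\<close> with \<open>t \<in> D\<close>, exactly
  those in which \<open>v\<close> is the value of \<open>t\<close> under \<open>s\<close>, and that \<open>S\<close> satisfies Tarski's conditions
  for satisfaction \<open>(a, s)\<close> of the \<open>a \<in> D\<close> under \<open>s\<close>, the set variable 0 being interpreted by \<open>X\<close>.
\<close>

definition SatClass :: "nat \<Rightarrow> nat \<Rightarrow> nat \<Rightarrow> nat \<Rightarrow> fm" where
  "SatClass X D V S = Ands
    [AllN (cVar (Var 0 \<^bold>+ One) \<^bold>\<in> D \<^bold>\<longrightarrow> cVar (Var 0) \<^bold>\<in> D),
     AllNs 2 (Ors [cAdd (Var 1) (Var 0) \<^bold>\<in> D, cMul (Var 1) (Var 0) \<^bold>\<in> D,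
                   cEq (Var 1) (Var 0) \<^bold>\<in> D, cLt (Var 1) (Var 0) \<^bold>\<in> D,
                   cImp (Var 1) (Var 0) \<^bold>\<in> D]
       \<^bold>\<longrightarrow> Var 1 \<^bold>\<in> D \<^bold>\<and> Var 0 \<^bold>\<in> D),
     AllN (cIn (Var 0) Zero \<^bold>\<in> D \<^bold>\<or> cAllN (Var 0) \<^bold>\<in> D \<^bold>\<longrightarrow> Var 0 \<^bold>\<in> D),

     cVar Zero \<^bold>\<in> D \<^bold>\<longrightarrow>
       AllNs 3 (cVar Zero \<star> (Var 2 \<star> Var 1) \<star> Var 0 \<^bold>\<in> V \<^bold>\<longleftrightarrow> Var 0 \<^bold>= Var 2),
     AllN (cVar (Var 0 \<^bold>+ One) \<^bold>\<in> D \<^bold>\<longrightarrow>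
       AllNs 3 (cVar (Var 3 \<^bold>+ One) \<star> (Var 2 \<star> Var 1) \<star> Var 0 \<^bold>\<in> V \<^bold>\<longleftrightarrow>
         cVar (Var 3) \<star> Var 1 \<star> Var 0 \<^bold>\<in> V)),
     cZero \<^bold>\<in> D \<^bold>\<longrightarrow> AllNs 2 (cZero \<star> Var 1 \<star> Var 0 \<^bold>\<in> V \<^bold>\<longleftrightarrow> Var 0 \<^bold>= Zero),
     cOne \<^bold>\<in> D \<^bold>\<longrightarrow> AllNs 2 (cOne \<star> Var 1 \<star> Var 0 \<^bold>\<in> V \<^bold>\<longleftrightarrow> Var 0 \<^bold>= One),
     AllNs 2 (cAdd (Var 1) (Var 0) \<^bold>\<in> D \<^bold>\<longrightarrow>
       AllNs 2 (cAdd (Var 3) (Var 2) \<star> Var 1 \<star> Var 0 \<^bold>\<in> V \<^bold>\<longleftrightarrow>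
         ExNs 2 (Var 5 \<star> Var 3 \<star> Var 1 \<^bold>\<in> V \<^bold>\<and> Var 4 \<star> Var 3 \<star> Var 0 \<^bold>\<in> V \<^bold>\<and>
           Var 2 \<^bold>= Var 1 \<^bold>+ Var 0))),
     AllNs 2 (cMul (Var 1) (Var 0) \<^bold>\<in> D \<^bold>\<longrightarrow>
       AllNs 2 (cMul (Var 3) (Var 2) \<star> Var 1 \<star> Var 0 \<^bold>\<in> V \<^bold>\<longleftrightarrow>
         ExNs 2 (Var 5 \<star> Var 3 \<star> Var 1 \<^bold>\<in> V \<^bold>\<and> Var 4 \<star> Var 3 \<star> Var 0 \<^bold>\<in> V \<^bold>\<and>
           Var 2 \<^bold>= Var 1 \<^bold>* Var 0))),

     AllNs 2 (cEq (Var 1) (Var 0) \<^bold>\<in> D \<^bold>\<longrightarrow>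
       AllN (cEq (Var 2) (Var 1) \<star> Var 0 \<^bold>\<in> S \<^bold>\<longleftrightarrow>
         ExNs 2 (Var 4 \<star> Var 2 \<star> Var 1 \<^bold>\<in> V \<^bold>\<and> Var 3 \<star> Var 2 \<star> Var 0 \<^bold>\<in> V \<^bold>\<and> Var 1 \<^bold>= Var 0))),
     AllNs 2 (cLt (Var 1) (Var 0) \<^bold>\<in> D \<^bold>\<longrightarrow>
       AllN (cLt (Var 2) (Var 1) \<star> Var 0 \<^bold>\<in> S \<^bold>\<longleftrightarrow>
         ExNs 2 (Var 4 \<star> Var 2 \<star> Var 1 \<^bold>\<in> V \<^bold>\<and> Var 3 \<star> Var 2 \<star> Var 0 \<^bold>\<in> V \<^bold>\<and> Var 1 \<^bold>< Var 0))),
     AllN (cIn (Var 0) Zero \<^bold>\<in> D \<^bold>\<longrightarrow>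
       AllN (cIn (Var 1) Zero \<star> Var 0 \<^bold>\<in> S \<^bold>\<longleftrightarrow>
         ExN (Var 2 \<star> Var 1 \<star> Var 0 \<^bold>\<in> V \<^bold>\<and> Var 0 \<^bold>\<in> X))),
     cFls \<^bold>\<in> D \<^bold>\<longrightarrow> AllN (\<^bold>\<not> cFls \<star> Var 0 \<^bold>\<in> S),
     AllNs 2 (cImp (Var 1) (Var 0) \<^bold>\<in> D \<^bold>\<longrightarrow>
       AllN (cImp (Var 2) (Var 1) \<star> Var 0 \<^bold>\<in> S \<^bold>\<longleftrightarrow>
         (Var 2 \<star> Var 0 \<^bold>\<in> S \<^bold>\<longrightarrow> Var 1 \<star> Var 0 \<^bold>\<in> S))),
     AllN (cAllN (Var 0) \<^bold>\<in> D \<^bold>\<longrightarrow>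
       AllN (cAllN (Var 1) \<star> Var 0 \<^bold>\<in> S \<^bold>\<longleftrightarrow>
         AllN (Var 2 \<star> (Var 0 \<star> Var 1) \<^bold>\<in> S)))]"

text \<open>\<open>x\<close> is the code of \<open>\<forall>X \<theta>\<close>, and for every set \<open>X\<close>, every satisfaction class relative to \<open>X\<close>
  whose domain contains \<open>\<theta>\<close> declares \<open>\<theta>\<close> true.  The set quantifiers bind \<open>X\<close>, \<open>D\<close>, \<open>V\<close>, \<open>S\<close> in
  this order.  Already \<open>ACA\<^sub>0\<close> has such satisfaction classes for every standard \<open>\<theta>\<close>, by
  arithmetical comprehension.\<close>

definition TruePi11 :: "tm \<Rightarrow> fm" where
  "TruePi11 x = ExN (x \<up> 1 \<^bold>= cAllS (Var 0) \<^bold>\<and>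
     AllS (AllS (AllS (AllS (
       SatClass 3 2 1 0 \<^bold>\<and> Var 0 \<^bold>\<in> 2 \<^bold>\<longrightarrow> Var 0 \<star> Zero \<^bold>\<in> 0)))))"

definition RFN_Pi11 :: "fm \<Rightarrow> fm" where
  "RFN_Pi11 \<tau> = AllN (Pi11Sent (Var 0) \<^bold>\<longrightarrow> Pr \<tau> (Var 0) \<^bold>\<longrightarrow> TruePi11 (Var 0))"

end

theory Submission
  imports Defs "HOL-Library.Countable_Set" "HOL-Number_Theory.Cong"
begin

text \<open>
  The proof is a form of Goedel's second incompleteness theorem in which reflection replaces the
  derivability conditions.  Write \<open>\<tau>\<close> as \<open>\<exists>X \<theta>(n, X)\<close> with \<open>\<theta>\<close> arithmetical.  Inside the formula
  \<open>Pr \<tau>\<close> the set quantifier of \<open>\<tau>\<close> stands below number quantifiers.  The formula \<open>WitnessedPr \<theta>\<close>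
  pulls it out: a single set \<open>Y\<close> carries all the witnesses, the axiom with code \<open>y\<close> being
  witnessed by the slice \<open>(Y)\<^sub>y\<close>, so that being a proof witnessed by \<open>Y\<close> is arithmetical in \<open>Y\<close>.
  The sentence \<open>diag \<theta>\<close>, which is literally \<open>\<Pi>\<^sup>1\<^sub>1\<close>, says of itself that no \<open>Y\<close> witnesses a proof
  of it.

  Suppose that \<open>T\<close> proves its \<open>\<Pi>\<^sup>1\<^sub>1\<close> reflection principle.  Then \<open>T\<close> proves \<open>diag \<theta>\<close>: otherwise
  \<open>completeness\<close> gives a model of \<open>T\<close> in which \<open>diag \<theta>\<close> fails, say at \<open>Y\<close>.  The slices of \<open>Y\<close> exist
  by comprehension, so in that model \<open>diag \<theta>\<close> is provable in the sense of \<open>Pr \<tau>\<close>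
  (\<open>Pr_if_not_diag\<close>), hence true in the sense of the truth predicate by reflection, hence true,
  because arithmetical comprehension provides the satisfaction classes over which the truth
  predicate quantifies (\<open>TruePi11_sound\<close>).  This is a contradiction.

  As \<open>T\<close> is \<open>\<Pi>\<^sup>1\<^sub>1\<close> sound, \<open>diag \<theta>\<close> is now true in the standard structure.  But \<open>T\<close> proves it, and a
  set \<open>Y\<close> assembled from one witness for each axiom of \<open>T\<close> then witnesses a proof of \<open>diag \<theta>\<close>, so
  \<open>diag \<theta>\<close> is false (\<open>provable_diag_false\<close>).

  The completeness theorem is there so that all reasoning inside \<open>T\<close> becomes ordinary reasoning
  about a structure.  Such a structure can be nonstandard, and so can be the proof of \<open>diag \<theta>\<close> that
  exists in it; but this proof is passed from \<open>WitnessedPr\<close> to \<open>Pr\<close> as it stands.  All formulas whose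
  codes are inspected are actual formulas, so that the arithmetized syntax has to be understood on
  standard numbers only.
\<close>

section \<open>Simultaneous substitution\<close>

text \<open>Lifting and the substitutions of the calculus act at one index.  They are instances of a
  simultaneous substitution, for which composition and semantics have uniform proofs; number
  variables go to terms, set variables to set variables.\<close>

primrec tsubst :: "(nat \<Rightarrow> tm) \<Rightarrow> tm \<Rightarrow> tm" where
  "tsubst \<sigma> (Var i) = \<sigma> i"
| "tsubst \<sigma> Zero = Zero"
| "tsubst \<sigma> One = One"
| "tsubst \<sigma> (s \<^bold>+ t) = tsubst \<sigma> s \<^bold>+ tsubst \<sigma> t"
| "tsubst \<sigma> (s \<^bold>* t) = tsubst \<sigma> s \<^bold>* tsubst \<sigma> t"

definition bindN :: "(nat \<Rightarrow> tm) \<Rightarrow> nat \<Rightarrow> tm" where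
  "bindN \<sigma> = case_nat (Var 0) (\<lambda>i. lift_tm 0 (\<sigma> i))"

definition bindS :: "(nat \<Rightarrow> nat) \<Rightarrow> nat \<Rightarrow> nat" where
  "bindS \<rho> = case_nat 0 (\<lambda>i. Suc (\<rho> i))"

primrec fsubst :: "(nat \<Rightarrow> tm) \<Rightarrow> (nat \<Rightarrow> nat) \<Rightarrow> fm \<Rightarrow> fm" where
  "fsubst \<sigma> \<rho> (s \<^bold>= t) = (tsubst \<sigma> s \<^bold>= tsubst \<sigma> t)"
| "fsubst \<sigma> \<rho> (s \<^bold>< t) = (tsubst \<sigma> s \<^bold>< tsubst \<sigma> t)"
| "fsubst \<sigma> \<rho> (t \<^bold>\<in> i) = (tsubst \<sigma> t \<^bold>\<in> \<rho> i)"
| "fsubst \<sigma> \<rho> Fls = Fls"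
| "fsubst \<sigma> \<rho> (a \<^bold>\<longrightarrow> b) = (fsubst \<sigma> \<rho> a \<^bold>\<longrightarrow> fsubst \<sigma> \<rho> b)"
| "fsubst \<sigma> \<rho> (AllN a) = AllN (fsubst (bindN \<sigma>) \<rho> a)"
| "fsubst \<sigma> \<rho> (AllS a) = AllS (fsubst \<sigma> (bindS \<rho>) a)"

lemma tsubst_ext: "bounded_tm m t \<Longrightarrow> (\<And>i. i < m \<Longrightarrow> \<sigma> i = \<sigma>' i) \<Longrightarrow> tsubst \<sigma> t = tsubst \<sigma>' t"
  by (induction t) auto

lemma fsubst_ext:
  "bounded m n a \<Longrightarrow> (\<And>i. i < m \<Longrightarrow> \<sigma> i = \<sigma>' i) \<Longrightarrow> (\<And>i. i < n \<Longrightarrow> \<rho> i = \<rho>' i)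
    \<Longrightarrow> fsubst \<sigma> \<rho> a = fsubst \<sigma>' \<rho>' a"
proof (induction a arbitrary: m n \<sigma> \<sigma>' \<rho> \<rho>')
  case (AllN a)
  have "bindN \<sigma> i = bindN \<sigma>' i" if "i < Suc m" for i
    using that AllN.prems(2) by (cases i) (simp_all add: bindN_def)
  then have "fsubst (bindN \<sigma>) \<rho> a = fsubst (bindN \<sigma>') \<rho>' a"
    using AllN.prems by (intro AllN.IH[of "Suc m" n]) simp_all
  then show ?case by simp
next
  case (AllS a)
  have "bindS \<rho> i = bindS \<rho>' i" if "i < Suc n" for i
    using that AllS.prems(3) by (cases i) (simp_all add: bindS_def)
  then have "fsubst \<sigma> (bindS \<rho>) a = fsubst \<sigma>' (bindS \<rho>') a"
    using AllS.prems by (intro AllS.IH[of m "Suc n"]) simp_all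
  then show ?case by simp
next
  case (Imp a b)
  have "fsubst \<sigma> \<rho> a = fsubst \<sigma>' \<rho>' a" "fsubst \<sigma> \<rho> b = fsubst \<sigma>' \<rho>' b"
    using Imp.prems by (intro Imp.IH[of m n]; simp)+
  then show ?case by simp
qed (auto intro!: tsubst_ext)

lemma tsubst_Var: "tsubst Var t = t"
  by (induction t) auto

lemma bindN_Var: "bindN Var = Var"
  by (auto simp: bindN_def fun_eq_iff split: nat.split)

lemma bindS_id: "bindS (\<lambda>i. i) = (\<lambda>i. i)"
  by (auto simp: bindS_def fun_eq_iff split: nat.split)

lemma fsubst_id: "fsubst Var (\<lambda>i. i) a = a"
  by (induction a) (auto simp: tsubst_Var bindN_Var bindS_id)

lemma tsubst_tsubst: "tsubst \<sigma> (tsubst \<sigma>' t) = tsubst (\<lambda>i. tsubst \<sigma> (\<sigma>' i)) t"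
  by (induction t) auto

lemma lift_tm_tsubst: "lift_tm k t = tsubst (\<lambda>i. Var (if i < k then i else i + 1)) t"
  by (induction t) auto

lemma subst_tm_tsubst:
  "subst_tm k u t = tsubst (\<lambda>i. if i < k then Var i else if i = k then u else Var (i - 1)) t"
  by (induction t) auto

lemma up_tsubst: "t \<up> n = tsubst (\<lambda>i. Var (i + n)) t"
  by (induction t) auto

lemma bindN_comp: "(\<lambda>i. tsubst (bindN \<sigma>) (bindN \<sigma>' i)) = bindN (\<lambda>i. tsubst \<sigma> (\<sigma>' i))"
  by (auto simp: fun_eq_iff bindN_def lift_tm_tsubst tsubst_tsubst split: nat.split)

lemma bindS_comp: "(\<lambda>i. bindS \<rho> (bindS \<rho>' i)) = bindS (\<lambda>i. \<rho> (\<rho>' i))"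
  by (auto simp: fun_eq_iff bindS_def split: nat.split)

lemma fsubst_fsubst:
  "fsubst \<sigma> \<rho> (fsubst \<sigma>' \<rho>' a) = fsubst (\<lambda>i. tsubst \<sigma> (\<sigma>' i)) (\<lambda>i. \<rho> (\<rho>' i)) a"
  by (induction a arbitrary: \<sigma> \<rho> \<sigma>' \<rho>') (auto simp: tsubst_tsubst bindN_comp bindS_comp)

lemma liftN_fsubst: "liftN k a = fsubst (\<lambda>i. Var (if i < k then i else i + 1)) (\<lambda>i. i) a"
proof (induction a arbitrary: k)
  case (AllN a)
  have "bindN (\<lambda>i. Var (if i < k then i else i + 1)) = (\<lambda>i. Var (if i < k + 1 then i else i + 1))"
    by (auto simp: bindN_def fun_eq_iff split: nat.split)
  then show ?case using AllN[of "k + 1"] by simp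
qed (auto simp: lift_tm_tsubst bindS_id)

lemma liftS_fsubst: "liftS k a = fsubst Var (\<lambda>i. if i < k then i else i + 1) a"
proof (induction a arbitrary: k)
  case (AllS a)
  have "bindS (\<lambda>i. if i < k then i else i + 1) = (\<lambda>i. if i < k + 1 then i else i + 1)"
    by (auto simp: bindS_def fun_eq_iff split: nat.split)
  then show ?case using AllS[of "k + 1"] by simp
qed (auto simp: tsubst_Var bindN_Var)

lemma substN_fsubst:
  "substN k u a =
     fsubst (\<lambda>i. if i < k then Var i else if i = k then u else Var (i - 1)) (\<lambda>i. i) a"
proof (induction a arbitrary: k u)
  case (AllN a)
  have "bindN (\<lambda>i. if i < k then Var i else if i = k then u else Var (i - 1))
      = (\<lambda>i. if i < k + 1 then Var i else if i = k + 1 then lift_tm 0 u else Var (i - 1))"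
    by (auto simp: bindN_def fun_eq_iff split: nat.split)
  then show ?case using AllN[of "k + 1"] by simp
qed (auto simp: subst_tm_tsubst bindS_id)

lemma substS_fsubst:
  "substS k j a = fsubst Var (\<lambda>i. if i < k then i else if i = k then j else i - 1) a"
proof (induction a arbitrary: k j)
  case (AllS a)
  have "bindS (\<lambda>i. if i < k then i else if i = k then j else i - 1)
      = (\<lambda>i. if i < k + 1 then i else if i = k + 1 then j + 1 else i - 1)"
    by (auto simp: bindS_def fun_eq_iff split: nat.split)
  then show ?case using AllS[of "k + 1" "j + 1"] by simp
qed (auto simp: tsubst_Var bindN_Var)

lemma lift0: "lift_tm 0 t = tsubst (\<lambda>i. Var (Suc i)) t"
  "liftN 0 a = fsubst (\<lambda>i. Var (Suc i)) (\<lambda>i. i) a"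
  "liftS 0 a = fsubst Var Suc a"
  by (simp_all add: lift_tm_tsubst liftN_fsubst liftS_fsubst)

lemma subst0: "substN 0 u a = fsubst (case_nat u Var) (\<lambda>i. i) a"
  "substS 0 j a = fsubst Var (case_nat j (\<lambda>i. i)) a"
proof -
  have "(\<lambda>i. if i < 0 then Var i else if i = 0 then u else Var (i - 1)) = case_nat u Var"
    by (auto simp: fun_eq_iff split: nat.split)
  then show "substN 0 u a = fsubst (case_nat u Var) (\<lambda>i. i) a" by (simp add: substN_fsubst)
  have "(\<lambda>i. if i < 0 then i else if i = 0 then j else i - 1) = case_nat j (\<lambda>i. i)"
    by (auto simp: fun_eq_iff split: nat.split)
  then show "substS 0 j a = fsubst Var (case_nat j (\<lambda>i. i)) a" by (simp add: substS_fsubst)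
qed

lemma case_nat_comp: "(\<lambda>i. f (case_nat x g i)) = case_nat (f x) (\<lambda>i. f (g i))"
  by (auto simp: fun_eq_iff split: nat.split)

lemma tsubst_bindN: "(\<lambda>i. tsubst (case_nat u Var) (bindN \<sigma> i)) = case_nat u \<sigma>"
  by (auto simp: fun_eq_iff bindN_def lift0 tsubst_tsubst tsubst_Var split: nat.split)

lemma tsubst_case_nat: "(\<lambda>i. tsubst \<sigma> (case_nat u Var i)) = case_nat (tsubst \<sigma> u) \<sigma>"
  by (auto simp: fun_eq_iff split: nat.split)

text \<open>The next four facts say that simultaneous substitution maps instances of the quantifier and
  equality axioms to such instances; this is what makes provability from sentences invariant under
  substitution.\<close>

lemma fsubst_substN: "fsubst \<sigma> \<rho> (substN 0 u a) = substN 0 (tsubst \<sigma> u) (fsubst (bindN \<sigma>) \<rho> a)"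
  by (simp add: subst0 fsubst_fsubst tsubst_case_nat tsubst_bindN)

lemma fsubst_liftN: "fsubst (bindN \<sigma>) \<rho> (liftN 0 a) = liftN 0 (fsubst \<sigma> \<rho> a)"
  by (simp add: lift0 fsubst_fsubst) (simp add: bindN_def lift0)

lemma fsubst_substS: "fsubst \<sigma> \<rho> (substS 0 j a) = substS 0 (\<rho> j) (fsubst \<sigma> (bindS \<rho>) a)"
proof -
  have "(\<lambda>i. case_nat (\<rho> j) (\<lambda>i. i) (bindS \<rho> i)) = case_nat (\<rho> j) \<rho>"
    by (auto simp: fun_eq_iff bindS_def split: nat.split)
  then show ?thesis by (simp add: subst0 fsubst_fsubst case_nat_comp tsubst_Var)
qed

lemma fsubst_liftS: "fsubst \<sigma> (bindS \<rho>) (liftS 0 a) = liftS 0 (fsubst \<sigma> \<rho> a)"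
  by (simp add: lift0 fsubst_fsubst tsubst_Var) (simp add: bindS_def)

lemma bounded_tm_mono: "bounded_tm m t \<Longrightarrow> m \<le> m' \<Longrightarrow> bounded_tm m' t"
  by (induction t) auto

lemma bounded_mono: "bounded m n a \<Longrightarrow> m \<le> m' \<Longrightarrow> n \<le> n' \<Longrightarrow> bounded m' n' a"
  by (induction a arbitrary: m n m' n') (auto intro: bounded_tm_mono)

lemma bounded_tm_ex: "\<exists>m. bounded_tm m t"
proof (induction t)
  case (Add s t)
  then obtain m n where "bounded_tm m s" "bounded_tm n t" by auto
  then have "bounded_tm (max m n) s" "bounded_tm (max m n) t" by (auto intro: bounded_tm_mono)
  then show ?case by auto
next
  case (Mul s t)
  then obtain m n where "bounded_tm m s" "bounded_tm n t" by auto
  then have "bounded_tm (max m n) s" "bounded_tm (max m n) t" by (auto intro: bounded_tm_mono)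
  then show ?case by auto
next
  case (Var i)
  then show ?case by (auto intro: exI[of _ "Suc i"])
qed auto

lemma bounded_tm_ex2: "\<exists>m. bounded_tm m s \<and> bounded_tm m t"
  using bounded_tm_ex[of "s \<^bold>+ t"] by simp

lemma bounded_ex: "\<exists>m. bounded m m a"
proof (induction a)
  case (Eq s t)
  then show ?case using bounded_tm_ex2[of s t] by auto
next
  case (Lt s t)
  then show ?case using bounded_tm_ex2[of s t] by auto
next
  case (In t i)
  obtain m where "bounded_tm m t" using bounded_tm_ex by blast
  then have "bounded (max m (Suc i)) (max m (Suc i)) (t \<^bold>\<in> i)" by (auto intro: bounded_tm_mono)
  then show ?case by blast
next
  case (Imp a b)
  then obtain m n where "bounded m m a" "bounded n n b" by auto
  then have "bounded (max m n) (max m n) (a \<^bold>\<longrightarrow> b)" by (auto intro: bounded_mono)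
  then show ?case by blast
next
  case (AllN a)
  then obtain m where "bounded m m a" by blast
  then show ?case by (auto intro!: exI[of _ m] elim: bounded_mono)
next
  case (AllS a)
  then obtain m where "bounded m m a" by blast
  then show ?case by (auto intro!: exI[of _ m] elim: bounded_mono)
qed auto

lemma range_case_nat: "X \<in> A \<Longrightarrow> range E \<subseteq> A \<Longrightarrow> range (case_nat X E) \<subseteq> A"
  by (force simp: image_subset_iff split: nat.split)

section \<open>Two-sorted structures\<close>

text \<open>Set variables range over a family of subsets of the domain, as in Henkin semantics.  With all
  subsets of the natural numbers this is the standard structure.\<close>

locale l2_structure =
  fixes zero one :: 'm
    and plus :: "'m \<Rightarrow> 'm \<Rightarrow> 'm" (infixl "\<oplus>" 65)
    and times :: "'m \<Rightarrow> 'm \<Rightarrow> 'm" (infixl "\<otimes>" 70)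
    and less :: "'m \<Rightarrow> 'm \<Rightarrow> bool" (infix "\<prec>" 50)
    and Sets :: "'m set set"
  assumes Sets_nonempty: "Sets \<noteq> {}"
begin

primrec mval :: "(nat \<Rightarrow> 'm) \<Rightarrow> tm \<Rightarrow> 'm" where
  "mval e (Var i) = e i"
| "mval e Zero = zero"
| "mval e One = one"
| "mval e (s \<^bold>+ t) = plus (mval e s) (mval e t)"
| "mval e (s \<^bold>* t) = times (mval e s) (mval e t)"

primrec msat :: "(nat \<Rightarrow> 'm) \<Rightarrow> (nat \<Rightarrow> 'm set) \<Rightarrow> fm \<Rightarrow> bool" where
  "msat e E (s \<^bold>= t) \<longleftrightarrow> mval e s = mval e t"
| "msat e E (s \<^bold>< t) \<longleftrightarrow> less (mval e s) (mval e t)"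
| "msat e E (t \<^bold>\<in> i) \<longleftrightarrow> mval e t \<in> E i"
| "msat e E Fls \<longleftrightarrow> False"
| "msat e E (a \<^bold>\<longrightarrow> b) \<longleftrightarrow> (msat e E a \<longrightarrow> msat e E b)"
| "msat e E (AllN a) \<longleftrightarrow> (\<forall>x. msat (case_nat x e) E a)"
| "msat e E (AllS a) \<longleftrightarrow> (\<forall>X\<in>Sets. msat e (case_nat X E) a)"

lemma msat_simps [simp]:
  "msat e E (\<^bold>\<not> a) \<longleftrightarrow> \<not> msat e E a"
  "msat e E (a \<^bold>\<or> b) \<longleftrightarrow> msat e E a \<or> msat e E b"
  "msat e E (a \<^bold>\<and> b) \<longleftrightarrow> msat e E a \<and> msat e E b"
  "msat e E (a \<^bold>\<longleftrightarrow> b) \<longleftrightarrow> (msat e E a \<longleftrightarrow> msat e E b)"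
  "msat e E (ExN a) \<longleftrightarrow> (\<exists>x. msat (case_nat x e) E a)"
  "msat e E (ExS a) \<longleftrightarrow> (\<exists>X\<in>Sets. msat e (case_nat X E) a)"
  by (auto simp: Neg_def Or_def And_def Iff_def ExN_def ExS_def)

text \<open>Truth under all assignments: since axioms may have free variables, this is the sense in which a
  structure is a model of a theory.\<close>

definition valid :: "fm \<Rightarrow> bool" where
  "valid a \<longleftrightarrow> (\<forall>e E. range E \<subseteq> Sets \<longrightarrow> msat e E a)"

lemma mval_tsubst: "mval e (tsubst \<sigma> t) = mval (\<lambda>i. mval e (\<sigma> i)) t"
  by (induction t) auto

lemma msat_fsubst:
  "msat e E (fsubst \<sigma> \<rho> a) \<longleftrightarrow> msat (\<lambda>i. mval e (\<sigma> i)) (\<lambda>i. E (\<rho> i)) a"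
proof (induction a arbitrary: e E \<sigma> \<rho>)
  case (AllN a)
  have "(\<lambda>i. mval (case_nat x e) (bindN \<sigma> i)) = case_nat x (\<lambda>i. mval e (\<sigma> i))" for x
    by (auto simp: fun_eq_iff bindN_def lift0 mval_tsubst split: nat.split)
  then show ?case using AllN by simp
next
  case (AllS a)
  have "(\<lambda>i. case_nat X E (bindS \<rho> i)) = case_nat X (\<lambda>i. E (\<rho> i))" for X
    by (auto simp: fun_eq_iff bindS_def split: nat.split)
  then show ?case using AllS by simp
qed (auto simp: mval_tsubst)

lemma mval_case_nat: "(\<lambda>i. mval e (case_nat u Var i)) = case_nat (mval e u) e"
  by (auto simp: fun_eq_iff split: nat.split)

lemma msat_lift_subst [simp]:
  "msat e E (substN 0 u a) \<longleftrightarrow> msat (case_nat (mval e u) e) E a"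
  "msat e E (substS 0 j a) \<longleftrightarrow> msat e (case_nat (E j) E) a"
  "msat (case_nat x e) E (liftN 0 a) \<longleftrightarrow> msat e E a"
  "msat e (case_nat X E) (liftS 0 a) \<longleftrightarrow> msat e E a"
  by (simp_all add: subst0 lift0 msat_fsubst mval_case_nat case_nat_comp)

lemma mval_up [simp]: "mval (case_nat x e) (t \<up> Suc n) = mval e (t \<up> n)"
  by (simp add: up_tsubst mval_tsubst)

lemma mval_up0 [simp]: "mval e (t \<up> 0) = mval e t"
  by (simp add: up_tsubst tsubst_Var)

lemma mval_bounded: "bounded_tm m t \<Longrightarrow> (\<And>i. i < m \<Longrightarrow> e i = e' i) \<Longrightarrow> mval e t = mval e' t"
  by (induction t) auto

lemma msat_bounded:
  "bounded m n a \<Longrightarrow> (\<And>i. i < m \<Longrightarrow> e i = e' i) \<Longrightarrow> (\<And>i. i < n \<Longrightarrow> E i = E' i)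
    \<Longrightarrow> msat e E a \<longleftrightarrow> msat e' E' a"
proof (induction a arbitrary: m n e e' E E')
  case (AllN a)
  have "case_nat x e i = case_nat x e' i" if "i < Suc m" for x i
    using that AllN.prems(2) by (cases i) simp_all
  then have "msat (case_nat x e) E a \<longleftrightarrow> msat (case_nat x e') E' a" for x
    using AllN.prems by (intro AllN.IH[of "Suc m" n]) simp_all
  then show ?case by simp
next
  case (AllS a)
  have "case_nat X E i = case_nat X E' i" if "i < Suc n" for X i
    using that AllS.prems(3) by (cases i) simp_all
  then have "msat e (case_nat X E) a \<longleftrightarrow> msat e' (case_nat X E') a" for X
    using AllS.prems by (intro AllS.IH[of m "Suc n"]) simp_all
  then show ?case by simp
next
  case (Imp a b)
  have "msat e E a \<longleftrightarrow> msat e' E' a" "msat e E b \<longleftrightarrow> msat e' E' b"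
    using Imp.prems by (intro Imp.IH[of m n]; simp)+
  then show ?case by simp
next
  case (Eq s t)
  have "mval e s = mval e' s" "mval e t = mval e' t"
    using Eq.prems by (intro mval_bounded[of m]; simp)+
  then show ?case by simp
next
  case (Lt s t)
  have "mval e s = mval e' s" "mval e t = mval e' t"
    using Lt.prems by (intro mval_bounded[of m]; simp)+
  then show ?case by simp
next
  case (In t i)
  have "mval e t = mval e' t"
    using In.prems by (intro mval_bounded[of m]) simp_all
  then show ?case using In.prems by simp
qed simp

lemma msat_cong_sentence: "sentence a \<Longrightarrow> msat e E a \<longleftrightarrow> msat e' E' a"
  by (rule msat_bounded[of 0 0]) (auto simp: sentence_def)

lemma valid_AllN: "valid (AllN a) \<longleftrightarrow> valid a"
proof
  assume v: "valid (AllN a)"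
  have "msat e E a" if "range E \<subseteq> Sets" for e E
  proof -
    have "msat (case_nat (e 0) (\<lambda>i. e (Suc i))) E a" using v that by (simp add: valid_def)
    moreover have "case_nat (e 0) (\<lambda>i. e (Suc i)) = e" by (auto simp: fun_eq_iff split: nat.split)
    ultimately show ?thesis by simp
  qed
  then show "valid a" by (simp add: valid_def)
qed (simp add: valid_def)

lemma valid_AllS: "valid (AllS a) \<longleftrightarrow> valid a"
proof
  assume v: "valid (AllS a)"
  have "msat e E a" if E: "range E \<subseteq> Sets" for e E
  proof -
    have "E 0 \<in> Sets" "range (\<lambda>i. E (Suc i)) \<subseteq> Sets" using E by auto
    then have "msat e (case_nat (E 0) (\<lambda>i. E (Suc i))) a" using v by (auto simp: valid_def)
    moreover have "case_nat (E 0) (\<lambda>i. E (Suc i)) = E" by (auto simp: fun_eq_iff split: nat.split)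
    ultimately show ?thesis by simp
  qed
  then show "valid a" by (simp add: valid_def)
next
  assume v: "valid a"
  then show "valid (AllS a)" by (simp add: valid_def range_case_nat)
qed

end

section \<open>Completeness\<close>

text \<open>Hypotheses are kept in a list, most recent first, so that the deduction theorem holds by
  definition.  Their free variables act as parameters: generalization applies to theorems of
  \<open>T\<close>, never to hypotheses.\<close>

primrec entails :: "fm set \<Rightarrow> fm list \<Rightarrow> fm \<Rightarrow> bool" where
  "entails T [] a \<longleftrightarrow> (T \<turnstile> a)"
| "entails T (h # H) a \<longleftrightarrow> entails T H (h \<^bold>\<longrightarrow> a)"

lemma ent_thm: "T \<turnstile> a \<Longrightarrow> entails T H a"
proof (induction H arbitrary: a)
  case (Cons h H)
  have "T \<turnstile> h \<^bold>\<longrightarrow> a"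
    using Cons.prems by (rule proves.mp) (intro proves.logical logical_axiom.intros)
  then show ?case using Cons.IH by simp
qed simp

lemma ent_logical: "logical_axiom a \<Longrightarrow> entails T H a"
  by (intro ent_thm proves.logical)

lemma ent_mp: "entails T H a \<Longrightarrow> entails T H (a \<^bold>\<longrightarrow> b) \<Longrightarrow> entails T H b"
proof (induction H arbitrary: a b)
  case Nil
  then show ?case using proves.mp[of T a b] by simp
next
  case (Cons h H)
  have "entails T H ((h \<^bold>\<longrightarrow> a \<^bold>\<longrightarrow> b) \<^bold>\<longrightarrow> (h \<^bold>\<longrightarrow> a) \<^bold>\<longrightarrow> h \<^bold>\<longrightarrow> b)"
    by (intro ent_logical logical_axiom.intros)
  then have "entails T H ((h \<^bold>\<longrightarrow> a) \<^bold>\<longrightarrow> h \<^bold>\<longrightarrow> b)"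
    using Cons.prems(2) Cons.IH[of "h \<^bold>\<longrightarrow> a \<^bold>\<longrightarrow> b"] by simp
  then show ?case using Cons.prems(1) Cons.IH[of "h \<^bold>\<longrightarrow> a"] by simp
qed

lemma ent_weaken1: "entails T H a \<Longrightarrow> entails T (h # H) a"
  by (simp, erule ent_mp) (intro ent_logical logical_axiom.intros(1))

lemma ent_weaken: "entails T H a \<Longrightarrow> entails T (G @ H) a"
  by (induction G) (auto intro: ent_weaken1 simp del: entails.simps(2))

lemma proves_imp_refl: "T \<turnstile> a \<^bold>\<longrightarrow> a"
proof -
  have "T \<turnstile> (a \<^bold>\<longrightarrow> (a \<^bold>\<longrightarrow> a) \<^bold>\<longrightarrow> a) \<^bold>\<longrightarrow> (a \<^bold>\<longrightarrow> a \<^bold>\<longrightarrow> a) \<^bold>\<longrightarrow> a \<^bold>\<longrightarrow> a"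
    "T \<turnstile> a \<^bold>\<longrightarrow> (a \<^bold>\<longrightarrow> a) \<^bold>\<longrightarrow> a" "T \<turnstile> a \<^bold>\<longrightarrow> a \<^bold>\<longrightarrow> a"
    by (auto intro: proves.logical logical_axiom.intros)
  then show ?thesis by (meson proves.mp)
qed

lemma ent_hyp: "entails T (h # H) h"
  using ent_thm[OF proves_imp_refl] by simp

lemma ent_dne: "entails T H ((a \<^bold>\<longrightarrow> Fls) \<^bold>\<longrightarrow> Fls) \<Longrightarrow> entails T H a"
  by (erule ent_mp) (intro ent_logical logical_axiom.intros)

text \<open>The point of axioms that are sentences is the first case: they are their own instances.\<close>

lemma proves_fsubst:
  assumes T: "\<forall>a\<in>T. sentence a" and "T \<turnstile> a"
  shows "T \<turnstile> fsubst \<sigma> \<rho> a"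
  using assms(2)
proof (induction arbitrary: \<sigma> \<rho>)
  case (ax a)
  have "fsubst \<sigma> \<rho> a = fsubst Var (\<lambda>i. i) a"
    by (rule fsubst_ext[of 0 0]) (use T ax in \<open>simp_all add: sentence_def\<close>)
  then show ?case using ax by (simp add: fsubst_id proves.ax)
next
  case (logical a)
  then show ?case
    by (intro proves.logical, cases rule: logical_axiom.cases)
      (simp_all add: fsubst_substN fsubst_liftN fsubst_substS fsubst_liftS logical_axiom.intros)
next
  case (mp a b)
  then show ?case by (metis fsubst.simps(5) proves.mp)
qed (simp_all add: proves.genN proves.genS)

lemma ent_fsubst:
  assumes T: "\<forall>a\<in>T. sentence a" and "entails T H a"
  shows "entails T (map (fsubst \<sigma> \<rho>) H) (fsubst \<sigma> \<rho> a)"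
  using assms(2)
proof (induction H arbitrary: a)
  case (Cons h H)
  then have "entails T (map (fsubst \<sigma> \<rho>) H) (fsubst \<sigma> \<rho> (h \<^bold>\<longrightarrow> a))"
    using Cons.IH[of "h \<^bold>\<longrightarrow> a"] by simp
  then show ?case by simp
qed (simp add: proves_fsubst[OF T])

lemma ent_genN: "entails T (map (liftN 0) H) a \<Longrightarrow> entails T H (AllN a)"
proof (induction H arbitrary: a)
  case (Cons h H)
  then have "entails T H (AllN (liftN 0 h \<^bold>\<longrightarrow> a))" by simp
  moreover have "entails T H (AllN (liftN 0 h \<^bold>\<longrightarrow> a) \<^bold>\<longrightarrow> h \<^bold>\<longrightarrow> AllN a)"
    by (intro ent_logical logical_axiom.intros)
  ultimately have "entails T H (h \<^bold>\<longrightarrow> AllN a)" by (rule ent_mp)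
  then show ?case by simp
qed (simp add: proves.genN)

lemma ent_genS: "entails T (map (liftS 0) H) a \<Longrightarrow> entails T H (AllS a)"
proof (induction H arbitrary: a)
  case (Cons h H)
  then have "entails T H (AllS (liftS 0 h \<^bold>\<longrightarrow> a))" by simp
  moreover have "entails T H (AllS (liftS 0 h \<^bold>\<longrightarrow> a) \<^bold>\<longrightarrow> h \<^bold>\<longrightarrow> AllS a)"
    by (intro ent_logical logical_axiom.intros)
  ultimately have "entails T H (h \<^bold>\<longrightarrow> AllS a)" by (rule ent_mp)
  then show ?case by simp
qed (simp add: proves.genS)

text \<open>In de Bruijn notation a fresh variable \<open>m\<close> is generalized by renaming it to 0 while every other
  variable moves up by one: this turns the hypotheses into their lifts and the instance
  \<open>a[m]\<close> back into \<open>a\<close>.\<close>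

lemma ent_fresh_genN:
  assumes T: "\<forall>a\<in>T. sentence a"
    and H: "\<And>h. h \<in> set H \<Longrightarrow> bounded m m h" and a: "bounded (Suc m) m a"
    and entails: "entails T H (substN 0 (Var m) a)"
  shows "entails T H (AllN a)"
proof -
  define \<sigma> where "\<sigma> i = (if i = m then Var 0 else Var (Suc i))" for i
  have "fsubst \<sigma> (\<lambda>i. i) h = liftN 0 h" if "h \<in> set H" for h
    unfolding lift0 by (rule fsubst_ext[OF H[OF that]]) (simp_all add: \<sigma>_def)
  then have "map (fsubst \<sigma> (\<lambda>i. i)) H = map (liftN 0) H" by simp
  moreover have "fsubst \<sigma> (\<lambda>i. i) (substN 0 (Var m) a) = fsubst Var (\<lambda>i. i) a"
    unfolding subst0 fsubst_fsubst tsubst_case_nat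
    by (rule fsubst_ext[OF a]) (auto simp: \<sigma>_def split: nat.split)
  ultimately have "entails T (map (liftN 0) H) a"
    using ent_fsubst[OF T entails, of \<sigma> "\<lambda>i. i"] by (simp only: fsubst_id)
  then show ?thesis by (rule ent_genN)
qed

lemma ent_fresh_genS:
  assumes T: "\<forall>a\<in>T. sentence a"
    and H: "\<And>h. h \<in> set H \<Longrightarrow> bounded m m h" and a: "bounded m (Suc m) a"
    and entails: "entails T H (substS 0 m a)"
  shows "entails T H (AllS a)"
proof -
  define \<rho> where "\<rho> i = (if i = m then 0 else Suc i)" for i
  have "fsubst Var \<rho> h = liftS 0 h" if "h \<in> set H" for h
    unfolding lift0 by (rule fsubst_ext[OF H[OF that]]) (simp_all add: \<rho>_def)
  then have "map (fsubst Var \<rho>) H = map (liftS 0) H" by simp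
  moreover have "fsubst Var \<rho> (substS 0 m a) = fsubst Var (\<lambda>i. i) a"
    unfolding subst0 fsubst_fsubst case_nat_comp tsubst_Var
    by (rule fsubst_ext[OF a]) (auto simp: \<rho>_def split: nat.split)
  ultimately have "entails T (map (liftS 0) H) a"
    using ent_fsubst[OF T entails, of Var \<rho>] by (simp only: fsubst_id)
  then show ?thesis by (rule ent_genS)
qed

lemma bounded_list_ex: "\<exists>m. \<forall>h\<in>set H. bounded m m h"
proof (induction H)
  case (Cons h H)
  then obtain m where m: "\<forall>h\<in>set H. bounded m m h" by blast
  obtain n where "bounded n n h" using bounded_ex by blast
  then have "\<forall>h\<in>set (h # H). bounded (max m n) (max m n) h"
    using m by (auto intro: bounded_mono)
  then show ?case by blast
qed simp

text \<open>The requirement that one stage of the Henkin construction has to meet for the formula \<open>b\<close>; a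
  refuted universal formula must have a refuted instance.\<close>

definition decides :: "fm set \<Rightarrow> fm list \<Rightarrow> fm \<Rightarrow> bool" where
  "decides T H b \<longleftrightarrow>
     (entails T H b \<or> entails T H (b \<^bold>\<longrightarrow> Fls)) \<and>
     (\<forall>a. b = AllN a \<longrightarrow> entails T H b \<or> (\<exists>m. entails T H (substN 0 (Var m) a \<^bold>\<longrightarrow> Fls))) \<and>
     (\<forall>a. b = AllS a \<longrightarrow> entails T H b \<or> (\<exists>m. entails T H (substS 0 m a \<^bold>\<longrightarrow> Fls)))"

lemma decidesI:
  "entails T H b \<Longrightarrow> decides T H b"
  "entails T H (AllN a \<^bold>\<longrightarrow> Fls) \<Longrightarrow> entails T H (substN 0 (Var m) a \<^bold>\<longrightarrow> Fls) \<Longrightarrow> decides T H (AllN a)"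
  "entails T H (AllS a \<^bold>\<longrightarrow> Fls) \<Longrightarrow> entails T H (substS 0 m a \<^bold>\<longrightarrow> Fls) \<Longrightarrow> decides T H (AllS a)"
  unfolding decides_def by blast+

text \<open>Only finitely many hypotheses are in use at each stage, so a variable that none of them mentions
  is available as a Henkin witness, and no new constants have to be added to the language.\<close>

lemma henkin_step:
  assumes T: "\<forall>a\<in>T. sentence a" and con: "\<not> entails T H Fls"
  shows "\<exists>G. \<not> entails T (G @ H) Fls \<and> decides T (G @ H) b"
proof (cases "entails T H (b \<^bold>\<longrightarrow> Fls)")
  case False
  moreover have "decides T ([b] @ H) b" by (simp only: append.simps decidesI(1) ent_hyp)
  ultimately have "\<not> entails T ([b] @ H) Fls \<and> decides T ([b] @ H) b" by simp
  then show ?thesis by blast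
next
  case neg: True
  obtain m where m: "\<forall>h\<in>set (b # H). bounded m m h" using bounded_list_ex by blast
  consider (N) a where "b = AllN a" | (S) a where "b = AllS a"
    | (other) "\<nexists>a. b = AllN a \<or> b = AllS a" by blast
  then show ?thesis
  proof cases
    case N
    let ?w = "substN 0 (Var m) a \<^bold>\<longrightarrow> Fls"
    have "\<not> entails T H (?w \<^bold>\<longrightarrow> Fls)"
    proof
      assume "entails T H (?w \<^bold>\<longrightarrow> Fls)"
      then have "entails T H (substN 0 (Var m) a)" by (rule ent_dne)
      then have "entails T H (AllN a)"
        using m N by (intro ent_fresh_genN[OF T, of H m]) simp_all
      then show False using con neg N ent_mp[of T H "AllN a" Fls] by simp
    qed
    moreover have "decides T ([?w] @ H) b"
      unfolding N append.simps using ent_weaken1[OF neg] ent_hyp[of T ?w H]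
      by (intro decidesI(2)[of _ _ _ m]) (simp_all only: N)
    ultimately have "\<not> entails T ([?w] @ H) Fls \<and> decides T ([?w] @ H) b" by simp
    then show ?thesis by blast
  next
    case S
    let ?w = "substS 0 m a \<^bold>\<longrightarrow> Fls"
    have "\<not> entails T H (?w \<^bold>\<longrightarrow> Fls)"
    proof
      assume "entails T H (?w \<^bold>\<longrightarrow> Fls)"
      then have "entails T H (substS 0 m a)" by (rule ent_dne)
      then have "entails T H (AllS a)"
        using m S by (intro ent_fresh_genS[OF T, of H m]) simp_all
      then show False using con neg S ent_mp[of T H "AllS a" Fls] by simp
    qed
    moreover have "decides T ([?w] @ H) b"
      unfolding S append.simps using ent_weaken1[OF neg] ent_hyp[of T ?w H]
      by (intro decidesI(3)[of _ _ _ m]) (simp_all only: S)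
    ultimately have "\<not> entails T ([?w] @ H) Fls \<and> decides T ([?w] @ H) b" by simp
    then show ?thesis by blast
  next
    case other
    then have "\<not> entails T ([] @ H) Fls \<and> decides T ([] @ H) b"
      using con neg by (simp add: decides_def)
    then show ?thesis by blast
  qed
qed

instance tm :: countable by countable_datatype
instance fm :: countable by countable_datatype

locale henkin_theory =
  fixes \<Gamma> :: "fm set"
  assumes consistent: "Fls \<notin> \<Gamma>"
    and complete: "a \<in> \<Gamma> \<or> (a \<^bold>\<longrightarrow> Fls) \<in> \<Gamma>"
    and logical: "logical_axiom a \<Longrightarrow> a \<in> \<Gamma>"
    and mp: "a \<in> \<Gamma> \<Longrightarrow> (a \<^bold>\<longrightarrow> b) \<in> \<Gamma> \<Longrightarrow> b \<in> \<Gamma>"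
    and witnessN: "AllN a \<notin> \<Gamma> \<Longrightarrow> \<exists>t. (substN 0 t a \<^bold>\<longrightarrow> Fls) \<in> \<Gamma>"
    and witnessS: "AllS a \<notin> \<Gamma> \<Longrightarrow> \<exists>j. (substS 0 j a \<^bold>\<longrightarrow> Fls) \<in> \<Gamma>"

lemma henkin_extension:
  assumes T: "\<forall>a\<in>T. sentence a" and g: "\<not> (T \<turnstile> g)"
  shows "\<exists>\<Gamma>. henkin_theory \<Gamma> \<and> (\<forall>a. (T \<turnstile> a) \<longrightarrow> a \<in> \<Gamma>) \<and> g \<notin> \<Gamma>"
proof -
  have "\<exists>f. \<forall>n. \<not> entails T (f n) Fls \<and> (n = 0 \<longrightarrow> f n = [g \<^bold>\<longrightarrow> Fls]) \<and>
      ((\<exists>G. f (Suc n) = G @ f n) \<and> decides T (f (Suc n)) (from_nat n))"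
  proof (rule exE[OF dependent_nat_choice[where
        P = "\<lambda>n H. \<not> entails T H Fls \<and> (n = 0 \<longrightarrow> H = [g \<^bold>\<longrightarrow> Fls])" and
        Q = "\<lambda>n H H'. (\<exists>G. H' = G @ H) \<and> decides T H' (from_nat n)"]])
    have "\<not> entails T [g \<^bold>\<longrightarrow> Fls] Fls" using g ent_dne[of T "[]" g] by auto
    then show "\<exists>H. \<not> entails T H Fls \<and> (0 = 0 \<longrightarrow> H = [g \<^bold>\<longrightarrow> Fls])" by blast
    show "\<exists>H'. (\<not> entails T H' Fls \<and> (Suc n = 0 \<longrightarrow> H' = [g \<^bold>\<longrightarrow> Fls])) \<and>
        (\<exists>G. H' = G @ H) \<and> decides T H' (from_nat n)"
      if "\<not> entails T H Fls \<and> (n = 0 \<longrightarrow> H = [g \<^bold>\<longrightarrow> Fls])" for H n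
      using henkin_step[OF T, of H "from_nat n"] that by blast
  qed blast
  then obtain f where con: "\<And>n. \<not> entails T (f n) Fls" and f0: "f 0 = [g \<^bold>\<longrightarrow> Fls]"
    and ext: "\<And>n. \<exists>G. f (Suc n) = G @ f n" and dec: "\<And>n. decides T (f (Suc n)) (from_nat n)"
    by blast
  have mono: "entails T (f n) a" if "entails T (f m) a" "m \<le> n" for m n a
    using that(2,1)
  proof (induction rule: dec_induct)
    case (step n)
    then show ?case using ext[of n] by (metis ent_weaken)
  qed
  define \<Gamma> where "\<Gamma> = {a. \<exists>n. entails T (f n) a}"
  have theorems: "a \<in> \<Gamma>" if "T \<turnstile> a" for a
    using ent_thm[OF that] by (auto simp: \<Gamma>_def)
  have mp: "b \<in> \<Gamma>" if ab: "a \<in> \<Gamma>" "(a \<^bold>\<longrightarrow> b) \<in> \<Gamma>" for a b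
  proof -
    obtain m n where "entails T (f m) a" "entails T (f n) (a \<^bold>\<longrightarrow> b)" using ab by (auto simp: \<Gamma>_def)
    then have "entails T (f (max m n)) b" by (meson ent_mp max.cobounded1 max.cobounded2 mono)
    then show ?thesis by (auto simp: \<Gamma>_def)
  qed
  have dec': "decides T (f (Suc (to_nat b))) b" for b :: fm
    using dec[of "to_nat b"] by simp
  have "henkin_theory \<Gamma>"
  proof
    show "Fls \<notin> \<Gamma>" using con by (simp add: \<Gamma>_def)
    show "a \<in> \<Gamma> \<or> (a \<^bold>\<longrightarrow> Fls) \<in> \<Gamma>" for a
      using dec'[of a] unfolding decides_def \<Gamma>_def by blast
    show "a \<in> \<Gamma>" if "logical_axiom a" for a
      using that by (intro theorems proves.logical)
    show "b \<in> \<Gamma>" if "a \<in> \<Gamma>" "(a \<^bold>\<longrightarrow> b) \<in> \<Gamma>" for a b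
      using mp that .
    show "\<exists>t. (substN 0 t a \<^bold>\<longrightarrow> Fls) \<in> \<Gamma>" if "AllN a \<notin> \<Gamma>" for a
      using dec'[of "AllN a"] that unfolding decides_def \<Gamma>_def by blast
    show "\<exists>j. (substS 0 j a \<^bold>\<longrightarrow> Fls) \<in> \<Gamma>" if "AllS a \<notin> \<Gamma>" for a
      using dec'[of "AllS a"] that unfolding decides_def \<Gamma>_def by blast
  qed
  moreover have "g \<notin> \<Gamma>"
  proof
    assume "g \<in> \<Gamma>"
    moreover have "entails T (f 0) (g \<^bold>\<longrightarrow> Fls)" using ent_hyp[of T "g \<^bold>\<longrightarrow> Fls" "[]"] by (simp add: f0)
    then have "(g \<^bold>\<longrightarrow> Fls) \<in> \<Gamma>" unfolding \<Gamma>_def by blast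
    ultimately have "Fls \<in> \<Gamma>" by (rule mp)
    then show False using con by (simp add: \<Gamma>_def)
  qed
  ultimately show ?thesis using theorems by blast
qed

context henkin_theory
begin

lemma Imp_iff: "(a \<^bold>\<longrightarrow> b) \<in> \<Gamma> \<longleftrightarrow> (a \<in> \<Gamma> \<longrightarrow> b \<in> \<Gamma>)"
proof (cases "a \<in> \<Gamma>")
  case True
  have "(b \<^bold>\<longrightarrow> a \<^bold>\<longrightarrow> b) \<in> \<Gamma>" by (intro logical logical_axiom.intros)
  then show ?thesis using True mp by blast
next
  case False
  then have na: "(a \<^bold>\<longrightarrow> Fls) \<in> \<Gamma>" using complete by blast
  have "(Fls \<^bold>\<longrightarrow> (b \<^bold>\<longrightarrow> Fls) \<^bold>\<longrightarrow> Fls) \<in> \<Gamma>" "(((b \<^bold>\<longrightarrow> Fls) \<^bold>\<longrightarrow> Fls) \<^bold>\<longrightarrow> b) \<in> \<Gamma>"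
    by (intro logical logical_axiom.intros)+
  have lift: "(a \<^bold>\<longrightarrow> c) \<in> \<Gamma>" if "c \<in> \<Gamma>" for c
    using that mp[OF that logical[OF logical_axiom.intros(1)]] by blast
  have S: "(a \<^bold>\<longrightarrow> d) \<in> \<Gamma>" if "(a \<^bold>\<longrightarrow> c) \<in> \<Gamma>" "(c \<^bold>\<longrightarrow> d) \<in> \<Gamma>" for c d
    using mp[OF that(1) mp[OF lift[OF that(2)] logical[OF logical_axiom.intros(2)]]] .
  have "(a \<^bold>\<longrightarrow> b) \<in> \<Gamma>"
    using S[OF S[OF na]] \<open>(Fls \<^bold>\<longrightarrow> (b \<^bold>\<longrightarrow> Fls) \<^bold>\<longrightarrow> Fls) \<in> \<Gamma>\<close> \<open>(((b \<^bold>\<longrightarrow> Fls) \<^bold>\<longrightarrow> Fls) \<^bold>\<longrightarrow> b) \<in> \<Gamma>\<close> by blast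
  then show ?thesis using False by blast
qed

lemma AllN_iff: "AllN a \<in> \<Gamma> \<longleftrightarrow> (\<forall>t. substN 0 t a \<in> \<Gamma>)"
  using witnessN[of a] mp[OF _ logical[OF logical_axiom.intros(4)]] consistent Imp_iff by blast

lemma AllS_iff: "AllS a \<in> \<Gamma> \<longleftrightarrow> (\<forall>j. substS 0 j a \<in> \<Gamma>)"
  using witnessS[of a] mp[OF _ logical[OF logical_axiom.intros(6)]] consistent Imp_iff by blast

lemma eq_refl: "(t \<^bold>= t) \<in> \<Gamma>"
  by (intro logical logical_axiom.intros)

lemma eq_subst: "(s \<^bold>= t) \<in> \<Gamma> \<Longrightarrow> substN 0 s a \<in> \<Gamma> \<Longrightarrow> substN 0 t a \<in> \<Gamma>"
  using logical[OF logical_axiom.intros(9)[of s t a]] by (simp add: Imp_iff)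

lemma subst_tm_lift: "subst_tm 0 u (lift_tm 0 t) = t"
  by (simp add: subst_tm_tsubst lift0 tsubst_tsubst tsubst_Var)

lemma eq_sym: "(s \<^bold>= t) \<in> \<Gamma> \<Longrightarrow> (t \<^bold>= s) \<in> \<Gamma>"
  using eq_subst[of s t "Var 0 \<^bold>= lift_tm 0 s"] eq_refl[of s] by (simp add: subst_tm_lift)

lemma eq_trans: "(s \<^bold>= t) \<in> \<Gamma> \<Longrightarrow> (t \<^bold>= u) \<in> \<Gamma> \<Longrightarrow> (s \<^bold>= u) \<in> \<Gamma>"
  using eq_subst[of t u "lift_tm 0 s \<^bold>= Var 0"] by (simp add: subst_tm_lift)

lemma eq_cong:
  assumes "(s \<^bold>= s') \<in> \<Gamma>" and "(t \<^bold>= t') \<in> \<Gamma>"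
  shows "(s \<^bold>+ t \<^bold>= s' \<^bold>+ t') \<in> \<Gamma>" and "(s \<^bold>* t \<^bold>= s' \<^bold>* t') \<in> \<Gamma>"
    and "(s \<^bold>< t) \<in> \<Gamma> \<Longrightarrow> (s' \<^bold>< t') \<in> \<Gamma>"
proof -
  have "(s \<^bold>+ t \<^bold>= s \<^bold>+ t) \<in> \<Gamma>" by (rule eq_refl)
  then have "(s \<^bold>+ t \<^bold>= s' \<^bold>+ t) \<in> \<Gamma>"
    using eq_subst[OF assms(1), of "lift_tm 0 (s \<^bold>+ t) \<^bold>= Var 0 \<^bold>+ lift_tm 0 t"]
    by (simp add: subst_tm_lift)
  then show "(s \<^bold>+ t \<^bold>= s' \<^bold>+ t') \<in> \<Gamma>"
    using eq_subst[OF assms(2), of "lift_tm 0 (s \<^bold>+ t) \<^bold>= lift_tm 0 s' \<^bold>+ Var 0"]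
    by (simp add: subst_tm_lift)
  have "(s \<^bold>* t \<^bold>= s \<^bold>* t) \<in> \<Gamma>" by (rule eq_refl)
  then have "(s \<^bold>* t \<^bold>= s' \<^bold>* t) \<in> \<Gamma>"
    using eq_subst[OF assms(1), of "lift_tm 0 (s \<^bold>* t) \<^bold>= Var 0 \<^bold>* lift_tm 0 t"]
    by (simp add: subst_tm_lift)
  then show "(s \<^bold>* t \<^bold>= s' \<^bold>* t') \<in> \<Gamma>"
    using eq_subst[OF assms(2), of "lift_tm 0 (s \<^bold>* t) \<^bold>= lift_tm 0 s' \<^bold>* Var 0"]
    by (simp add: subst_tm_lift)
  assume "(s \<^bold>< t) \<in> \<Gamma>"
  then have "(s' \<^bold>< t) \<in> \<Gamma>"
    using eq_subst[OF assms(1), of "Var 0 \<^bold>< lift_tm 0 t"] by (simp add: subst_tm_lift)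
  then show "(s' \<^bold>< t') \<in> \<Gamma>"
    using eq_subst[OF assms(2), of "lift_tm 0 s' \<^bold>< Var 0"] by (simp add: subst_tm_lift)
qed

lemma eq_In: "(s \<^bold>= t) \<in> \<Gamma> \<Longrightarrow> (s \<^bold>\<in> j) \<in> \<Gamma> \<Longrightarrow> (t \<^bold>\<in> j) \<in> \<Gamma>"
  using eq_subst[of s t "Var 0 \<^bold>\<in> j"] by simp

text \<open>The domain of the term model consists of the classes of provably equal terms.  The classes of the
  numerals are pairwise different, so there are infinitely many classes, and the natural numbers
  themselves can serve as the domain.\<close>

lemma term_numbering:
  assumes succ_ne: "AllN (\<^bold>\<not> (Var 0 \<^bold>+ One \<^bold>= Zero)) \<in> \<Gamma>"
    and succ_inj: "AllN (AllN (Var 0 \<^bold>+ One \<^bold>= Var 1 \<^bold>+ One \<^bold>\<longrightarrow> Var 0 \<^bold>= Var 1)) \<in> \<Gamma>"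
  shows "\<exists>h :: tm \<Rightarrow> nat. surj h \<and> (\<forall>s t. h s = h t \<longleftrightarrow> (s \<^bold>= t) \<in> \<Gamma>)"
proof -
  define cls where "cls t = {s. (t \<^bold>= s) \<in> \<Gamma>}" for t
  have cls: "cls s = cls t \<longleftrightarrow> (s \<^bold>= t) \<in> \<Gamma>" for s t
    unfolding cls_def using eq_refl eq_sym eq_trans by blast
  have ne: "(t \<^bold>+ One \<^bold>= Zero) \<notin> \<Gamma>" for t
    using succ_ne consistent by (auto simp: AllN_iff Neg_def Imp_iff)
  have inj: "(s \<^bold>= t) \<in> \<Gamma>" if "(s \<^bold>+ One \<^bold>= t \<^bold>+ One) \<in> \<Gamma>" for s t
    using succ_inj that by (simp add: AllN_iff Imp_iff subst_tm_lift)
  have "m = n" if "(num m \<^bold>= num n) \<in> \<Gamma>" for m n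
    using that
  proof (induction m arbitrary: n)
    case 0
    then show ?case using ne eq_sym by (cases n) auto
  next
    case (Suc m)
    then show ?case using ne inj by (cases n) auto
  qed
  then have "inj (\<lambda>n. cls (num n))" by (auto simp: inj_def cls)
  then have "infinite (range (\<lambda>n. cls (num n)))" using finite_imageD by blast
  then have inf: "infinite (range cls)" by (rule infinite_super[rotated]) auto
  then have bij: "bij_betw (to_nat_on (range cls)) (range cls) UNIV"
    by (simp add: to_nat_on_infinite)
  have "surj (\<lambda>t. to_nat_on (range cls) (cls t))"
    using bij by (auto simp: bij_betw_def image_image)
  moreover have "to_nat_on (range cls) (cls s) = to_nat_on (range cls) (cls t) \<longleftrightarrow> (s \<^bold>= t) \<in> \<Gamma>" for s t
    unfolding cls[symmetric] by (rule to_nat_on_inj[OF countable_image[OF countableI_type]]) blast+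
  ultimately show ?thesis by blast
qed

end

text \<open>The universal closure; the same number of number and of set quantifiers is used, since a common
  bound on all free variables always exists.\<close>

definition closure :: "nat \<Rightarrow> fm \<Rightarrow> fm" where
  "closure m a = (AllS ^^ m) ((AllN ^^ m) a)"

lemma proves_closure: "T \<turnstile> a \<Longrightarrow> T \<turnstile> closure m a"
proof -
  assume a: "T \<turnstile> a"
  have "T \<turnstile> (AllN ^^ m) a" for m by (induction m) (auto intro: a proves.genN)
  then have "T \<turnstile> (AllS ^^ k) ((AllN ^^ m) a)" for k m by (induction k) (auto intro: proves.genS)
  then show ?thesis by (simp add: closure_def)
qed

lemma sentence_closure: "bounded m m a \<Longrightarrow> sentence (closure m a)"
proof -
  have N: "bounded i n ((AllN ^^ k) a)" if "bounded (i + k) n a" for i k n a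
    using that by (induction k arbitrary: i) simp_all
  have S: "bounded n i ((AllS ^^ k) a)" if "bounded n (i + k) a" for i k n a
    using that by (induction k arbitrary: i) simp_all
  assume "bounded m m a"
  then show ?thesis using N[of 0 m m a] S[of 0 0 m] by (simp add: closure_def sentence_def)
qed

lemma (in l2_structure) valid_closure: "valid (closure m a) \<longleftrightarrow> valid a"
proof -
  have "valid ((AllN ^^ k) a) \<longleftrightarrow> valid a" for k a by (induction k) (auto simp: valid_AllN)
  moreover have "valid ((AllS ^^ k) a) \<longleftrightarrow> valid a" for k a by (induction k) (auto simp: valid_AllS)
  ultimately show ?thesis by (simp add: closure_def)
qed

text \<open>The two facts about the successor guarantee that the term model is infinite, which is why its
  domain can be fixed in advance to be the type of natural numbers.  The Henkin construction is run
  on the closed theorems of \<open>T\<close>: they prove nothing new, and a structure that satisfies the universal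
  closures of the theorems of \<open>T\<close> satisfies these theorems.\<close>

theorem completeness:
  assumes "T \<turnstile> \<^bold>\<not> (Var 0 \<^bold>+ One \<^bold>= Zero)"
    and "T \<turnstile> Var 0 \<^bold>+ One \<^bold>= Var 1 \<^bold>+ One \<^bold>\<longrightarrow> Var 0 \<^bold>= Var 1"
    and "\<not> (T \<turnstile> g)"
  shows "\<exists>(zero :: nat) one plus times less Sets. l2_structure Sets \<and>
    (\<forall>a. (T \<turnstile> a) \<longrightarrow> l2_structure.valid zero one plus times less Sets a) \<and>
    \<not> l2_structure.valid zero one plus times less Sets g"
proof -
  define T' where "T' = {a. sentence a \<and> (T \<turnstile> a)}"
  have sent: "\<forall>a\<in>T'. sentence a" by (simp add: T'_def)
  have conservative: "T \<turnstile> a" if "T' \<turnstile> a" for a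
    using that
  proof induction
    case (mp a b)
    then show ?case by (metis proves.mp)
  qed (simp_all add: T'_def proves.intros(2,4,5))
  obtain k where k: "bounded k k g" using bounded_ex by blast
  have "\<not> (T' \<turnstile> g)" using conservative assms(3) by blast
  then obtain \<Gamma> where "henkin_theory \<Gamma>" and T'\<Gamma>: "\<And>a. T' \<turnstile> a \<Longrightarrow> a \<in> \<Gamma>" and g: "g \<notin> \<Gamma>"
    using henkin_extension[OF sent] by blast
  then interpret henkin_theory \<Gamma> by simp
  have "AllN (\<^bold>\<not> (Var 0 \<^bold>+ One \<^bold>= Zero)) \<in> \<Gamma>"
    using assms(1) by (intro T'\<Gamma> proves.ax) (simp add: T'_def sentence_def Neg_def proves.genN)
  moreover have "AllN (AllN (Var 0 \<^bold>+ One \<^bold>= Var 1 \<^bold>+ One \<^bold>\<longrightarrow> Var 0 \<^bold>= Var 1)) \<in> \<Gamma>"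
    using assms(2) by (intro T'\<Gamma> proves.ax) (simp add: T'_def sentence_def proves.genN)
  ultimately obtain h :: "tm \<Rightarrow> nat" where surj: "surj h"
    and h: "\<And>s t. h s = h t \<longleftrightarrow> (s \<^bold>= t) \<in> \<Gamma>"
    using term_numbering by blast
  define rep where "rep = inv h"
  have h_rep: "h (rep n) = n" for n by (simp add: rep_def surj surj_f_inv_f)
  have rep_h: "(rep (h t) \<^bold>= t) \<in> \<Gamma>" "(t \<^bold>= rep (h t)) \<in> \<Gamma>" for t
    using h h_rep by metis+
  define plus where "plus m n = h (rep m \<^bold>+ rep n)" for m n
  define times where "times m n = h (rep m \<^bold>* rep n)" for m n
  define less where "less m n \<longleftrightarrow> (rep m \<^bold>< rep n) \<in> \<Gamma>" for m n
  define S where "S j = {n. (rep n \<^bold>\<in> j) \<in> \<Gamma>}" for j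
  have plus: "plus (h s) (h t) = h (s \<^bold>+ t)" and times: "times (h s) (h t) = h (s \<^bold>* t)" for s t
    by (simp_all add: plus_def times_def h eq_cong rep_h)
  have less: "less (h s) (h t) \<longleftrightarrow> (s \<^bold>< t) \<in> \<Gamma>" for s t
    unfolding less_def using eq_cong(3) rep_h by blast
  have S: "h s \<in> S j \<longleftrightarrow> (s \<^bold>\<in> j) \<in> \<Gamma>" for s j
    unfolding S_def using eq_In rep_h by blast
  interpret l2_structure "h Zero" "h One" plus times less "range S"
    by unfold_locales simp
  have val: "mval (\<lambda>i. h (\<sigma> i)) t = h (tsubst \<sigma> t)" for \<sigma> t
    by (induction t) (simp_all add: plus times)
  have truth: "msat (\<lambda>i. h (\<sigma> i)) (\<lambda>i. S (\<rho> i)) a \<longleftrightarrow> fsubst \<sigma> \<rho> a \<in> \<Gamma>" for \<sigma> \<rho> a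
  proof (induction a arbitrary: \<sigma> \<rho>)
    case (AllN a)
    have "msat (case_nat (h t) (\<lambda>i. h (\<sigma> i))) (\<lambda>i. S (\<rho> i)) a
        \<longleftrightarrow> substN 0 t (fsubst (bindN \<sigma>) \<rho> a) \<in> \<Gamma>" for t
      using AllN[of "case_nat t \<sigma>" \<rho>] by (simp add: case_nat_comp subst0 fsubst_fsubst tsubst_bindN)
    then show ?case using surj by (simp add: AllN_iff) (metis surj_f_inv_f)
  next
    case (AllS a)
    have "msat (\<lambda>i. h (\<sigma> i)) (case_nat (S j) (\<lambda>i. S (\<rho> i))) a
        \<longleftrightarrow> substS 0 j (fsubst \<sigma> (bindS \<rho>) a) \<in> \<Gamma>" for j
    proof -
      have "(\<lambda>i. case_nat j (\<lambda>i. i) (bindS \<rho> i)) = case_nat j \<rho>"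
        by (auto simp: fun_eq_iff bindS_def split: nat.split)
      then show ?thesis
        using AllS[of \<sigma> "case_nat j \<rho>"] by (simp add: case_nat_comp subst0 fsubst_fsubst tsubst_Var)
    qed
    then show ?case by (simp add: AllS_iff)
  qed (simp_all add: val h less S Imp_iff consistent)
  have "valid a" if "T \<turnstile> a" for a
  proof -
    obtain m where "bounded m m a" using bounded_ex by blast
    then have "closure m a \<in> T'"
      using that by (simp add: T'_def sentence_closure proves_closure)
    then have *: "sentence (closure m a)" "closure m a \<in> \<Gamma>"
      using sent T'\<Gamma> by (auto intro: proves.ax)
    then have "msat (\<lambda>i. h (Var i)) S (closure m a)"
      using truth[of Var "\<lambda>i. i" "closure m a"] by (simp add: fsubst_id)
    then have "valid (closure m a)"
      using msat_cong_sentence[OF *(1)] by (auto simp: valid_def)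
    then show ?thesis by (simp add: valid_closure)
  qed
  moreover have "\<not> valid g"
  proof
    assume "valid g"
    then have "msat (\<lambda>i. h (Var i)) S g" by (simp add: valid_def)
    then show False using truth[of Var "\<lambda>i. i" g] g by (simp add: fsubst_id)
  qed
  ultimately show ?thesis using l2_structure_axioms by blast
qed

section \<open>Arithmetic in models of \<open>ACA\<^sub>0\<close>\<close>

locale arith_model = l2_structure +
  assumes ACA0_valid: "a \<in> ACA0 \<Longrightarrow> valid a"
begin

lemma valid_inst: "valid a \<Longrightarrow> \<exists>X\<in>Sets. msat e (\<lambda>_. X) a"
  using Sets_nonempty unfolding valid_def by (metis all_not_in_conv image_subset_iff)

lemma basic_inst:
  assumes "a \<in> basic_axioms"
  shows "\<exists>X\<in>Sets. msat (case_nat x (\<lambda>_. y)) (\<lambda>_. X) a"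
  using assms by (intro valid_inst ACA0_valid) (simp add: ACA0_def)

lemma succ_ne: "x \<oplus> one \<noteq> zero"
  using basic_inst[of "\<^bold>\<not> (Var 0 \<^bold>+ One \<^bold>= Zero)" x x] by (auto simp: basic_axioms_def)

lemma succ_inj: "x \<oplus> one = y \<oplus> one \<longleftrightarrow> x = y"
  using basic_inst[of "Var 0 \<^bold>+ One \<^bold>= Var 1 \<^bold>+ One \<^bold>\<longrightarrow> Var 0 \<^bold>= Var 1" x y]
  by (auto simp: basic_axioms_def)

lemma plus_zero: "x \<oplus> zero = x"
  using basic_inst[of "Var 0 \<^bold>+ Zero \<^bold>= Var 0" x x] by (auto simp: basic_axioms_def)

lemma plus_succ: "x \<oplus> (y \<oplus> one) = (x \<oplus> y) \<oplus> one"
  using basic_inst[of "Var 0 \<^bold>+ (Var 1 \<^bold>+ One) \<^bold>= (Var 0 \<^bold>+ Var 1) \<^bold>+ One" x y]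
  by (auto simp: basic_axioms_def)

lemma times_zero: "x \<otimes> zero = zero"
  using basic_inst[of "Var 0 \<^bold>* Zero \<^bold>= Zero" x x] by (auto simp: basic_axioms_def)

lemma times_succ: "x \<otimes> (y \<oplus> one) = (x \<otimes> y) \<oplus> x"
  using basic_inst[of "Var 0 \<^bold>* (Var 1 \<^bold>+ One) \<^bold>= (Var 0 \<^bold>* Var 1) \<^bold>+ Var 0" x y]
  by (auto simp: basic_axioms_def)

lemma not_less_zero: "\<not> x \<prec> zero"
  using basic_inst[of "\<^bold>\<not> (Var 0 \<^bold>< Zero)" x x] by (auto simp: basic_axioms_def)

lemma less_succ: "x \<prec> y \<oplus> one \<longleftrightarrow> x \<prec> y \<or> x = y"
  using basic_inst[of "Var 0 \<^bold>< Var 1 \<^bold>+ One \<^bold>\<longleftrightarrow> (Var 0 \<^bold>< Var 1 \<^bold>\<or> Var 0 \<^bold>= Var 1)" x y]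
  by (auto simp: basic_axioms_def)

lemma comprehension:
  assumes "arithmetical a" and "range E \<subseteq> Sets"
  shows "{x. msat (case_nat x e) E a} \<in> Sets"
proof -
  have "valid (ExS (AllN (Var 0 \<^bold>\<in> 0 \<^bold>\<longleftrightarrow> liftS 0 a)))"
    using assms(1) by (intro ACA0_valid) (auto simp: ACA0_def)
  then have "\<exists>X\<in>Sets. \<forall>x. x \<in> X \<longleftrightarrow> msat (case_nat x e) E a"
    using assms(2) by (simp add: valid_def)
  then obtain X where "X \<in> Sets" "\<And>x. x \<in> X \<longleftrightarrow> msat (case_nat x e) E a" by blast
  moreover from this have "X = {x. msat (case_nat x e) E a}" by blast
  ultimately show ?thesis by simp
qed

lemma set_induct:
  assumes "X \<in> Sets" and "zero \<in> X" and "\<And>x. x \<in> X \<Longrightarrow> x \<oplus> one \<in> X"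
  shows "x \<in> X"
proof -
  have "valid induction_axiom" by (intro ACA0_valid) (simp add: ACA0_def)
  then have "msat (\<lambda>_. x) (\<lambda>_. X) induction_axiom"
    using assms(1) by (simp add: valid_def image_subset_iff)
  then show ?thesis using assms by (simp add: induction_axiom_def)
qed

lemma formula_induct:
  assumes "arithmetical a" and "X \<in> Sets \<Longrightarrow> msat (case_nat zero e) (\<lambda>_. X) a"
    and "\<And>x. X \<in> Sets \<Longrightarrow> msat (case_nat x e) (\<lambda>_. X) a \<Longrightarrow> msat (case_nat (x \<oplus> one) e) (\<lambda>_. X) a"
    and "X \<in> Sets"
  shows "msat (case_nat x e) (\<lambda>_. X) a"
  using set_induct[of "{x. msat (case_nat x e) (\<lambda>_. X) a}" x]
    comprehension[OF assms(1), of "\<lambda>_. X" e] assms(2-4) by (simp add: image_subset_iff)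

text \<open>Induction for formulas without set variables.  The assignment to set variables is existentially
  quantified because it is irrelevant; a member of the family of sets just has to exist.\<close>

lemma term_induct:
  assumes "arithmetical a" and "\<And>X. msat (case_nat zero e) (\<lambda>_. X) a"
    and "\<And>x X. msat (case_nat x e) (\<lambda>_. X) a \<Longrightarrow> msat (case_nat (x \<oplus> one) e) (\<lambda>_. X) a"
  shows "\<exists>X. msat (case_nat x e) (\<lambda>_. X) a"
  using formula_induct[OF assms(1)] assms(2,3) Sets_nonempty by (meson all_not_in_conv)

lemma zero_plus: "zero \<oplus> x = x"
  using term_induct[of "Zero \<^bold>+ Var 0 \<^bold>= Var 0" "\<lambda>_. x" x]
  by (simp add: plus_zero plus_succ succ_inj)

lemma succ_plus: "(x \<oplus> one) \<oplus> y = (x \<oplus> y) \<oplus> one"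
  using term_induct[of "(Var 1 \<^bold>+ One) \<^bold>+ Var 0 \<^bold>= (Var 1 \<^bold>+ Var 0) \<^bold>+ One" "\<lambda>_. x" y]
  by (simp add: plus_zero plus_succ)

lemma plus_comm: "x \<oplus> y = y \<oplus> x"
  using term_induct[of "Var 1 \<^bold>+ Var 0 \<^bold>= Var 0 \<^bold>+ Var 1" "\<lambda>_. x" y]
  by (simp add: plus_zero zero_plus plus_succ succ_plus)

lemma plus_assoc: "(x \<oplus> y) \<oplus> z = x \<oplus> (y \<oplus> z)"
  using term_induct[of "(Var 1 \<^bold>+ Var 2) \<^bold>+ Var 0 \<^bold>= Var 1 \<^bold>+ (Var 2 \<^bold>+ Var 0)"
      "case_nat x (\<lambda>_. y)" z]
  by (simp add: plus_zero plus_succ)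

lemma plus_left_comm: "x \<oplus> (y \<oplus> z) = y \<oplus> (x \<oplus> z)"
  by (metis plus_assoc plus_comm)

lemmas plus_ac = plus_assoc plus_comm plus_left_comm

lemma zero_times: "zero \<otimes> x = zero"
  using term_induct[of "Zero \<^bold>* Var 0 \<^bold>= Zero" "\<lambda>_. x" x]
  by (simp add: plus_zero times_zero times_succ)

lemma succ_times: "(x \<oplus> one) \<otimes> y = x \<otimes> y \<oplus> y"
  using term_induct[of "(Var 1 \<^bold>+ One) \<^bold>* Var 0 \<^bold>= Var 1 \<^bold>* Var 0 \<^bold>+ Var 0" "\<lambda>_. x" y]
  by (simp add: times_zero plus_zero times_succ plus_ac)

lemma times_comm: "x \<otimes> y = y \<otimes> x"
  using term_induct[of "Var 1 \<^bold>* Var 0 \<^bold>= Var 0 \<^bold>* Var 1" "\<lambda>_. x" y]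
  by (simp add: zero_times times_zero times_succ succ_times)

lemma distrib_left: "x \<otimes> (y \<oplus> z) = x \<otimes> y \<oplus> x \<otimes> z"
  using term_induct[of "Var 1 \<^bold>* (Var 2 \<^bold>+ Var 0) \<^bold>= Var 1 \<^bold>* Var 2 \<^bold>+ Var 1 \<^bold>* Var 0"
      "case_nat x (\<lambda>_. y)" z]
  by (simp add: plus_zero times_zero times_succ plus_assoc[symmetric])

lemma distrib_right: "(y \<oplus> z) \<otimes> x = y \<otimes> x \<oplus> z \<otimes> x"
  using distrib_left[of x y z] by (simp add: times_comm)

lemma plus_cancel: "x \<oplus> z = y \<oplus> z \<longleftrightarrow> x = y"
  using term_induct[of "Var 1 \<^bold>+ Var 0 \<^bold>= Var 2 \<^bold>+ Var 0 \<^bold>\<longrightarrow> Var 1 \<^bold>= Var 2"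
      "case_nat x (\<lambda>_. y)" z]
  by (auto simp: plus_zero plus_assoc[symmetric] succ_inj)

lemma plus_cancel_left: "z \<oplus> x = z \<oplus> y \<longleftrightarrow> x = y"
  using plus_cancel[of x z y] by (simp add: plus_comm)

lemma zero_or_succ: "x = zero \<or> (\<exists>y. x = y \<oplus> one)"
  using term_induct[of "Var 0 \<^bold>= Zero \<^bold>\<or> ExN (Var 1 \<^bold>= Var 0 \<^bold>+ One)" "\<lambda>_. x" x]
  by (auto simp: Or_def ExN_def Neg_def)

text \<open>Linearity of the order, in the form needed to compare the two sums in the injectivity of pairing.\<close>

lemma comparable: "(\<exists>z. y = x \<oplus> z) \<or> (\<exists>z. x = y \<oplus> z)"
proof -
  have step: "(\<exists>z. y \<oplus> one = x \<oplus> z) \<or> (\<exists>z. x = (y \<oplus> one) \<oplus> z)"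
    if "(\<exists>z. y = x \<oplus> z) \<or> (\<exists>z. x = y \<oplus> z)" for y
    using that
  proof
    assume "\<exists>z. y = x \<oplus> z"
    then obtain z where "y = x \<oplus> z" ..
    then have "y \<oplus> one = x \<oplus> (z \<oplus> one)" by (simp add: plus_assoc)
    then show ?thesis by blast
  next
    assume "\<exists>z. x = y \<oplus> z"
    then obtain z where z: "x = y \<oplus> z" ..
    show ?thesis
    proof (cases "z = zero")
      case True
      then have "y \<oplus> one = x \<oplus> one" by (simp add: z plus_zero)
      then show ?thesis by blast
    next
      case False
      then obtain w where "z = w \<oplus> one" using zero_or_succ by blast
      then have "x = (y \<oplus> one) \<oplus> w" by (simp add: z plus_ac)
      then show ?thesis by blast
    qed
  qed
  have "\<exists>z. x = zero \<oplus> z" by (simp add: zero_plus)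
  then show ?thesis
    using term_induct[of "ExN (Var 1 \<^bold>= Var 2 \<^bold>+ Var 0) \<^bold>\<or> ExN (Var 2 \<^bold>= Var 1 \<^bold>+ Var 0)" "\<lambda>_. x" y]
      step by (simp add: Or_def ExN_def Neg_def) metis
qed

definition mpair :: "'a \<Rightarrow> 'a \<Rightarrow> 'a" where
  "mpair x y = (x \<oplus> y) \<otimes> (x \<oplus> y) \<oplus> x"

text \<open>If \<open>s = x + y\<close> and \<open>x' + y' = s + z\<close> with \<open>z > 0\<close>, then \<open>(s + z)\<^sup>2\<close> exceeds
  \<open>s\<^sup>2\<close> by more than \<open>s\<close>, hence by more than \<open>x\<close>.\<close>

lemma mpair_inj_aux:
  assumes eq: "mpair x y = mpair x' y'" and z: "x' \<oplus> y' = (x \<oplus> y) \<oplus> z"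
  shows "x = x' \<and> y = y'"
proof (cases "z = zero")
  case True
  then have s: "x' \<oplus> y' = x \<oplus> y" using z by (simp add: plus_zero)
  then have "x = x'" using eq by (simp add: mpair_def plus_cancel_left)
  then show ?thesis using s by (simp add: plus_cancel_left)
next
  case False
  then obtain w where w: "z = w \<oplus> one" using zero_or_succ by blast
  let ?s = "x \<oplus> y"
  have "(?s \<oplus> z) \<otimes> (?s \<oplus> z) = ?s \<otimes> ?s \<oplus> (?s \<otimes> z \<oplus> (z \<otimes> ?s \<oplus> z \<otimes> z))"
    by (simp add: distrib_left distrib_right plus_ac)
  then have "?s \<otimes> ?s \<oplus> x = ?s \<otimes> ?s \<oplus> (?s \<otimes> z \<oplus> (z \<otimes> ?s \<oplus> z \<otimes> z) \<oplus> x')"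
    using eq z by (simp add: mpair_def plus_assoc)
  then have "x = ?s \<otimes> z \<oplus> (z \<otimes> ?s \<oplus> z \<otimes> z) \<oplus> x'" by (simp only: plus_cancel_left)
  also have "\<dots> = (?s \<otimes> w \<oplus> ?s) \<oplus> (z \<otimes> ?s \<oplus> (z \<otimes> w \<oplus> (w \<oplus> one))) \<oplus> x'"
    by (simp add: w times_succ)
  also have "\<dots> = x \<oplus> ((?s \<otimes> w \<oplus> (y \<oplus> (z \<otimes> ?s \<oplus> (z \<otimes> w \<oplus> (w \<oplus> x'))))) \<oplus> one)"
    by (simp only: plus_ac)
  finally have "x \<oplus> zero = x \<oplus> ((?s \<otimes> w \<oplus> (y \<oplus> (z \<otimes> ?s \<oplus> (z \<otimes> w \<oplus> (w \<oplus> x'))))) \<oplus> one)"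
    by (simp add: plus_zero)
  then show ?thesis using succ_ne by (metis plus_cancel_left)
qed

lemma mpair_inject [simp]: "mpair x y = mpair x' y' \<longleftrightarrow> x = x' \<and> y = y'"
  using comparable[of "x' \<oplus> y'" "x \<oplus> y"] mpair_inj_aux[of x y x' y'] mpair_inj_aux[of x' y' x y]
  by auto

lemma mval_pairt [simp]: "mval e (s \<star> t) = mpair (mval e s) (mval e t)"
  by (simp add: pairt_def mpair_def)

subsection \<open>Standard numbers\<close>

text \<open>The embedding of the natural numbers into the model.\<close>

primrec nm :: "nat \<Rightarrow> 'a" where
  "nm 0 = zero"
| "nm (Suc n) = nm n \<oplus> one"

declare nm.simps [simp del]

lemma mval_num [simp]: "mval e (num n) = nm n"
  by (induction n) (simp_all add: nm.simps)

lemma nm_plus: "nm a \<oplus> nm b = nm (a + b)"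
  by (induction b) (simp_all add: nm.simps plus_zero plus_succ)

lemma nm_times: "nm a \<otimes> nm b = nm (a * b)"
proof (induction b)
  case (Suc b)
  then show ?case using nm_plus[of "a * b" a] by (simp add: nm.simps times_succ add.commute)
qed (simp add: nm.simps times_zero)

lemma nm_inject [simp]: "nm a = nm b \<longleftrightarrow> a = b"
proof (induction a arbitrary: b)
  case 0
  then show ?case using succ_ne[symmetric] by (cases b) (simp_all add: nm.simps)
next
  case (Suc a)
  then show ?case using succ_ne by (cases b) (simp_all add: nm.simps succ_inj)
qed

lemma mval_up_numeral [simp]:
  "mval (case_nat x e) (t \<up> numeral k) = mval e (t \<up> pred_numeral k)"
  by (simp add: numeral_eq_Suc)

text \<open>Codes of syntactic objects evaluate to iterated pairs of standard numbers.  These are kept in the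
  normal form built from \<open>mpair\<close> and \<open>nm\<close>, in which injectivity decides equations, and the constants
  of the language have to follow suit.\<close>

lemma mval_const [simp]: "mval e Zero = nm 0" "mval e One = nm 1"
  by (simp_all add: nm.simps zero_plus)

declare mval.simps(2,3) [simp del]

declare nm_plus [simp] nm_times [simp]

lemma less_nm: "x \<prec> nm n \<longleftrightarrow> (\<exists>i<n. x = nm i)"
proof (induction n)
  case 0
  then show ?case using not_less_zero by (simp add: nm.simps)
next
  case (Suc n)
  then show ?case by (simp only: nm.simps less_succ) (auto simp: less_Suc_eq)
qed

lemma nm_less [simp]: "nm a \<prec> nm b \<longleftrightarrow> a < b"
  by (auto simp: less_nm)

lemma nm_pair [simp]: "nm (pair a b) = mpair (nm a) (nm b)"
  by (simp add: pair_def mpair_def)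

text \<open>The standard numbers are closed downwards, so decomposing a standard sum never leads to
  nonstandard elements.\<close>

lemma plus_standard: "x \<oplus> y = nm k \<Longrightarrow> \<exists>a b. x = nm a \<and> y = nm b"
proof (induction k arbitrary: y)
  case 0
  have "y = zero"
  proof (rule ccontr)
    assume "y \<noteq> zero"
    then obtain w where "y = w \<oplus> one" using zero_or_succ by blast
    then have "(x \<oplus> w) \<oplus> one = zero" using 0 by (simp only: nm.simps plus_succ)
    then show False using succ_ne by blast
  qed
  then have "x = nm 0" "y = nm 0" using 0 by (simp_all only: nm.simps plus_zero)
  then show ?case by blast
next
  case (Suc k)
  show ?case
  proof (cases "y = zero")
    case True
    then have "x = nm (Suc k)" "y = nm 0" using Suc.prems by (simp_all only: nm.simps plus_zero)
    then show ?thesis by blast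
  next
    case False
    then obtain w where w: "y = w \<oplus> one" using zero_or_succ by blast
    then have "x \<oplus> w = nm k" using Suc.prems by (simp only: plus_succ succ_inj nm.simps)
    then obtain a b where "x = nm a" "w = nm b" using Suc.IH by blast
    then have "x = nm a" "y = nm (Suc b)" by (simp_all only: w nm.simps)
    then show ?thesis by blast
  qed
qed

subsection \<open>Derivations of standard length\<close>

lemma msat_ExNs [simp]:
  "msat e E (ExNs 0 a) \<longleftrightarrow> msat e E a"
  "msat e E (ExNs (Suc n) a) \<longleftrightarrow> (\<exists>x. msat (case_nat x e) E (ExNs n a))"
  "msat e E (ExNs (numeral k) a) \<longleftrightarrow> (\<exists>x. msat (case_nat x e) E (ExNs (pred_numeral k) a))"
  by (simp_all add: ExNs_def numeral_eq_Suc)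

lemma msat_AllNs [simp]:
  "msat e E (AllNs 0 a) \<longleftrightarrow> msat e E a"
  "msat e E (AllNs (Suc n) a) \<longleftrightarrow> (\<forall>x. msat (case_nat x e) E (AllNs n a))"
  "msat e E (AllNs (numeral k) a) \<longleftrightarrow> (\<forall>x. msat (case_nat x e) E (AllNs (pred_numeral k) a))"
  by (simp_all add: AllNs_def numeral_eq_Suc)

lemma msat_Ors [simp]: "msat e E (Ors as) \<longleftrightarrow> (\<exists>a\<in>set as. msat e E a)"
  by (induction as) (simp_all add: Ors_def)

lemma msat_Ands [simp]: "msat e E (Ands as) \<longleftrightarrow> (\<forall>a\<in>set as. msat e E a)"
  by (induction as) (simp_all add: Ands_def)

definition beta :: "'a \<Rightarrow> 'a \<Rightarrow> 'a \<Rightarrow> 'a \<Rightarrow> bool" where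
  "beta c d i x \<longleftrightarrow>
     x \<prec> nm 1 \<oplus> (i \<oplus> nm 1) \<otimes> d \<and> (\<exists>q. c = q \<otimes> (nm 1 \<oplus> (i \<oplus> nm 1) \<otimes> d) \<oplus> x)"

lemma msat_Beta [simp]:
  "msat e E (Beta c d i x) \<longleftrightarrow> beta (mval e c) (mval e d) (mval e i) (mval e x)"
  by (simp add: Beta_def Let_def beta_def)

definition earlier :: "'a \<Rightarrow> 'a \<Rightarrow> 'a \<Rightarrow> 'a \<Rightarrow> bool" where
  "earlier c d i z \<longleftrightarrow> (\<exists>j. j \<prec> i \<and> beta c d j z)"

lemma msat_Earlier [simp]:
  "msat e E (Earlier c d i z) \<longleftrightarrow> earlier (mval e c) (mval e d) (mval e i) (mval e z)"
  by (simp add: Earlier_def earlier_def)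

lemma beta_nm:
  assumes "x = c mod (1 + (i + 1) * d)"
  shows "beta (nm c) (nm d) (nm i) (nm x)"
proof -
  let ?m = "1 + (i + 1) * d"
  have "x < ?m" using assms by simp
  moreover have "c = (c div ?m) * ?m + x" using assms by (metis div_mult_mod_eq)
  ultimately show ?thesis
    unfolding beta_def by (intro conjI exI[of _ "nm (c div ?m)"]) (simp_all only: nm_plus nm_times nm_less)
qed

end

text \<open>Goedel's argument: if \<open>d\<close> is divisible by all positive numbers up to \<open>N\<close>, then the moduli
  \<open>1 + (i + 1) d\<close> with \<open>i < N\<close> are pairwise coprime, and the Chinese remainder theorem applies.
  Here \<open>N\<close> bounds the entries too, so that they are smaller than the moduli, hence remainders.\<close>

lemma beta_function: "\<exists>c d. \<forall>i<length l. l ! i = c mod (1 + (i + 1) * d)"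
proof -
  define N where "N = length l + sum_list l"
  define d where "d = (fact N :: nat)"
  have dvd: "k dvd d" if "0 < k" "k \<le> N" for k
    using that by (simp add: d_def dvd_fact)
  have cop: "coprime (1 + (i + 1) * d) (1 + (j + 1) * d)" if "i < j" "j < length l" for i j
  proof (rule coprimeI)
    fix g assume g: "g dvd 1 + (i + 1) * d" "g dvd 1 + (j + 1) * d"
    \<comment> \<open>This combination eliminates \<open>d\<close>, so that \<open>g\<close> divides \<open>j - i\<close>, which divides \<open>d\<close>.\<close>
    have "(j + 1) * (1 + (i + 1) * d) = (i + 1) * (1 + (j + 1) * d) + (j - i)"
    proof -
      obtain k where "j = i + k" using \<open>i < j\<close> less_imp_add_positive by blast
      then show ?thesis by (simp add: algebra_simps)
    qed
    moreover have "g dvd (j + 1) * (1 + (i + 1) * d)" "g dvd (i + 1) * (1 + (j + 1) * d)"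
      using g by (meson dvd_mult)+
    ultimately have "g dvd j - i" using dvd_add_right_iff by metis
    also have "j - i dvd d" using that by (intro dvd) (auto simp: N_def)
    finally have "g dvd (i + 1) * d" by (rule dvd_mult)
    then show "is_unit g" using g(1) dvd_add_left_iff[of g "(i + 1) * d" 1] by blast
  qed
  have "\<forall>i\<in>{..<length l}. \<forall>j\<in>{..<length l}. i \<noteq> j \<longrightarrow>
      coprime (1 + (i + 1) * d) (1 + (j + 1) * d)"
    using cop by (metis coprime_commute lessThan_iff nat_neq_iff)
  from chinese_remainder_nat[OF _ this, of "\<lambda>i. l ! i"]
  obtain c where c: "\<forall>i<length l. [c = l ! i] (mod (1 + (i + 1) * d))" by auto
  have "l ! i = c mod (1 + (i + 1) * d)" if "i < length l" for i
  proof -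
    have "l ! i \<le> N" using member_le_sum_list[of "l ! i" l] that by (simp add: N_def)
    also have "N \<le> d" by (simp add: d_def fact_ge_self)
    finally have "l ! i < 1 + (i + 1) * d" by simp
    moreover have "[c = l ! i] (mod (1 + (i + 1) * d))" using c that by blast
    ultimately show ?thesis by (metis cong_def mod_less)
  qed
  then show ?thesis by blast
qed

context arith_model
begin

text \<open>The assignment under which \<open>Derivable\<close> evaluates its step: the current element \<open>y\<close>, its position
  \<open>i\<close>, the last position \<open>n\<close>, and the code \<open>(c, d)\<close> of the sequence.\<close>

abbreviation step_env :: "(nat \<Rightarrow> 'a) \<Rightarrow> 'a \<Rightarrow> 'a \<Rightarrow> 'a \<Rightarrow> 'a \<Rightarrow> 'a \<Rightarrow> nat \<Rightarrow> 'a" where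
  "step_env e c d n i y \<equiv> case_nat y (case_nat i (case_nat n (case_nat d (case_nat c e))))"

text \<open>The step holds at \<open>y\<close> as soon as the elements of \<open>A\<close> come earlier, whatever sequence is
  considered.  This uniformity is what allows sequences to be concatenated.\<close>

definition step_ok ::
    "((nat \<Rightarrow> tm \<Rightarrow> fm) \<Rightarrow> tm \<Rightarrow> fm) \<Rightarrow> (nat \<Rightarrow> 'a set) \<Rightarrow> nat set \<Rightarrow> nat \<Rightarrow> bool" where
  "step_ok step E A y \<longleftrightarrow> (\<forall>e c d n i. (\<forall>z\<in>A. earlier c d i (nm z)) \<longrightarrow>
     msat (step_env e c d n i (nm y)) E
       (step (\<lambda>k. Earlier (Var (4 + k)) (Var (3 + k)) (Var (1 + k))) (Var 0)))"

lemma step_ok_mono: "step_ok step E A y \<Longrightarrow> A \<subseteq> B \<Longrightarrow> step_ok step E B y"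
  unfolding step_ok_def by (meson subsetD)

text \<open>Being generated by the step, in the metatheory.  It replaces arguments about coded sequences by
  rule inductions, and it implies the formula \<open>Derivable\<close> in every model, not only in the standard
  one.\<close>

inductive derivable :: "((nat \<Rightarrow> tm \<Rightarrow> fm) \<Rightarrow> tm \<Rightarrow> fm) \<Rightarrow> (nat \<Rightarrow> 'a set) \<Rightarrow> nat \<Rightarrow> bool"
  for step E where
  "\<forall>z\<in>set L. derivable step E z \<Longrightarrow> step_ok step E (set L) y \<Longrightarrow> derivable step E y"

lemma derivableI:
  assumes "\<forall>z\<in>set L. derivable step E z"
    and "\<And>e c d n i. \<forall>z\<in>set L. earlier c d i (nm z) \<Longrightarrow> msat (step_env e c d n i (nm y)) E
       (step (\<lambda>k. Earlier (Var (4 + k)) (Var (3 + k)) (Var (1 + k))) (Var 0))"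
  shows "derivable step E y"
  using assms by (intro derivable.intros[of L]) (auto simp: step_ok_def)

lemma derivable_sequence:
  "derivable step E y \<Longrightarrow>
    \<exists>l. l \<noteq> [] \<and> last l = y \<and> (\<forall>i<length l. step_ok step E (set (take i l)) (l ! i))"
proof (induction rule: derivable.induct)
  case (1 L y)
  let ?ok = "\<lambda>l. \<forall>i<length l. step_ok step E (set (take i l)) (l ! i)"
  have append: "?ok (l @ l')" if "?ok l" "?ok l'" for l l'
  proof (intro allI impI)
    fix i assume i: "i < length (l @ l')"
    show "step_ok step E (set (take i (l @ l'))) ((l @ l') ! i)"
    proof (cases "i < length l")
      case True
      then show ?thesis using that(1) by (simp add: nth_append)
    next
      case False
      then have "step_ok step E (set (take (i - length l) l')) ((l @ l') ! i)"
        using that(2) i by (simp add: nth_append)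
      then show ?thesis by (rule step_ok_mono) (auto simp: False)
    qed
  qed
  have "\<exists>l. ?ok l \<and> set L' \<subseteq> set l" if "set L' \<subseteq> set L" for L'
    using that
  proof (induction L')
    case (Cons z L')
    then obtain l where l: "?ok l" "set L' \<subseteq> set l" by auto
    obtain l' where l': "l' \<noteq> []" "last l' = z" "?ok l'" using Cons.prems 1(1) by auto
    have "?ok (l @ l')" using append l l' by blast
    moreover have "set (z # L') \<subseteq> set (l @ l')" using l l' last_in_set by fastforce
    ultimately show ?case by blast
  qed (auto intro: exI[of _ "[]"])
  then obtain l where l: "?ok l" "set L \<subseteq> set l" by blast
  have "step_ok step E (set l) y" using 1(2) l(2) by (rule step_ok_mono)
  then have "?ok (l @ [y])" using l(1) by (auto simp: nth_append less_Suc_eq)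
  then show ?case by (intro exI[of _ "l @ [y]"]) simp
qed

text \<open>A list of standard length with standard entries is coded by standard numbers \<open>c\<close> and \<open>d\<close>, and the
  positions up to its last one are standard in every model; so the code works there as well.\<close>

lemma Derivable_if_derivable:
  assumes "derivable step E y" and x: "mval e x = nm y"
  shows "msat e E (Derivable step x)"
proof -
  obtain l where l: "l \<noteq> []" "last l = y"
    and ok: "\<And>i. i < length l \<Longrightarrow> step_ok step E (set (take i l)) (l ! i)"
    using derivable_sequence[OF assms(1)] by blast
  obtain c d where cd: "\<And>i. i < length l \<Longrightarrow> l ! i = c mod (1 + (i + 1) * d)"
    using beta_function[of l] by blast
  have beta: "beta (nm c) (nm d) (nm i) (nm (l ! i))" if "i < length l" for i
    using cd[OF that] by (rule beta_nm)
  define n where "n = length l - 1"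
  have n: "Suc n = length l" "l ! n = y" using l by (auto simp: n_def last_conv_nth)
  have "msat (step_env e (nm c) (nm d) (nm n) (nm i) (nm (l ! i))) E
      (step (\<lambda>k. Earlier (Var (4 + k)) (Var (3 + k)) (Var (1 + k))) (Var 0))"
    if "i < length l" for i
  proof -
    have "earlier (nm c) (nm d) (nm i) (nm z)" if z: "z \<in> set (take i l)" for z
    proof -
      obtain j where "j < i" "z = l ! j" using z \<open>i < length l\<close> by (auto simp: in_set_conv_nth)
      then show ?thesis
        using beta[of j] \<open>i < length l\<close> unfolding earlier_def by (intro exI[of _ "nm j"]) simp
    qed
    then show ?thesis using ok[OF that] by (simp add: step_ok_def)
  qed
  moreover have "\<exists>i'<length l. i = nm i'" if "i \<prec> nm (n + 1)" for i
    using that n(1) by (simp add: less_nm)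
  ultimately have "\<forall>i. i \<prec> nm (n + 1) \<longrightarrow> (\<exists>y. beta (nm c) (nm d) i y \<and>
      msat (step_env e (nm c) (nm d) (nm n) i y) E
        (step (\<lambda>k. Earlier (Var (4 + k)) (Var (3 + k)) (Var (1 + k))) (Var 0)))"
    using beta by blast
  moreover have "beta (nm c) (nm d) (nm n) (mval e x)"
    using beta[of n] n x by simp
  ultimately show ?thesis
    unfolding Derivable_def
    by (simp)
      (intro exI[of _ "nm c"] exI[of _ "nm d"] exI[of _ "nm n"], simp)
qed

lemma Derivable_mono:
  assumes "\<And>c d n i y.
      msat (step_env e c d n i y) E
        (step (\<lambda>k. Earlier (Var (4 + k)) (Var (3 + k)) (Var (1 + k))) (Var 0)) \<Longrightarrow>
      msat (step_env e' c d n i y) E'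
        (step' (\<lambda>k. Earlier (Var (4 + k)) (Var (3 + k)) (Var (1 + k))) (Var 0))"
    and "mval e x = mval e' x'" and "msat e E (Derivable step x)"
  shows "msat e' E' (Derivable step' x')"
  using assms(2,3) assms(1) unfolding Derivable_def by simp meson

end

section \<open>Correctness of the arithmetized syntax\<close>

lemma pair_less: "m + n < m' + n' \<Longrightarrow> pair m n < pair m' n'"
proof -
  assume "m + n < m' + n'"
  then have "(m + n + 1) * (m + n + 1) \<le> (m' + n') * (m' + n')" by (intro mult_le_mono) auto
  then show ?thesis by (simp add: pair_def)
qed

lemma pair_inject [simp]: "pair m n = pair m' n' \<longleftrightarrow> m = m' \<and> n = n'"
proof
  assume eq: "pair m n = pair m' n'"
  then have "m + n = m' + n'" by (metis linorder_neq_iff pair_less)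
  then show "m = m' \<and> n = n'" using eq by (simp add: pair_def)
qed simp

lemma code_tm_inject [simp]: "code_tm s = code_tm t \<longleftrightarrow> s = t"
  by (induction s arbitrary: t; case_tac t) auto

lemma code_inject [simp]: "code a = code b \<longleftrightarrow> a = b"
  by (induction a arbitrary: b; case_tac b) auto

lemmas code_tms = cVar_def cZero_def cOne_def cAdd_def cMul_def cEq_def cLt_def cIn_def cFls_def
  cImp_def cAllN_def cAllS_def

context arith_model
begin

declare code_tms [simp]

lemma Ors_nthI: "i < length as \<Longrightarrow> msat e E (as ! i) \<Longrightarrow> msat e E (Ors as)"
  by auto

text \<open>The formulas of the arithmetized syntax hold, in every model, of the codes for which they are
  meant.  The hypotheses of these rules are existential so that they can be conditions of rewrite
  rules: the injectivity of pairing and coding then finds the syntactic objects.\<close>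

lemma IsTm_code [simp]: "\<exists>t. mval e x = nm (code_tm t) \<Longrightarrow> msat e E (IsTm x)"
  unfolding IsTm_def
proof (elim exE, erule Derivable_if_derivable[rotated], goal_cases)
  case (1 t)
  show ?case
  proof (induction t)
    case (Add s t)
    then show ?case by (intro derivableI[of "[code_tm s, code_tm t]"]) auto
  next
    case (Mul s t)
    then show ?case by (intro derivableI[of "[code_tm s, code_tm t]"]) auto
  qed (rule derivableI[of "[]"]; simp)+
qed

lemma IsFm_code [simp]: "\<exists>a. mval e x = nm (code a) \<Longrightarrow> msat e E (IsFm x)"
  unfolding IsFm_def
proof (elim exE, erule Derivable_if_derivable[rotated], goal_cases)
  case (1 a)
  show ?case
  proof (induction a)
    case (Imp a b)
    then show ?case by (intro derivableI[of "[code a, code b]"]) simp_all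
  next
    case (AllN a)
    then show ?case by (intro derivableI[of "[code a]"]) simp_all
  next
    case (AllS a)
    then show ?case by (intro derivableI[of "[code a]"]) simp_all
  qed (rule derivableI[of "[]"]; simp)+
qed

lemma LiftTm_code [simp]:
  "\<exists>k t. mval e x = nm (pair k (pair (code_tm t) (code_tm (lift_tm k t))))
    \<Longrightarrow> msat e E (LiftTm x)"
  unfolding LiftTm_def
proof (elim exE, erule Derivable_if_derivable[rotated], goal_cases)
  case (1 k t)
  let ?c = "\<lambda>t. pair k (pair (code_tm t) (code_tm (lift_tm k t)))"
  show ?case
  proof (induction t)
    case (Add s t)
    then show ?case by (intro derivableI[of "[?c s, ?c t]"]) simp_all
  next
    case (Mul s t)
    then show ?case by (intro derivableI[of "[?c s, ?c t]"]) simp_all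
  next
    case (Var i)
    show ?case by (rule derivableI[of "[]"]; cases "i < k"; simp)
  qed (rule derivableI[of "[]"]; simp)+
qed

lemma LiftN_code [simp]:
  "\<exists>k a. mval e x = nm (pair k (pair (code a) (code (liftN k a)))) \<Longrightarrow> msat e E (LiftN x)"
  unfolding LiftN_def
proof (elim exE, erule Derivable_if_derivable[rotated], goal_cases)
  case (1 k a)
  let ?c = "\<lambda>k a. pair k (pair (code a) (code (liftN k a)))"
  show ?case
  proof (induction a arbitrary: k)
    case (Imp a b)
    then show ?case by (intro derivableI[of "[?c k a, ?c k b]"]) simp_all
  next
    case (AllN a)
    then show ?case by (intro derivableI[of "[?c (k + 1) a]"]) simp_all
  next
    case (AllS a)
    then show ?case by (intro derivableI[of "[?c k a]"]) simp_all
  qed (rule derivableI[of "[]"]; simp)+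
qed

lemma LiftS_code [simp]:
  "\<exists>k a. mval e x = nm (pair k (pair (code a) (code (liftS k a)))) \<Longrightarrow> msat e E (LiftS x)"
  unfolding LiftS_def
proof (elim exE, erule Derivable_if_derivable[rotated], goal_cases)
  case (1 k a)
  let ?c = "\<lambda>k a. pair k (pair (code a) (code (liftS k a)))"
  show ?case
  proof (induction a arbitrary: k)
    case (In t i)
    show ?case by (rule derivableI[of "[]"]; cases "i < k"; simp)
  next
    case (Imp a b)
    then show ?case by (intro derivableI[of "[?c k a, ?c k b]"]) simp_all
  next
    case (AllN a)
    then show ?case by (intro derivableI[of "[?c k a]"]) simp_all
  next
    case (AllS a)
    then show ?case by (intro derivableI[of "[?c (k + 1) a]"]) simp_all
  qed (rule derivableI[of "[]"]; simp)+
qed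

lemma SubstTm_code [simp]:
  "\<exists>k u t. mval e x = nm (pair k (pair (code_tm u) (pair (code_tm t) (code_tm (subst_tm k u t)))))
    \<Longrightarrow> msat e E (SubstTm x)"
  unfolding SubstTm_def
proof (elim exE, erule Derivable_if_derivable[rotated], goal_cases)
  case (1 k u t)
  let ?c = "\<lambda>t. pair k (pair (code_tm u) (pair (code_tm t) (code_tm (subst_tm k u t))))"
  show ?case
  proof (induction t)
    case (Add s t)
    then show ?case by (intro derivableI[of "[?c s, ?c t]"]) simp_all
  next
    case (Mul s t)
    then show ?case by (intro derivableI[of "[?c s, ?c t]"]) simp_all
  next
    case (Var i)
    consider "i < k" | "i = k" | "k < i" by linarith
    then show ?case by cases (rule derivableI[of "[]"]; simp)+
  qed (rule derivableI[of "[]"]; simp)+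
qed

lemma SubstN_code [simp]:
  "\<exists>k u a. mval e x = nm (pair k (pair (code_tm u) (pair (code a) (code (substN k u a)))))
    \<Longrightarrow> msat e E (SubstN x)"
  unfolding SubstN_def
proof (elim exE, erule Derivable_if_derivable[rotated], goal_cases)
  case (1 k u a)
  let ?c = "\<lambda>k u a. pair k (pair (code_tm u) (pair (code a) (code (substN k u a))))"
  show ?case
  proof (induction a arbitrary: k u)
    case (Imp a b)
    then show ?case by (intro derivableI[of "[?c k u a, ?c k u b]"]) simp_all
  next
    case (AllN a)
    then show ?case
      by (intro derivableI[of "[?c (k + 1) (lift_tm 0 u) a]"])
        (simp_all, intro exI[of _ "nm (code_tm (lift_tm 0 u))"], simp)
  next
    case (AllS a)
    then show ?case by (intro derivableI[of "[?c k u a]"]) simp_all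
  qed (rule derivableI[of "[]"]; simp)+
qed

lemma SubstS_code [simp]:
  "\<exists>k j a. mval e x = nm (pair k (pair j (pair (code a) (code (substS k j a)))))
    \<Longrightarrow> msat e E (SubstS x)"
  unfolding SubstS_def
proof (elim exE, erule Derivable_if_derivable[rotated], goal_cases)
  case (1 k j a)
  let ?c = "\<lambda>k j a. pair k (pair j (pair (code a) (code (substS k j a))))"
  show ?case
  proof (induction a arbitrary: k j)
    case (In t i)
    consider "i < k" | "i = k" | "k < i" by linarith
    then show ?case by cases (rule derivableI[of "[]"]; simp)+
  next
    case (Imp a b)
    then show ?case by (intro derivableI[of "[?c k j a, ?c k j b]"]) simp_all
  next
    case (AllN a)
    then show ?case by (intro derivableI[of "[?c k j a]"]) simp_all
  next
    case (AllS a)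
    then show ?case by (intro derivableI[of "[?c (k + 1) (j + 1) a]"]) simp_all
  qed (rule derivableI[of "[]"]; simp)+
qed

lemma LogAx_code:
  assumes "logical_axiom a" and y: "mval e y = nm (code a)"
  shows "msat e E (LogAx y)"
  unfolding LogAx_def using assms
proof (induction rule: logical_axiom.induct)
  case (1 a b)
  then show ?case by (intro Ors_nthI[of 0]) simp_all
next
  case (2 a b c)
  then show ?case by (intro Ors_nthI[of 1]) simp_all
next
  case (3 a)
  then show ?case by (intro Ors_nthI[of 2]) simp_all
next
  case (4 a t)
  then show ?case by (intro Ors_nthI[of 3]) (simp_all, intro exI[of _ "nm (code_tm t)"], simp)
next
  case (5 a b)
  then show ?case by (intro Ors_nthI[of 4]) simp_all
next
  case (6 a j)
  then show ?case by (intro Ors_nthI[of 5]) (simp_all, intro exI[of _ "nm j"], auto)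
next
  case (7 a b)
  then show ?case by (intro Ors_nthI[of 6]) simp_all
next
  case (8 t)
  then show ?case by (intro Ors_nthI[of 7]) simp_all
next
  case (9 s t a)
  then show ?case by (intro Ors_nthI[of 8]) (simp_all, intro exI[of _ "nm (code a)"], simp)
qed

lemma BoundedTm_code [simp]:
  "\<exists>k t. bounded_tm k t \<and> mval e x = nm (pair k (code_tm t)) \<Longrightarrow> msat e E (BoundedTm x)"
  unfolding BoundedTm_def
proof (elim exE conjE, erule Derivable_if_derivable[rotated], goal_cases)
  case (1 k t)
  let ?c = "\<lambda>t. pair k (code_tm t)"
  show ?case
    using 1
  proof (induction t)
    case (Add s t)
    then show ?case by (intro derivableI[of "[?c s, ?c t]"]) simp_all
  next
    case (Mul s t)
    then show ?case by (intro derivableI[of "[?c s, ?c t]"]) simp_all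
  qed (rule derivableI[of "[]"]; simp)+
qed

lemma BoundedArith_code [simp]:
  "\<exists>k a. arithmetical a \<and> bounded k 1 a \<and> mval e x = nm (pair k (code a))
    \<Longrightarrow> msat e E (BoundedArith x)"
  unfolding BoundedArith_def
proof (elim exE conjE, erule Derivable_if_derivable[rotated], goal_cases)
  case (1 k a)
  show ?case
    using 1
  proof (induction a arbitrary: k)
    case (Imp a b)
    then show ?case by (intro derivableI[of "[pair k (code a), pair k (code b)]"]) simp_all
  next
    case (AllN a)
    then show ?case by (intro derivableI[of "[pair (k + 1) (code a)]"]) simp_all
  qed (rule derivableI[of "[]"]; simp)+
qed

text \<open>A model recognizes every actual \<open>\<Pi>\<^sup>1\<^sub>1\<close> sentence, so reflection can be applied to it.\<close>

lemma Pi11Sent_code: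
  assumes "arithmetical b" and "bounded 0 1 b" and "mval e x = nm (code (AllS b))"
  shows "msat e E (Pi11Sent x)"
  using assms by (simp add: Pi11Sent_def)

end

subsection \<open>Complexity of the arithmetized syntax\<close>

lemma bounded_simps [simp]:
  "bounded m n (\<^bold>\<not> a) \<longleftrightarrow> bounded m n a"
  "bounded m n (a \<^bold>\<or> b) \<longleftrightarrow> bounded m n a \<and> bounded m n b"
  "bounded m n (a \<^bold>\<and> b) \<longleftrightarrow> bounded m n a \<and> bounded m n b"
  "bounded m n (a \<^bold>\<longleftrightarrow> b) \<longleftrightarrow> bounded m n a \<and> bounded m n b"
  "bounded m n (ExN a) \<longleftrightarrow> bounded (Suc m) n a"
  "bounded m n (ExS a) \<longleftrightarrow> bounded m (Suc n) a"
  by (auto simp: Neg_def Or_def And_def Iff_def ExN_def ExS_def)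

lemma bounded_ExNs [simp]: "bounded m n (ExNs k a) \<longleftrightarrow> bounded (m + k) n a"
  by (induction k arbitrary: m) (simp_all add: ExNs_def)

lemma bounded_AllNs [simp]: "bounded m n (AllNs k a) \<longleftrightarrow> bounded (m + k) n a"
  by (induction k arbitrary: m) (simp_all add: AllNs_def)

lemma bounded_Ors [simp]: "bounded m n (Ors as) \<longleftrightarrow> (\<forall>a\<in>set as. bounded m n a)"
  by (induction as) (simp_all add: Ors_def)

lemma bounded_tm_num [simp]: "bounded_tm m (num k)"
  by (induction k) simp_all

lemma bounded_tm_pairt [simp]: "bounded_tm m (s \<star> t) \<longleftrightarrow> bounded_tm m s \<and> bounded_tm m t"
  by (auto simp: pairt_def)

lemma bounded_tm_up [simp]:
  "bounded_tm (m + k) (t \<up> k) \<longleftrightarrow> bounded_tm m t"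
  "bounded_tm (Suc m) (t \<up> Suc 0) \<longleftrightarrow> bounded_tm m t"
  "bounded_tm (Suc (Suc m)) (t \<up> 2) \<longleftrightarrow> bounded_tm m t"
  by (induction t) simp_all

lemma bounded_Beta [simp]:
  "bounded m n (Beta c d i x) \<longleftrightarrow>
    bounded_tm m c \<and> bounded_tm m d \<and> bounded_tm m i \<and> bounded_tm m x"
  by (auto simp: Beta_def Let_def)

lemma bounded_Earlier [simp]:
  "bounded m n (Earlier c d i z) \<longleftrightarrow>
    bounded_tm m c \<and> bounded_tm m d \<and> bounded_tm m i \<and> bounded_tm m z"
  by (auto simp: Earlier_def)

lemma bounded_Derivable [simp]:
  "bounded m n (Derivable step x) \<longleftrightarrow> bounded_tm m x \<and>
    bounded (m + 5) n (step (\<lambda>k. Earlier (Var (4 + k)) (Var (3 + k)) (Var (1 + k))) (Var 0))"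
  by (auto simp: Derivable_def add.commute)

lemma bounded_syntax [simp]:
  "bounded_tm m x \<Longrightarrow> bounded m n (IsTm x)"
  "bounded_tm m x \<Longrightarrow> bounded m n (IsFm x)"
  "bounded_tm m x \<Longrightarrow> bounded m n (LiftTm x)"
  "bounded_tm m x \<Longrightarrow> bounded m n (LiftN x)"
  "bounded_tm m x \<Longrightarrow> bounded m n (LiftS x)"
  "bounded_tm m x \<Longrightarrow> bounded m n (SubstTm x)"
  "bounded_tm m x \<Longrightarrow> bounded m n (SubstN x)"
  "bounded_tm m x \<Longrightarrow> bounded m n (SubstS x)"
  "bounded_tm m x \<Longrightarrow> bounded m n (LogAx x)"
  by (simp_all add: IsTm_def IsFm_def LiftTm_def LiftN_def LiftS_def SubstTm_def SubstN_def
      SubstS_def LogAx_def code_tms)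

lemma arithmetical_simps [simp]:
  "arithmetical (\<^bold>\<not> a) \<longleftrightarrow> arithmetical a"
  "arithmetical (a \<^bold>\<or> b) \<longleftrightarrow> arithmetical a \<and> arithmetical b"
  "arithmetical (a \<^bold>\<and> b) \<longleftrightarrow> arithmetical a \<and> arithmetical b"
  "arithmetical (a \<^bold>\<longleftrightarrow> b) \<longleftrightarrow> arithmetical a \<and> arithmetical b"
  "arithmetical (ExN a) \<longleftrightarrow> arithmetical a"
  by (auto simp: Neg_def Or_def And_def Iff_def ExN_def)

lemma arithmetical_ExNs [simp]: "arithmetical (ExNs k a) \<longleftrightarrow> arithmetical a"
  by (induction k) (simp_all add: ExNs_def)

lemma arithmetical_AllNs [simp]: "arithmetical (AllNs k a) \<longleftrightarrow> arithmetical a"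
  by (induction k) (simp_all add: AllNs_def)

lemma arithmetical_Ors [simp]: "arithmetical (Ors as) \<longleftrightarrow> (\<forall>a\<in>set as. arithmetical a)"
  by (induction as) (simp_all add: Ors_def)

lemma arithmetical_Derivable [simp]:
  "arithmetical (Beta c d i x)" "arithmetical (Earlier c d i x)"
  "arithmetical (Derivable step x) \<longleftrightarrow>
    arithmetical (step (\<lambda>k. Earlier (Var (4 + k)) (Var (3 + k)) (Var (1 + k))) (Var 0))"
  by (simp_all add: Beta_def Earlier_def Derivable_def Let_def)

lemma arithmetical_syntax [simp]:
  "arithmetical (IsTm x)" "arithmetical (IsFm x)" "arithmetical (LiftTm x)" "arithmetical (LiftN x)"
  "arithmetical (LiftS x)" "arithmetical (SubstTm x)" "arithmetical (SubstN x)"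
  "arithmetical (SubstS x)" "arithmetical (LogAx x)"
  by (simp_all add: IsTm_def IsFm_def LiftTm_def LiftN_def LiftS_def SubstTm_def SubstN_def
      SubstS_def LogAx_def)

section \<open>Satisfaction classes\<close>

text \<open>A variable counts all variables of smaller index among its subterms, because satisfaction classes
  evaluate variable \<open>i + 1\<close> on a stack through variable \<open>i\<close> on its tail.\<close>

primrec subtms :: "tm \<Rightarrow> tm list" where
  "subtms (Var i) = map Var [0..<Suc i]"
| "subtms Zero = [Zero]"
| "subtms One = [One]"
| "subtms (s \<^bold>+ t) = (s \<^bold>+ t) # subtms s @ subtms t"
| "subtms (s \<^bold>* t) = (s \<^bold>* t) # subtms s @ subtms t"

primrec tms_of :: "fm \<Rightarrow> tm list" where
  "tms_of (s \<^bold>= t) = subtms s @ subtms t"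
| "tms_of (s \<^bold>< t) = subtms s @ subtms t"
| "tms_of (t \<^bold>\<in> i) = subtms t"
| "tms_of Fls = []"
| "tms_of (a \<^bold>\<longrightarrow> b) = tms_of a @ tms_of b"
| "tms_of (AllN a) = tms_of a"
| "tms_of (AllS a) = tms_of a"

primrec subfms :: "fm \<Rightarrow> fm list" where
  "subfms (s \<^bold>= t) = [s \<^bold>= t]"
| "subfms (s \<^bold>< t) = [s \<^bold>< t]"
| "subfms (t \<^bold>\<in> i) = [t \<^bold>\<in> i]"
| "subfms Fls = [Fls]"
| "subfms (a \<^bold>\<longrightarrow> b) = (a \<^bold>\<longrightarrow> b) # subfms a @ subfms b"
| "subfms (AllN a) = AllN a # subfms a"
| "subfms (AllS a) = AllS a # subfms a"

lemma self_subtms: "t \<in> set (subtms t)"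
  by (cases t) auto

lemma self_subfms: "a \<in> set (subfms a)"
  by (cases a) auto

lemma subtms_closed:
  "Var (Suc i) \<in> set (subtms t) \<Longrightarrow> Var i \<in> set (subtms t)"
  "r \<^bold>+ s \<in> set (subtms t) \<Longrightarrow> r \<in> set (subtms t) \<and> s \<in> set (subtms t)"
  "r \<^bold>* s \<in> set (subtms t) \<Longrightarrow> r \<in> set (subtms t) \<and> s \<in> set (subtms t)"
  by (induction t) (auto simp: self_subtms)

lemma tms_of_closed:
  "Var (Suc i) \<in> set (tms_of a) \<Longrightarrow> Var i \<in> set (tms_of a)"
  "r \<^bold>+ s \<in> set (tms_of a) \<Longrightarrow> r \<in> set (tms_of a) \<and> s \<in> set (tms_of a)"
  "r \<^bold>* s \<in> set (tms_of a) \<Longrightarrow> r \<in> set (tms_of a) \<and> s \<in> set (tms_of a)"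
  by (induction a) (auto dest: subtms_closed)

lemma subfms_closed:
  "(s \<^bold>= t) \<in> set (subfms a) \<Longrightarrow> s \<in> set (tms_of a) \<and> t \<in> set (tms_of a)"
  "(s \<^bold>< t) \<in> set (subfms a) \<Longrightarrow> s \<in> set (tms_of a) \<and> t \<in> set (tms_of a)"
  "(t \<^bold>\<in> i) \<in> set (subfms a) \<Longrightarrow> t \<in> set (tms_of a)"
  "(b \<^bold>\<longrightarrow> c) \<in> set (subfms a) \<Longrightarrow> b \<in> set (subfms a) \<and> c \<in> set (subfms a)"
  "AllN b \<in> set (subfms a) \<Longrightarrow> b \<in> set (subfms a)"
  by (induction a) (auto simp: self_subtms self_subfms)

text \<open>Arithmetical formulas, one for each standard index, term and formula, that define evaluation and
  satisfaction.  For a fixed formula a recursion in the metatheory suffices; the satisfaction class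
  only combines finitely many of these definitions.\<close>

primrec lookupF :: "nat \<Rightarrow> tm \<Rightarrow> tm \<Rightarrow> fm" where
  "lookupF 0 s v = ExN (s \<up> 1 \<^bold>= v \<up> 1 \<star> Var 0)"
| "lookupF (Suc i) s v = ExNs 2 (s \<up> 2 \<^bold>= Var 1 \<star> Var 0 \<^bold>\<and> lookupF i (Var 0) (v \<up> 2))"

primrec valueF :: "tm \<Rightarrow> tm \<Rightarrow> tm \<Rightarrow> fm" where
  "valueF (Var i) s v = lookupF i s v"
| "valueF Zero s v = (v \<^bold>= Zero)"
| "valueF One s v = (v \<^bold>= One)"
| "valueF (t \<^bold>+ u) s v = ExNs 2 (valueF t (s \<up> 2) (Var 1) \<^bold>\<and> valueF u (s \<up> 2) (Var 0) \<^bold>\<and>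
     v \<up> 2 \<^bold>= Var 1 \<^bold>+ Var 0)"
| "valueF (t \<^bold>* u) s v = ExNs 2 (valueF t (s \<up> 2) (Var 1) \<^bold>\<and> valueF u (s \<up> 2) (Var 0) \<^bold>\<and>
     v \<up> 2 \<^bold>= Var 1 \<^bold>* Var 0)"

primrec holdsF :: "fm \<Rightarrow> tm \<Rightarrow> fm" where
  "holdsF (t \<^bold>= u) s = ExNs 2 (valueF t (s \<up> 2) (Var 1) \<^bold>\<and> valueF u (s \<up> 2) (Var 0) \<^bold>\<and> Var 1 \<^bold>= Var 0)"
| "holdsF (t \<^bold>< u) s = ExNs 2 (valueF t (s \<up> 2) (Var 1) \<^bold>\<and> valueF u (s \<up> 2) (Var 0) \<^bold>\<and> Var 1 \<^bold>< Var 0)"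
| "holdsF (t \<^bold>\<in> i) s = ExN (valueF t (s \<up> 1) (Var 0) \<^bold>\<and> Var 0 \<^bold>\<in> 0)"
| "holdsF Fls s = Fls"
| "holdsF (a \<^bold>\<longrightarrow> b) s = (holdsF a s \<^bold>\<longrightarrow> holdsF b s)"
| "holdsF (AllN a) s = AllN (holdsF a (Var 0 \<star> s \<up> 1))"
| "holdsF (AllS a) s = Fls"

lemma arithmetical_lookupF [simp]: "arithmetical (lookupF i s v)"
  by (induction i arbitrary: s v) simp_all

lemma arithmetical_valueF [simp]: "arithmetical (valueF t s v)"
  by (induction t arbitrary: s v) simp_all

lemma arithmetical_holdsF [simp]: "arithmetical (holdsF a s)"
  by (induction a arbitrary: s) simp_all

context arith_model
begin

primrec lookup :: "nat \<Rightarrow> 'a \<Rightarrow> 'a \<Rightarrow> bool" where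
  "lookup 0 s v \<longleftrightarrow> (\<exists>r. s = mpair v r)"
| "lookup (Suc i) s v \<longleftrightarrow> (\<exists>x r. s = mpair x r \<and> lookup i r v)"

primrec denotes :: "tm \<Rightarrow> 'a \<Rightarrow> 'a \<Rightarrow> bool" where
  "denotes (Var i) s v \<longleftrightarrow> lookup i s v"
| "denotes Zero s v \<longleftrightarrow> v = nm 0"
| "denotes One s v \<longleftrightarrow> v = nm 1"
| "denotes (t \<^bold>+ u) s v \<longleftrightarrow> (\<exists>x y. denotes t s x \<and> denotes u s y \<and> v = x \<oplus> y)"
| "denotes (t \<^bold>* u) s v \<longleftrightarrow> (\<exists>x y. denotes t s x \<and> denotes u s y \<and> v = x \<otimes> y)"

primrec holds :: "'a set \<Rightarrow> fm \<Rightarrow> 'a \<Rightarrow> bool" where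
  "holds X (t \<^bold>= u) s \<longleftrightarrow> (\<exists>x y. denotes t s x \<and> denotes u s y \<and> x = y)"
| "holds X (t \<^bold>< u) s \<longleftrightarrow> (\<exists>x y. denotes t s x \<and> denotes u s y \<and> x \<prec> y)"
| "holds X (t \<^bold>\<in> i) s \<longleftrightarrow> (\<exists>x. denotes t s x \<and> x \<in> X)"
| "holds X Fls s \<longleftrightarrow> False"
| "holds X (a \<^bold>\<longrightarrow> b) s \<longleftrightarrow> (holds X a s \<longrightarrow> holds X b s)"
| "holds X (AllN a) s \<longleftrightarrow> (\<forall>x. holds X a (mpair x s))"
| "holds X (AllS a) s \<longleftrightarrow> False"

lemma msat_lookupF [simp]: "msat e E (lookupF i s v) \<longleftrightarrow> lookup i (mval e s) (mval e v)"
  by (induction i arbitrary: s v e) simp_all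

lemma msat_valueF [simp]: "msat e E (valueF t s v) \<longleftrightarrow> denotes t (mval e s) (mval e v)"
  by (induction t arbitrary: s v e) simp_all

lemma msat_holdsF [simp]: "msat e E (holdsF a s) \<longleftrightarrow> holds (E 0) a (mval e s)"
  by (induction a arbitrary: s e) simp_all

text \<open>Not every number is a pair, hence a stack need not assign a value to every variable; those that
  arise from the empty stack by pushing do.\<close>

definition encodes :: "'a \<Rightarrow> (nat \<Rightarrow> 'a) \<Rightarrow> bool" where
  "encodes s e \<longleftrightarrow> (\<forall>i v. lookup i s v \<longleftrightarrow> v = e i)"

lemma encodes_push: "encodes s e \<Longrightarrow> encodes (mpair x s) (case_nat x e)"
  unfolding encodes_def
proof (intro allI)
  fix i v
  assume "\<forall>i v. lookup i s v \<longleftrightarrow> v = e i"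
  then show "lookup i (mpair x s) v \<longleftrightarrow> v = case_nat x e i" by (cases i) auto
qed

lemma encodes_empty: "encodes (nm 0) (\<lambda>_. nm 0)"
proof -
  \<comment> \<open>The empty stack is its own tail.\<close>
  have zero: "nm 0 = mpair (nm 0) (nm 0)" using nm_pair[of 0 0] by (simp add: pair_def del: nm_pair)
  have "lookup i (nm 0) v \<longleftrightarrow> v = nm 0" for i v
  proof (induction i)
    case 0
    then show ?case by (subst zero) (auto simp del: nm_pair)
  next
    case (Suc i)
    have "lookup (Suc i) (mpair (nm 0) (nm 0)) v \<longleftrightarrow> lookup i (nm 0) v" by auto
    then show ?case using Suc zero by metis
  qed
  then show ?thesis by (simp add: encodes_def)
qed

lemma denotes_mval: "encodes s e \<Longrightarrow> denotes t s v \<longleftrightarrow> v = mval e t"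
  by (induction t arbitrary: v) (auto simp: encodes_def)

lemma holds_msat:
  "arithmetical a \<Longrightarrow> bounded m 1 a \<Longrightarrow> encodes s e \<Longrightarrow> E 0 = X \<Longrightarrow> holds X a s \<longleftrightarrow> msat e E a"
proof (induction a arbitrary: s e m)
  case (AllN a)
  have "holds X a (mpair x s) \<longleftrightarrow> msat (case_nat x e) E a" for x
    using AllN.prems encodes_push by (intro AllN.IH[of "Suc m"]) simp_all
  then show ?case by simp
qed (auto simp: denotes_mval)

text \<open>Together with its counterpart for formulas, this reads off the outermost constructor from a tagged
  code.  The components range over the whole model, but the equation forces them to be standard.\<close>

lemma code_tm_eq [simp]:
  "mpair (nm 0) x = nm (code_tm t) \<longleftrightarrow> (\<exists>i. t = Var i \<and> x = nm i)"
  "mpair (nm 3) (mpair x y) = nm (code_tm t) \<longleftrightarrow>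
    (\<exists>r s. t = r \<^bold>+ s \<and> x = nm (code_tm r) \<and> y = nm (code_tm s))"
  "mpair (nm 4) (mpair x y) = nm (code_tm t) \<longleftrightarrow>
    (\<exists>r s. t = r \<^bold>* s \<and> x = nm (code_tm r) \<and> y = nm (code_tm s))"
  "mpair (nm (Suc 0)) x = nm (code_tm t) \<longleftrightarrow> t = Zero \<and> x = nm 0"
  "mpair (nm 2) x = nm (code_tm t) \<longleftrightarrow> t = One \<and> x = nm 0"
  "5 \<le> k \<Longrightarrow> mpair (nm k) x \<noteq> nm (code_tm t)"
  by (cases t; auto)+

lemma code_eq [simp]:
  "mpair (nm 5) (mpair x y) = nm (code a) \<longleftrightarrow>
    (\<exists>s t. a = (s \<^bold>= t) \<and> x = nm (code_tm s) \<and> y = nm (code_tm t))"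
  "mpair (nm 6) (mpair x y) = nm (code a) \<longleftrightarrow>
    (\<exists>s t. a = (s \<^bold>< t) \<and> x = nm (code_tm s) \<and> y = nm (code_tm t))"
  "mpair (nm 7) (mpair x y) = nm (code a) \<longleftrightarrow>
    (\<exists>t i. a = (t \<^bold>\<in> i) \<and> x = nm (code_tm t) \<and> y = nm i)"
  "mpair (nm 8) x = nm (code a) \<longleftrightarrow> a = Fls \<and> x = nm 0"
  "mpair (nm 9) (mpair x y) = nm (code a) \<longleftrightarrow>
    (\<exists>b c. a = (b \<^bold>\<longrightarrow> c) \<and> x = nm (code b) \<and> y = nm (code c))"
  "mpair (nm 10) x = nm (code a) \<longleftrightarrow> (\<exists>b. a = AllN b \<and> x = nm (code b))"
  "k \<le> 4 \<Longrightarrow> mpair (nm k) x \<noteq> nm (code a)"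
  by (cases a; auto)+

lemma succ_eq_nm [simp]: "x \<oplus> nm (Suc 0) = nm i \<longleftrightarrow> (\<exists>j. i = Suc j \<and> x = nm j)"
proof
  assume eq: "x \<oplus> nm (Suc 0) = nm i"
  then obtain j where "x = nm j" using plus_standard by blast
  then show "\<exists>j. i = Suc j \<and> x = nm j" using eq by auto
qed auto

lemma definable:
  assumes "arithmetical a" and "X \<in> Sets" and "\<And>x. x \<in> A \<longleftrightarrow> msat (case_nat x e) (\<lambda>_. X) a"
  shows "A \<in> Sets"
proof -
  have "A = {x. msat (case_nat x e) (\<lambda>_. X) a}" using assms(3) by blast
  then show ?thesis using comprehension[OF assms(1), of "\<lambda>_. X" e] assms(2) by auto
qed

text \<open>The domain of the class is the finite set of subformulas and subterms of \<open>a\<close>.  Over it, values and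
  satisfaction are arithmetically definable from \<open>X\<close>, so that the three sets exist by comprehension
  and Tarski's conditions hold by the recursive definitions.\<close>

lemma satisfaction_class:
  assumes "arithmetical a" and "bounded 0 1 a" and X: "X \<in> Sets"
  shows "\<exists>D\<in>Sets. \<exists>V\<in>Sets. \<exists>S\<in>Sets.
    (\<forall>e E. msat e (case_nat S (case_nat V (case_nat D (case_nat X E)))) (SatClass 3 2 1 0)) \<and>
    nm (code a) \<in> D \<and> (\<forall>s. mpair (nm (code a)) s \<in> S \<longleftrightarrow> holds X a s)"
proof -
  define D where "D = nm ` (code_tm ` set (tms_of a) \<union> code ` set (subfms a))"
  define V where "V = {mpair (nm (code_tm t)) (mpair s v) |t s v. t \<in> set (tms_of a) \<and> denotes t s v}"
  define S where "S = {mpair (nm (code b)) s |b s. b \<in> set (subfms a) \<and> holds X b s}"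
  have D: "D \<in> Sets"
    by (rule definable[of "Ors (map (\<lambda>t. Var 0 \<^bold>= num (code_tm t)) (tms_of a) @
      map (\<lambda>b. Var 0 \<^bold>= num (code b)) (subfms a))" X _ "\<lambda>_. nm 0"]) (use X in \<open>auto simp: D_def bex_Un\<close>)
  have V: "V \<in> Sets"
    by (rule definable[of "Ors (map (\<lambda>t. ExNs 2 (Var 2 \<^bold>= num (code_tm t) \<star> Var 1 \<star> Var 0 \<^bold>\<and>
      valueF t (Var 1) (Var 0))) (tms_of a))" X _ "\<lambda>_. nm 0"]) (use X in \<open>auto simp: V_def\<close>)
  have S: "S \<in> Sets"
    by (rule definable[of "Ors (map (\<lambda>b. ExN (Var 1 \<^bold>= num (code b) \<star> Var 0 \<^bold>\<and>
      holdsF b (Var 0))) (subfms a))" X _ "\<lambda>_. nm 0"]) (use X in \<open>auto simp: S_def\<close>)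
  have mem_D: "x \<in> D \<longleftrightarrow> (\<exists>t\<in>set (tms_of a). x = nm (code_tm t)) \<or> (\<exists>b\<in>set (subfms a). x = nm (code b))" for x
    by (auto simp: D_def)
  have mem_V: "mpair x y \<in> V \<longleftrightarrow>
      (\<exists>t s v. t \<in> set (tms_of a) \<and> x = nm (code_tm t) \<and> y = mpair s v \<and> denotes t s v)" for x y
    by (auto simp: V_def)
  have mem_S: "mpair x s \<in> S \<longleftrightarrow> (\<exists>b. b \<in> set (subfms a) \<and> x = nm (code b) \<and> holds X b s)" for x s
    by (auto simp: S_def)
  have "msat e (case_nat S (case_nat V (case_nat D (case_nat X E)))) (SatClass 3 2 1 0)" for e E
    unfolding SatClass_def
    by (simp add: mem_D mem_V mem_S, intro conjI allI impI, auto dest: tms_of_closed subfms_closed)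
      blast+
  moreover have "nm (code a) \<in> D" by (simp add: mem_D self_subfms)
  moreover have "mpair (nm (code a)) s \<in> S \<longleftrightarrow> holds X a s" for s
    by (auto simp: mem_S self_subfms)
  ultimately show ?thesis using D V S by blast
qed

lemma TruePi11_sound:
  assumes "msat e E (TruePi11 x)" and "mval e x = nm (code (AllS a))"
    and a: "arithmetical a" "bounded 0 1 a" and X: "X \<in> Sets"
  shows "msat e' (case_nat X E') a"
proof -
  obtain D V S where DVS: "D \<in> Sets" "V \<in> Sets" "S \<in> Sets" and
    sat: "\<And>e E. msat e (case_nat S (case_nat V (case_nat D (case_nat X E)))) (SatClass 3 2 1 0)" and
    D: "nm (code a) \<in> D" and S: "\<And>s. mpair (nm (code a)) s \<in> S \<longleftrightarrow> holds X a s"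
    using satisfaction_class[OF a X] by blast
  have "mpair (nm (code a)) (nm 0) \<in> S"
    using assms(1,2) X DVS sat D by (simp add: TruePi11_def numeral_eq_Suc)
  then have "msat (\<lambda>_. nm 0) (case_nat X E') a"
    using S holds_msat[OF a encodes_empty, of "case_nat X E'" X] by simp
  moreover have "msat (\<lambda>_. nm 0) (case_nat X E') a \<longleftrightarrow> msat e' (case_nat X E') a"
    by (rule msat_bounded[OF a(2)]) simp_all
  ultimately show ?thesis by simp
qed

end

section \<open>The diagonal sentence\<close>

lemma arithmetical_slice [simp]: "arithmetical (slice p k a) \<longleftrightarrow> arithmetical a"
  by (induction a arbitrary: p k) auto

lemma bounded_slice: "bounded m n a \<Longrightarrow> p < m \<Longrightarrow> bounded m n (slice p k a)"
  by (induction a arbitrary: m n p k) auto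

text \<open>\<open>Pr (ExS \<theta>)\<close> with the test for axioms replaced.  Since \<open>Derivable\<close> always passes the number
  variable 0 as the current element, \<open>slice 0 0 \<theta>\<close> says that the slice of the set variable 0 at the
  current element witnesses that this element is an axiom.\<close>

definition WitnessedPr :: "fm \<Rightarrow> tm \<Rightarrow> fm" where
  "WitnessedPr \<theta> = Derivable (\<lambda>E y. Ors
    [slice 0 0 \<theta>,
     LogAx y,
     ExN (E 1 (Var 0) \<^bold>\<and> E 1 (cImp (Var 0) (y \<up> 1))),
     ExN (E 1 (Var 0) \<^bold>\<and> y \<up> 1 \<^bold>= cAllN (Var 0)),
     ExN (E 1 (Var 0) \<^bold>\<and> y \<up> 1 \<^bold>= cAllS (Var 0))])"

text \<open>Slice 0 of the set variable 0 satisfies the recursion for \<open>k \<mapsto> code_tm (num k)\<close>.  No axiom has code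
  0, so this slice is not in use as a witness; prescribing it there spares an arithmetical
  definition of the codes of numerals.\<close>

definition NumeralGraph :: fm where
  "NumeralGraph = AllNs 2 ((Var 1 \<star> Var 0) \<star> Zero \<^bold>\<in> 0 \<^bold>\<longleftrightarrow>
     (Var 1 \<^bold>= Zero \<^bold>\<and> Var 0 \<^bold>= cZero) \<^bold>\<or>
     ExNs 2 (Var 3 \<^bold>= Var 1 \<^bold>+ One \<^bold>\<and> Var 2 \<^bold>= cAdd (Var 0) cOne \<^bold>\<and> (Var 1 \<star> Var 0) \<star> Zero \<^bold>\<in> 0))"

text \<open>Here the number variable 0 is meant to be the code of this very formula.  Under the quantifier,
  \<open>Var 0\<close> is then the code of the numeral of that code, and the argument of \<open>WitnessedPr\<close> is the code
  of the sentence \<open>\<forall>X \<forall>x (x = n \<longrightarrow> a)\<close> for \<open>a\<close> with code \<open>n\<close>.  Equating a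
  variable with the numeral, rather than substituting the numeral, makes this code a term in those
  two numbers.\<close>

definition diag_open :: "fm \<Rightarrow> fm" where
  "diag_open \<theta> = (NumeralGraph \<^bold>\<longrightarrow> AllN ((Var 1 \<star> Var 0) \<star> Zero \<^bold>\<in> 0 \<^bold>\<longrightarrow>
     \<^bold>\<not> WitnessedPr \<theta> (cAllS (cAllN (cImp (cEq (cVar Zero) (Var 0)) (Var 1))))))"

definition diag_matrix :: "fm \<Rightarrow> fm" where
  "diag_matrix \<theta> = AllN (Var 0 \<^bold>= num (code (diag_open \<theta>)) \<^bold>\<longrightarrow> diag_open \<theta>)"

definition diag :: "fm \<Rightarrow> fm" where
  "diag \<theta> = AllS (diag_matrix \<theta>)"

lemma arithmetical_diag_matrix: "arithmetical \<theta> \<Longrightarrow> arithmetical (diag_matrix \<theta>)"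
  by (simp add: diag_matrix_def diag_open_def NumeralGraph_def WitnessedPr_def)

lemma bounded_diag_matrix: "bounded 1 1 \<theta> \<Longrightarrow> bounded 0 1 (diag_matrix \<theta>)"
  using bounded_mono[OF bounded_slice[of 1 1 \<theta> 0 0]]
  by (simp add: diag_matrix_def diag_open_def NumeralGraph_def WitnessedPr_def code_tms)

lemma pi11_sentence_diag: "arithmetical \<theta> \<Longrightarrow> bounded 1 1 \<theta> \<Longrightarrow> pi11_sentence (diag \<theta>)"
  using arithmetical_diag_matrix bounded_diag_matrix
  by (auto simp: pi11_sentence_def pi11_def sentence_def diag_def)

context arith_model
begin

lemma msat_slice: "msat e E (slice p k a) \<longleftrightarrow> msat e (E(k := {x. mpair x (e p) \<in> E k})) a"
proof (induction a arbitrary: e E p k)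
  case (AllS a)
  have "msat e (case_nat X E) (slice p (k + 1) a) \<longleftrightarrow>
      msat e (case_nat X (E(k := {x. mpair x (e p) \<in> E k}))) a" for X
  proof -
    have "(case_nat X E)(k + 1 := {x. mpair x (e p) \<in> case_nat X E (k + 1)})
        = case_nat X (E(k := {x. mpair x (e p) \<in> E k}))"
      by (auto simp: fun_eq_iff split: nat.split)
    then show ?thesis by (subst AllS) (simp only:)
  qed
  then show ?case by (simp del: fun_upd_apply)
qed auto

text \<open>The slices of \<open>X\<close> belong to the model by comprehension, so they are admissible values of the set
  quantifier in the definition of the axioms.\<close>

lemma Pr_if_WitnessedPr:
  assumes \<theta>: "bounded 1 1 \<theta>" and X: "X \<in> Sets"
    and eq: "mval e x = mval e' x'" and WitnessedPr: "msat e (case_nat X E) (WitnessedPr \<theta> x)"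
  shows "msat e' E' (Pr (ExS \<theta>) x')"
proof -
  have slice: "\<exists>Y\<in>Sets. msat (case_nat y f') (case_nat Y F) \<theta>"
    if "msat (case_nat y f) (case_nat X E) (slice 0 0 \<theta>)" for y f f' F
  proof (rule bexI)
    let ?Y = "{z. mpair z y \<in> X}"
    show "?Y \<in> Sets"
      by (rule definable[of "Var 0 \<star> Var 1 \<^bold>\<in> 0" X _ "\<lambda>_. y"]) (simp_all add: X)
    have "msat (case_nat y f) ((case_nat X E)(0 := ?Y)) \<theta>" using that by (simp add: msat_slice)
    then show "msat (case_nat y f') (case_nat ?Y F) \<theta>"
      by (subst msat_bounded[OF \<theta>, of _ "case_nat y f" _ "(case_nat X E)(0 := ?Y)"]) simp_all
  qed
  have LogAx: "msat (case_nat y f) F (LogAx (Var 0)) \<Longrightarrow> msat (case_nat y f') F' (LogAx (Var 0))"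
    for y f f' F F'
    by (subst msat_bounded[of 1 0 _ _ "case_nat y f" _ F]) simp_all
  show ?thesis
    using WitnessedPr unfolding WitnessedPr_def Pr_def
    by (rule Derivable_mono[OF _ eq, rotated]) (auto dest: slice LogAx)
qed

text \<open>Unfolding the recursion \<open>n\<close> times determines the value at a standard \<open>n\<close>, however the set behaves
  at nonstandard arguments.\<close>

lemma standard_numeral_code:
  assumes "msat e E NumeralGraph"
  shows "mpair (mpair (nm n) c) (nm 0) \<in> E 0 \<longleftrightarrow> c = nm (code_tm (num n))"
proof -
  have "msat e E NumeralGraph \<longleftrightarrow> (\<forall>x c. mpair (mpair x c) (nm 0) \<in> E 0 \<longleftrightarrow>
      x = nm 0 \<and> c = mpair (nm 1) (nm 0) \<or>
      (\<exists>x' c'. x = x' \<oplus> nm 1 \<and> c = mpair (nm 3) (mpair c' (mpair (nm 2) (nm 0))) \<and>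
        mpair (mpair x' c') (nm 0) \<in> E 0))"
    by (simp add: NumeralGraph_def)
  then have graph: "mpair (mpair x c) (nm 0) \<in> E 0 \<longleftrightarrow>
      x = nm 0 \<and> c = mpair (nm 1) (nm 0) \<or>
      (\<exists>x' c'. x = x' \<oplus> nm 1 \<and> c = mpair (nm 3) (mpair c' (mpair (nm 2) (nm 0))) \<and>
        mpair (mpair x' c') (nm 0) \<in> E 0)" for x c
    using assms by blast
  have succ: "nm n = x \<oplus> nm 1 \<longleftrightarrow> (\<exists>j. n = Suc j \<and> x = nm j)" for n x
    by (metis One_nat_def succ_eq_nm)
  show ?thesis
  proof (induction n arbitrary: c)
    case 0
    show ?case unfolding graph[of "nm 0" c] succ by simp
  next
    case (Suc n)
    have "mpair (mpair (nm (Suc n)) c) (nm 0) \<in> E 0 \<longleftrightarrow>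
        (\<exists>c'. c = mpair (nm 3) (mpair c' (mpair (nm 2) (nm 0))) \<and> mpair (mpair (nm n) c') (nm 0) \<in> E 0)"
      unfolding graph[of "nm (Suc n)" c] succ by auto
    then show ?case using Suc.IH by auto
  qed
qed

lemma Pr_if_not_diag:
  assumes \<theta>: "bounded 1 1 \<theta>" and X: "X \<in> Sets"
    and not: "\<not> msat e (case_nat X E) (diag_matrix \<theta>)" and x: "mval e' x = nm (code (diag \<theta>))"
  shows "msat e' E' (Pr (ExS \<theta>) x)"
proof -
  let ?n = "code (diag_open \<theta>)"
  obtain c where graph: "msat (case_nat (nm ?n) e) (case_nat X E) NumeralGraph"
    and c: "mpair (mpair (nm ?n) c) (nm 0) \<in> X"
    and WitnessedPr: "msat (case_nat c (case_nat (nm ?n) e)) (case_nat X E)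
      (WitnessedPr \<theta> (cAllS (cAllN (cImp (cEq (cVar Zero) (Var 0)) (Var 1)))))"
    using not unfolding diag_matrix_def by (simp add: diag_open_def[of \<theta>] del: code_tms) blast
  have "c = nm (code_tm (num ?n))"
    using standard_numeral_code[OF graph] c by simp
  then show ?thesis
    using x by (intro Pr_if_WitnessedPr[OF \<theta> X _ WitnessedPr]) (simp add: diag_def diag_matrix_def)
qed

text \<open>The heart of the argument: in a model of reflection a counterexample to \<open>diag \<theta>\<close> would make
  \<open>diag \<theta>\<close> provable, hence true.\<close>

lemma reflection_implies_diag:
  assumes \<theta>: "arithmetical \<theta>" "bounded 1 1 \<theta>" and RFN: "valid (RFN_Pi11 (ExS \<theta>))"
  shows "valid (diag \<theta>)"
  unfolding valid_def
proof (intro allI impI)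
  fix e :: "nat \<Rightarrow> 'a" and E :: "nat \<Rightarrow> 'a set"
  assume E: "range E \<subseteq> Sets"
  have "msat e (case_nat X E) (diag_matrix \<theta>)" if X: "X \<in> Sets" for X
  proof (rule ccontr)
    assume not: "\<not> msat e (case_nat X E) (diag_matrix \<theta>)"
    let ?e = "case_nat (nm (code (diag \<theta>))) e"
    have x: "mval ?e (Var 0) = nm (code (AllS (diag_matrix \<theta>)))" by (simp add: diag_def)
    note matrix = arithmetical_diag_matrix[OF \<theta>(1)] bounded_diag_matrix[OF \<theta>(2)]
    have "msat ?e E (Pi11Sent (Var 0) \<^bold>\<longrightarrow> Pr (ExS \<theta>) (Var 0) \<^bold>\<longrightarrow> TruePi11 (Var 0))"
      using RFN E by (simp add: RFN_Pi11_def valid_def)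
    moreover have "msat ?e E (Pi11Sent (Var 0))" by (rule Pi11Sent_code[OF matrix x])
    moreover have "msat ?e E (Pr (ExS \<theta>) (Var 0))"
      using x by (intro Pr_if_not_diag[OF \<theta>(2) X not]) (simp add: diag_def)
    ultimately have "msat ?e E (TruePi11 (Var 0))" by simp
    then show False using TruePi11_sound[OF _ x matrix X] not by blast
  qed
  then show "msat e E (diag \<theta>)" by (simp add: diag_def)
qed

end

section \<open>The standard model\<close>

text \<open>The unit is given as \<open>Suc 0\<close>, the form to which the simplifier takes 1, so that its rules apply to
  the interpreted constants.\<close>

interpretation standard: l2_structure "0 :: nat" "Suc 0" "(+)" "(*)" "(<)" UNIV
  by unfold_locales simp

lemma standard_mval: "standard.mval e t = val e t"
  by (induction t) simp_all

lemma standard_msat: "standard.msat e E a \<longleftrightarrow> sat e E a"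
  by (induction a arbitrary: e E) (simp_all add: standard_mval)

interpretation standard: arith_model "0 :: nat" "Suc 0" "(+)" "(*)" "(<)" UNIV
proof
  fix a assume "a \<in> ACA0"
  then consider (basic) "a \<in> basic_axioms" | (induction) "a = induction_axiom"
    | (comprehension) b where "a = ExS (AllN (Var 0 \<^bold>\<in> 0 \<^bold>\<longleftrightarrow> liftS 0 b))"
    unfolding ACA0_def by blast
  then show "standard.valid a"
  proof cases
    case basic
    then show ?thesis by (auto simp: basic_axioms_def standard.valid_def less_Suc_eq)
  next
    case induction
    have "x \<in> X" if "0 \<in> X" "\<forall>x. x \<in> X \<longrightarrow> Suc x \<in> X" for x and X :: "nat set"
      using that(1) by (rule nat_induct) (simp add: that(2))
    note ind = this
    show ?thesis unfolding induction induction_axiom_def standard.valid_def by simp (blast intro: ind)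
  next
    case comprehension
    have "\<exists>X. \<forall>x. x \<in> X \<longleftrightarrow> P x" for P :: "nat \<Rightarrow> bool"
      by (rule exI[of _ "{x. P x}"]) simp
    then show ?thesis unfolding comprehension by (simp add: standard.valid_def)
  qed
qed

lemma standard_nm [simp]: "standard.nm n = n"
  by (induction n) (simp_all add: standard.nm.simps)

lemma standard_mpair [simp]: "standard.mpair x y = pair x y"
  by (simp add: standard.mpair_def pair_def)

text \<open>A proof in \<open>T\<close> is turned step by step into a coded proof whose axioms are witnessed by the slices
  of \<open>Y\<close>.\<close>

lemma standard_WitnessedPr:
  assumes W: "\<And>a. a \<in> T \<Longrightarrow> sat (\<lambda>_. code a) (case_nat {x. pair x (code a) \<in> Y} E) \<theta>"
    and \<theta>: "bounded 1 1 \<theta>" and "T \<turnstile> a" and x: "val e x = code a"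
  shows "sat e (case_nat Y E) (WitnessedPr \<theta> x)"
proof -
  have slice: "standard.msat (case_nat (code a) f) (case_nat Y E) (slice 0 0 \<theta>)" if "a \<in> T" for a f
  proof -
    have "standard.msat (\<lambda>_. code a) (case_nat {x. pair x (code a) \<in> Y} E) \<theta>"
      using W[OF that] by (simp add: standard_msat)
    then show ?thesis
      unfolding standard.msat_slice
      by (subst standard.msat_bounded[OF \<theta>, of _ "\<lambda>_. code a" _ "case_nat {x. pair x (code a) \<in> Y} E"]) simp_all
  qed
  have "standard.msat e (case_nat Y E) (WitnessedPr \<theta> x)"
    unfolding WitnessedPr_def
  proof (rule standard.Derivable_if_derivable)
    show "standard.mval e x = standard.nm (code a)" using x by (simp add: standard_mval)
    show "standard.derivable (\<lambda>E y. Ors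
       [slice 0 0 \<theta>,
        LogAx y,
        ExN (E 1 (Var 0) \<^bold>\<and> E 1 (cImp (Var 0) (y \<up> 1))),
        ExN (E 1 (Var 0) \<^bold>\<and> y \<up> 1 \<^bold>= cAllN (Var 0)),
        ExN (E 1 (Var 0) \<^bold>\<and> y \<up> 1 \<^bold>= cAllS (Var 0))]) (case_nat Y E) (code a)"
      using assms(3)
    proof (induction a)
      case (ax a)
      then show ?case by (intro standard.derivableI[of "[]"]) (simp_all add: slice)
    next
      case (logical a)
      then show ?case by (intro standard.derivableI[of "[]"]) (simp_all add: standard.LogAx_code)
    next
      case (mp a b)
      then show ?case
        by (intro standard.derivableI[of "[code a, code (a \<^bold>\<longrightarrow> b)]"]) (auto simp: code_tms)
    next
      case (genN a)
      then show ?case by (intro standard.derivableI[of "[code a]"]) (auto simp: code_tms)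
    next
      case (genS a)
      then show ?case by (intro standard.derivableI[of "[code a]"]) (auto simp: code_tms)
    qed
  qed
  then show ?thesis by (simp add: standard_msat)
qed

lemma code_pos: "code a \<noteq> 0"
  by (cases a) (simp_all add: pair_def)

text \<open>The set \<open>Y\<close> has a witness for the axiom with code \<open>n\<close> as its slice \<open>n\<close>, and the codes of the
  numerals as its slice 0; so it witnesses a proof of \<open>diag \<theta>\<close> and refutes what \<open>diag \<theta>\<close> says.\<close>

lemma provable_diag_false:
  assumes \<tau>: "defines_axioms (ExS \<theta>) T" and \<theta>: "bounded 1 1 \<theta>" and "T \<turnstile> diag \<theta>"
  shows "\<not> true_N (diag \<theta>)"
proof -
  have "\<forall>n\<in>code ` T. \<exists>X. sat (\<lambda>_. n) (case_nat X (\<lambda>_. {})) \<theta>"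
  proof
    fix n assume "n \<in> code ` T"
    then have "standard.msat (\<lambda>_. n) (\<lambda>_. {}) (ExS \<theta>)" using \<tau> by (simp add: defines_axioms_def standard_msat)
    then show "\<exists>X. sat (\<lambda>_. n) (case_nat X (\<lambda>_. {})) \<theta>" by (simp add: standard_msat[symmetric])
  qed
  then obtain W where W: "\<And>n. n \<in> code ` T \<Longrightarrow> sat (\<lambda>_. n) (case_nat (W n) (\<lambda>_. {})) \<theta>"
    by metis
  define Y where "Y = {pair i n |i n. n \<in> code ` T \<and> i \<in> W n} \<union>
    {pair (pair k (code_tm (num k))) 0 |k. True}"
  have Y0: "pair (pair k c) 0 \<in> Y \<longleftrightarrow> c = code_tm (num k)" for k c
    by (auto simp: Y_def code_pos)
  have Ya: "{x. pair x (code a) \<in> Y} = W (code a)" if "a \<in> T" for a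
    using that by (auto simp: Y_def code_pos)
  let ?n = "code (diag_open \<theta>)"
  let ?E = "case_nat Y (\<lambda>_. {})"
  let ?e = "case_nat (code_tm (num ?n)) (case_nat ?n (\<lambda>_. 0))"
  have WitnessedPr: "standard.msat ?e ?E (WitnessedPr \<theta> (cAllS (cAllN (cImp (cEq (cVar Zero) (Var 0)) (Var 1)))))"
    unfolding standard_msat
    by (rule standard_WitnessedPr[OF _ \<theta> assms(3)])
      (simp_all add: Ya W standard_mval[symmetric] code_tms diag_def diag_matrix_def)
  have "k = 0 \<and> c = code_tm Zero \<or> (\<exists>k' c'. k = k' + 1 \<and> c = pair 3 (pair c' (code_tm One)) \<and>
      c' = code_tm (num k')) \<longleftrightarrow> c = code_tm (num k)" for k c
    by (cases k) auto
  then have "standard.msat (case_nat ?n (\<lambda>_. 0)) ?E NumeralGraph"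
    by (simp add: NumeralGraph_def code_tms Y0)
  then have "\<not> standard.msat (case_nat ?n (\<lambda>_. 0)) ?E (diag_open \<theta>)"
    using WitnessedPr Y0 unfolding diag_open_def by (simp add: Y0)
  then have "\<not> standard.msat (\<lambda>_. 0) (\<lambda>_. {}) (diag \<theta>)" by (auto simp: diag_def diag_matrix_def)
  then show ?thesis by (simp add: true_N_def standard_msat)
qed

section \<open>Unprovability of \<open>\<Pi>\<^sup>1\<^sub>1\<close> soundness\<close>

theorem theorem1p3:
  fixes T :: "fm set" and \<tau> :: fm
  assumes "extends T Sigma11_AC0"
    and "pi11_sound T"
    and "sigma11_definition \<tau> T"
  shows "\<not> (T \<turnstile> RFN_Pi11 \<tau>)"
proof
  assume RFN: "T \<turnstile> RFN_Pi11 \<tau>"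
  obtain \<theta> where \<theta>: "arithmetical \<theta>" "bounded 1 1 \<theta>" and \<tau>: "\<tau> = ExS \<theta>"
    using assms(3) by (auto simp: sigma11_definition_def sigma11_def)
  have ACA0: "T \<turnstile> a" if "a \<in> ACA0" for a
    using assms(1) that by (simp add: extends_def Sigma11_AC0_def)
  have "T \<turnstile> diag \<theta>"
  proof (rule ccontr)
    assume "\<not> (T \<turnstile> diag \<theta>)"
    moreover have "T \<turnstile> \<^bold>\<not> (Var 0 \<^bold>+ One \<^bold>= Zero)"
      and "T \<turnstile> Var 0 \<^bold>+ One \<^bold>= Var 1 \<^bold>+ One \<^bold>\<longrightarrow> Var 0 \<^bold>= Var 1"
      by (intro ACA0; simp add: ACA0_def basic_axioms_def)+
    ultimately obtain zero one plus times less and Sets :: "nat set set"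
      where "l2_structure Sets"
      and valid: "\<And>a. T \<turnstile> a \<Longrightarrow> l2_structure.valid zero one plus times less Sets a"
      and not: "\<not> l2_structure.valid zero one plus times less Sets (diag \<theta>)"
      using completeness[of T "diag \<theta>"] by blast
    interpret arith_model zero one plus times less Sets
      using \<open>l2_structure Sets\<close> valid ACA0
      by (simp add: arith_model_def arith_model_axioms_def)
    show False using not valid[OF RFN] reflection_implies_diag[OF \<theta>] \<tau> by blast
  qed
  moreover from this have "true_N (diag \<theta>)"
    using assms(2) pi11_sentence_diag[OF \<theta>] by (simp add: pi11_sound_def)
  ultimately show False
    using provable_diag_false[of \<theta> T] assms(3) \<theta>(2) \<tau> by (simp add: sigma11_definition_def)
qed

end
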